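(* Let $T>0$, let $A\in\mathbb C^{N\times N}$ satisfy $A=A^*\ge0$, let $B\in\mathbb C^{N\times\ell}$, and assume $\operatorname{rank}[\lambda I_N-A\mid B]=N$ for all $\lambda\in\sigma(A)$. Then for every $(u^0,u^1)\in\mathcal X^3\times\mathcal X^1$ there is a control $f\in H_0^2(0,T;\mathbb C^\ell)$ such that the solution $u$ of $$u_{tt}+L^2u+2Lu_t+Au=0\ \text{ in }(0,\pi)\times(0,T),\qquad u(0,t)=u_{xx}(0,t)=0,\quad u(\pi,t)=Bf(t),\ u_{xx}(\pi,t)=0,\qquad u(\cdot,0)=u^0,\ u_t(\cdot,0)=u^1$$ satisfies $u(\cdot,T)=0$ and $u_t(\cdot,T)=0$, and $$\|f\|_{H^2(0,T;\mathbb C^\ell)}\le C_T\left(\|u^0\|_{\mathcal X^3}+\|u^1\|_{\mathcal X^1}\right),$$ with $C_T$ independent of $(u^0,u^1)$.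
   Context: $L=-\partial_{xx}$ is the Dirichlet Laplacian in $L^2(0,\pi)$, with eigenfunctions $\varphi_m(x)=\sqrt{2/\pi}\,\sin(mx)$, $L\varphi_m=m^2\varphi_m$, $m\ge1$. For $s\in\mathbb R$, $X^s=\{y=\sum_{m\ge1}y_m\varphi_m:\ \|y\|_{X^s}^2:=\sum_m m^{2s}|y_m|^2<\infty\}$ (for $s<0$ the spectral completion), and $\mathcal X^s:=(X^s)^N$. $H_0^2(0,T;\mathbb C^\ell)=\{f\in H^2(0,T;\mathbb C^\ell): f(0)=f'(0)=f(T)=f'(T)=0\}$. Solutions: for $f\in H^2(0,T;\mathbb C^\ell)$ with $f(0)=f'(0)=0$, the solution is $u=hBf+v$ with $h(x)=x/\pi$, where $v\in C([0,T];\mathcal X^3)\cap C^1([0,T];\mathcal X^1)$ is the solution, with homogeneous hinged boundary conditions, of $v_{tt}+L^2v+2Lv_t+Av=-h(Bf''+ABf)$, $(v(0),v_t(0))=(u^0,u^1)$. Equivalently, the Fourier coefficients $v_m(t)\in\mathbb C^N$ of $v$ with respect to $\varphi_m$ satisfy $v_m''+2m^2v_m'+m^4v_m+Av_m=-x_m(Bf''+ABf)$ with $x_m=(-1)^{m+1}\sqrt{2/\pi}\,m^{-1}$, and with initial values the Fourier coefficients of $u^0,u^1$. *)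

theory Defs
  imports "HOL-Analysis.Analysis"
begin

section \<open>Matrices\<close>

definition conj_transpose :: "complex^'n^'m \<Rightarrow> complex^'m^'n" where
  "conj_transpose A = (\<chi> i j. cnj (A $ j $ i))"

definition pos_semidef :: "complex^'n^'n \<Rightarrow> bool" where
  "pos_semidef A \<longleftrightarrow>
     A = conj_transpose A \<and> (\<forall>z. 0 \<le> Re (\<Sum>i\<in>UNIV. cnj (z $ i) * (A *v z) $ i))"

definition spectrum :: "complex^'n^'n \<Rightarrow> complex set" where
  "spectrum A = {lam. \<exists>z. z \<noteq> 0 \<and> A *v z = lam *s z}"

text \<open>The block matrix with the columns of \<open>M\<close> followed by those of \<open>B\<close>;
  columns are indexed by the disjoint sum of the two column index types.\<close>

definition hcat :: "'a^'n^'k \<Rightarrow> 'a^'l^'k \<Rightarrow> 'a^('n + 'l)^'k" where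
  "hcat M B = (\<chi> i j. case j of Inl p \<Rightarrow> M $ i $ p | Inr q \<Rightarrow> B $ i $ q)"


section \<open>Function spaces\<close>

text \<open>Elements of \<open>L\<^sup>2\<close> spaces are represented by functions; equality of elements is equality almost
  everywhere.\<close>

definition sq_integrable :: "real measure \<Rightarrow> (real \<Rightarrow> 'a::euclidean_space) \<Rightarrow> bool" where
  "sq_integrable M f \<longleftrightarrow> f \<in> borel_measurable M \<and> integrable M (\<lambda>x. (norm (f x))\<^sup>2)"

abbreviation Omega :: "real measure" where
  "Omega \<equiv> lebesgue_on {0<..<pi}"

definition phi :: "nat \<Rightarrow> real \<Rightarrow> real" where
  "phi m x = sqrt (2 / pi) * sin (real m * x)"

definition coef :: "nat \<Rightarrow> (real \<Rightarrow> 'a::euclidean_space) \<Rightarrow> 'a" where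
  "coef m y = (LINT x|Omega. phi m x *\<^sub>R y x)"

text \<open>The spectral spaces for \<open>s \<ge> 0\<close>, where they are subspaces of \<open>L\<^sup>2(0,\<pi>)\<close>. For values in
  \<open>\<complex>\<^sup>N\<close> this is the product space \<open>(X\<^sup>s)\<^sup>N\<close> with the Hilbert product norm. The last conjunct is
  \<open>y = \<Sum>\<^sub>m y\<^sub>m \<phi>\<^sub>m\<close> in \<open>L\<^sup>2(0,\<pi>)\<close>.\<close>

definition Xs :: "real \<Rightarrow> (real \<Rightarrow> 'a::euclidean_space) set" where
  "Xs s = {y. sq_integrable Omega y \<and>
     (\<lambda>m. real m powr (2 * s) * (norm (coef m y))\<^sup>2) summable_on {1..} \<and>
     (\<lambda>M. LINT x|Omega. (norm (y x - (\<Sum>m=1..M. phi m x *\<^sub>R coef m y)))\<^sup>2) \<longlonglongrightarrow> 0}"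

definition Xs_norm :: "real \<Rightarrow> (real \<Rightarrow> 'a::euclidean_space) \<Rightarrow> real" where
  "Xs_norm s y = sqrt (\<Sum>\<^sub>\<infinity>m\<in>{1..}. real m powr (2 * s) * (norm (coef m y))\<^sup>2)"

definition C0_Xs :: "real \<Rightarrow> real \<Rightarrow> (real \<Rightarrow> real \<Rightarrow> 'a::euclidean_space) \<Rightarrow> bool" where
  "C0_Xs T s v \<longleftrightarrow> (\<forall>t\<in>{0..T}. v t \<in> Xs s \<and>
     ((\<lambda>r. Xs_norm s (\<lambda>x. v r x - v t x)) \<longlongrightarrow> 0) (at t within {0..T}))"

text \<open>\<open>v \<in> C\<^sup>1([0,T]; X\<^sup>s)\<close> with time derivative \<open>w\<close>.\<close>

definition C1_Xs ::
  "real \<Rightarrow> real \<Rightarrow> (real \<Rightarrow> real \<Rightarrow> 'a::euclidean_space) \<Rightarrow> (real \<Rightarrow> real \<Rightarrow> 'a) \<Rightarrow> bool" where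
  "C1_Xs T s v w \<longleftrightarrow> C0_Xs T s v \<and> C0_Xs T s w \<and>
     (\<forall>t\<in>{0..T}.
        ((\<lambda>r. Xs_norm s (\<lambda>x. (v r x - v t x) /\<^sub>R (r - t) - w t x)) \<longlongrightarrow> 0) (at t within {0..T}))"

text \<open>\<open>f \<in> H\<^sup>2(0,T)\<close>, taken as its \<open>C\<^sup>1\<close> representative on \<open>[0,T]\<close>, with classical first derivative
  \<open>f1\<close> which is absolutely continuous with derivative \<open>f2 \<in> L\<^sup>2(0,T)\<close>; \<open>f2\<close> is determined almost
  everywhere.\<close>

definition H2 ::
  "real \<Rightarrow> (real \<Rightarrow> 'a::euclidean_space) \<Rightarrow> (real \<Rightarrow> 'a) \<Rightarrow> (real \<Rightarrow> 'a) \<Rightarrow> bool" where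
  "H2 T f f1 f2 \<longleftrightarrow>
     sq_integrable (lebesgue_on {0..T}) f2 \<and>
     (\<forall>t\<in>{0..T}. (f has_vector_derivative f1 t) (at t within {0..T})) \<and>
     (\<forall>t\<in>{0..T}. f1 t = f1 0 + (LINT r|lebesgue_on {0..t}. f2 r))"

definition H2_zero ::
  "real \<Rightarrow> (real \<Rightarrow> 'a::euclidean_space) \<Rightarrow> (real \<Rightarrow> 'a) \<Rightarrow> (real \<Rightarrow> 'a) \<Rightarrow> bool" where
  "H2_zero T f f1 f2 \<longleftrightarrow> H2 T f f1 f2 \<and> f 0 = 0 \<and> f1 0 = 0 \<and> f T = 0 \<and> f1 T = 0"

definition H2_norm ::
  "real \<Rightarrow> (real \<Rightarrow> 'a::euclidean_space) \<Rightarrow> (real \<Rightarrow> 'a) \<Rightarrow> (real \<Rightarrow> 'a) \<Rightarrow> real" where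
  "H2_norm T f f1 f2 =
     sqrt (LINT t|lebesgue_on {0..T}. (norm (f t))\<^sup>2 + (norm (f1 t))\<^sup>2 + (norm (f2 t))\<^sup>2)"


section \<open>The controlled plate system\<close>

text \<open>\<open>u - h B f\<close> with \<open>h(x) = x / \<pi>\<close>, and the Fourier coefficients of \<open>h\<close>.\<close>

definition unlift ::
  "complex^'l^'n \<Rightarrow> (real \<Rightarrow> complex^'l) \<Rightarrow> (real \<Rightarrow> real \<Rightarrow> complex^'n)
     \<Rightarrow> real \<Rightarrow> real \<Rightarrow> complex^'n" where
  "unlift B f u = (\<lambda>t x. u t x - (x / pi) *\<^sub>R (B *v f t))"

definition hcoef :: "nat \<Rightarrow> real" where
  "hcoef m = (-1) ^ (m + 1) * sqrt (2 / pi) / real m"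

text \<open>\<open>u\<close>, with time derivative \<open>ut\<close>, is the solution with initial data \<open>u0, u1\<close> for the control \<open>f\<close>
  (with derivatives \<open>f1, f2\<close>; \<open>f 0 = f1 0 = 0\<close>): \<open>u = h B f + v\<close> and \<open>u\<^sub>t = h B f' + w\<close>, where
  \<open>v\<close> and \<open>w = v\<^sub>t\<close> have the required regularity and the equation
  \<open>v\<^sub>t\<^sub>t + L\<^sup>2 v + 2 L v\<^sub>t + A v = - h (B f'' + A B f)\<close> with homogeneous hinged boundary conditions holds
  for the coefficients with respect to \<open>\<phi>\<^sub>m\<close>. As \<open>f''\<close> is only in \<open>L\<^sup>2(0,T)\<close>, each of these
  second-order equations is satisfied in \<open>H\<^sup>2(0,T)\<close>, i.e. almost everywhere.\<close>

definition is_solution ::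
  "real \<Rightarrow> complex^'n^'n \<Rightarrow> complex^'l^'n \<Rightarrow> (real \<Rightarrow> complex^'n) \<Rightarrow> (real \<Rightarrow> complex^'n)
     \<Rightarrow> (real \<Rightarrow> complex^'l) \<Rightarrow> (real \<Rightarrow> complex^'l) \<Rightarrow> (real \<Rightarrow> complex^'l)
     \<Rightarrow> (real \<Rightarrow> real \<Rightarrow> complex^'n) \<Rightarrow> (real \<Rightarrow> real \<Rightarrow> complex^'n) \<Rightarrow> bool" where
  "is_solution T A B u0 u1 f f1 f2 u ut \<longleftrightarrow>
     (let v = unlift B f u; w = unlift B f1 ut in
        C0_Xs T 3 v \<and> C1_Xs T 1 v w \<and>
        (AE x in Omega. v 0 x = u0 x) \<and> (AE x in Omega. w 0 x = u1 x) \<and>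
        (\<forall>m\<ge>1. H2 T (\<lambda>t. coef m (v t)) (\<lambda>t. coef m (w t))
           (\<lambda>t. - (2 * (real m)\<^sup>2) *\<^sub>R coef m (w t) - (real m ^ 4) *\<^sub>R coef m (v t)
                - A *v coef m (v t) - hcoef m *\<^sub>R (B *v f2 t + A *v (B *v f t)))))"

end

theory Submission
  imports Defs
begin

text \<open>
Expansion in the sine basis and splitting of $\mathbb C^N$ into the eigenspaces of \<open>A\<close>, with eigenvalues
$\theta^2 \ge 0$, reduce the plate to scalar equations
$u'' + 2m^2u' + (m^4 + \theta^2)u = x_m(2m^2F' + m^4F)$, where \<open>F\<close> is a component of \<open>B f\<close>. The characteristic
exponents are $-m^2 \pm i\theta$. Integrating against the adjoint solutions shows that all
modes are at rest at time \<open>T\<close> as soon as the moments of \<open>f\<close> against $e^{(m^2 \pm i\theta)t}$ have certain values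
given by the data; for $\theta = 0$ the two exponents coincide and the moment against $t e^{m^2t}$ is
prescribed as well (\<open>steered_to_zero\<close>, \<open>coefficients_vanish\<close>). By the Hautus condition \<open>B\<close> reaches every
direction of every eigenspace (\<open>hautus_right_inverse\<close>), so that a scalar family biorthogonal
to these exponentials solves the vector problem (\<open>moment_problem\<close>).

The biorthogonal family comes from an elementary device. The operator
$f \mapsto f - e^{-\lambda\tau} f(\cdot - \tau)$ annihilates the moment with exponent $\lambda$, extends the
support by $\tau$ only, and enlarges sup norms by a factor of at most $1 + e^{-\mathrm{Re}\,\lambda\,\tau}$. For
exponents with real part $m^2$ take $\tau_m = c\, m^{-3/2}$. Then $\sum\tau_m$ is as small as desired and
$\sum e^{-m^2\tau_m}$ converges. The infinite product of these operators over all exponents except one is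
therefore bounded; it turns a bump function into a function of class $C^2$ with support inside $(0,T)$ for which
only the moment at the spared exponent survives (\<open>annihilating_shift_product\<close>). At level \<open>n\<close> the product
multiplies this moment by a factor not smaller than $e^{-Cn^{3/2}}$, whereas for a bump near $2T/3$ it was at least of size $e^{2n^2T/3}$ before.
After normalisation the family decays like $e^{-\varepsilon n^2}$ (\<open>biorthogonal_family\<close>). Hence the series
for the control converges in $C^2$ for every \<open>T > 0\<close>, bounded by the norms of the data.

Existence of the solution is explicit: each mode factors into two first-order equations
(\<open>second_order_ode\<close>), each of which gains a factor $m^{-2}$, and the resulting sine series
converge in the required spaces (\<open>solution_exists\<close>).
\<close>

section \<open>Twice differentiable functions with compact support\<close>

text \<open>A function is carried together with its first two derivatives as \<open>F 0\<close>, \<open>F 1\<close>, \<open>F 2\<close>. Linear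
operations, shifts and series then act on all three components by the same formula, and one constant
\<open>M\<close> controls the $C^2$ norm, which is stronger than the $H^2$ norm of the control. The support
condition uses the open interval, so that everything vanishes at both end points.\<close>

definition C2_jet ::
    "real \<Rightarrow> real \<Rightarrow> real \<Rightarrow> (nat \<Rightarrow> real \<Rightarrow> 'a::euclidean_space) \<Rightarrow> bool" where
  "C2_jet a b M F \<longleftrightarrow>
     (\<forall>k<2. \<forall>t. (F k has_vector_derivative F (Suc k) t) (at t)) \<and>
     continuous_on UNIV (F 2) \<and>
     (\<forall>k\<le>2. \<forall>t. norm (F k t) \<le> M) \<and>
     (\<forall>k\<le>2. \<forall>t. t \<notin> {a<..<b} \<longrightarrow> F k t = 0)"

lemma C2_jetI:
  assumes "\<And>k t. k < 2 \<Longrightarrow> (F k has_vector_derivative F (Suc k) t) (at t)"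
    and "continuous_on UNIV (F 2)"
    and "\<And>k t. k \<le> 2 \<Longrightarrow> norm (F k t) \<le> M"
    and "\<And>k t. k \<le> 2 \<Longrightarrow> t \<notin> {a<..<b} \<Longrightarrow> F k t = 0"
  shows "C2_jet a b M F"
  using assms unfolding C2_jet_def by blast

lemma C2_jetD:
  assumes "C2_jet a b M F"
  shows C2_jet_deriv: "\<And>k t. k < 2 \<Longrightarrow> (F k has_vector_derivative F (Suc k) t) (at t)"
    and C2_jet_bound: "\<And>k t. k \<le> 2 \<Longrightarrow> norm (F k t) \<le> M"
    and C2_jet_zero: "\<And>k t. k \<le> 2 \<Longrightarrow> t \<notin> {a<..<b} \<Longrightarrow> F k t = 0"
  using assms unfolding C2_jet_def by blast+

lemma C2_jet_nonneg: "C2_jet a b M F \<Longrightarrow> 0 \<le> M"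
  using C2_jet_bound[of a b M F 0 0] norm_ge_zero[of "F 0 0"] by linarith

lemma C2_jet_continuous:
  assumes "C2_jet a b M F" "k \<le> 2"
  shows "continuous_on S (F k)"
proof (cases "k = 2")
  case True
  then show ?thesis using assms continuous_on_subset unfolding C2_jet_def by blast
next
  case False
  then have "k < 2" using assms by simp
  then show ?thesis
    using C2_jet_deriv[OF assms(1)] has_vector_derivative_continuous
    by (metis continuous_at_imp_continuous_on)
qed

lemma C2_jet_mono:
  assumes "C2_jet a b M F" "a' \<le> a" "b \<le> b'" "M \<le> M'"
  shows "C2_jet a' b' M' F"
proof (rule C2_jetI)
  fix k t assume k: "k \<le> (2::nat)"
  show "norm (F k t) \<le> M'" using C2_jet_bound[OF assms(1) k, of t] assms(4) by linarith
  show "F k t = 0" if "t \<notin> {a'<..<b'}"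
    by (rule C2_jet_zero[OF assms(1) k]) (use that assms in auto)
qed (use assms(1) in \<open>auto simp: C2_jet_def\<close>)

lemma C2_jet_add:
  assumes "C2_jet a b M F" "C2_jet a b N G"
  shows "C2_jet a b (M + N) (\<lambda>k t. F k t + G k t)"
proof (rule C2_jetI)
  fix k t assume k: "k < (2::nat)"
  show "((\<lambda>t. F k t + G k t) has_vector_derivative F (Suc k) t + G (Suc k) t) (at t)"
    by (intro has_vector_derivative_add C2_jet_deriv[OF assms(1)] C2_jet_deriv[OF assms(2)] k)
next
  show "continuous_on UNIV (\<lambda>t. F 2 t + G 2 t)"
    by (intro continuous_on_add C2_jet_continuous[OF assms(1)] C2_jet_continuous[OF assms(2)]) auto
next
  fix k t assume k: "k \<le> (2::nat)"
  show "norm (F k t + G k t) \<le> M + N"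
    by (intro norm_add_rule_thm C2_jet_bound[OF assms(1)] C2_jet_bound[OF assms(2)] k)
qed (simp add: C2_jet_zero[OF assms(1)] C2_jet_zero[OF assms(2)])

lemma C2_jet_linear:
  assumes "C2_jet a b M F" "bounded_linear L" and K: "\<And>z. norm (L z) \<le> norm z * K" and "K \<ge> 0"
  shows "C2_jet a b (M * K) (\<lambda>k t. L (F k t))"
proof (rule C2_jetI)
  interpret bounded_linear L by fact
  fix k t assume k: "k < (2::nat)"
  show "((\<lambda>t. L (F k t)) has_vector_derivative L (F (Suc k) t)) (at t)"
    by (rule bounded_linear.has_vector_derivative[OF assms(2) C2_jet_deriv[OF assms(1) k]])
next
  interpret bounded_linear L by fact
  show "continuous_on UNIV (\<lambda>t. L (F 2 t))"
    by (intro continuous_on C2_jet_continuous[OF assms(1)]) auto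
next
  interpret bounded_linear L by fact
  fix k t assume k: "k \<le> (2::nat)"
  have "norm (L (F k t)) \<le> norm (F k t) * K" by (rule K)
  also have "\<dots> \<le> M * K" by (intro mult_right_mono C2_jet_bound[OF assms(1) k] \<open>K \<ge> 0\<close>)
  finally show "norm (L (F k t)) \<le> M * K" .
next
  interpret bounded_linear L by fact
  fix k t assume "k \<le> (2::nat)" "t \<notin> {a<..<b}"
  then show "L (F k t) = 0" by (simp add: C2_jet_zero[OF assms(1)] zero)
qed

lemma C2_jet_scale:
  fixes c :: complex
  assumes "C2_jet a b M F"
  shows "C2_jet a b (M * norm c) (\<lambda>k t. c * F k t)"
  by (rule C2_jet_linear[OF assms bounded_linear_mult_right]) (simp_all add: norm_mult mult.commute)

lemma C2_jet_const_zero: "C2_jet a b 0 (\<lambda>k t. 0)"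
  by (rule C2_jetI) auto

lemma C2_jet_sum:
  assumes "finite I" "\<And>i. i \<in> I \<Longrightarrow> C2_jet a b (M i) (F i)"
  shows "C2_jet a b (\<Sum>i\<in>I. M i) (\<lambda>k t. \<Sum>i\<in>I. F i k t)"
  using assms
proof (induction I rule: finite_induct)
  case empty
  then show ?case by (simp add: C2_jet_const_zero)
next
  case (insert x I)
  have "C2_jet a b (M x + (\<Sum>i\<in>I. M i)) (\<lambda>k t. F x k t + (\<Sum>i\<in>I. F i k t))"
    by (rule C2_jet_add) (use insert in auto)
  then show ?case using insert by simp
qed

text \<open>The space of jets supported in a fixed interval is complete. This turns the infinite products and the
series over all modes below into controls.\<close>

lemma C2_jet_suminf:
  fixes F :: "nat \<Rightarrow> nat \<Rightarrow> real \<Rightarrow> 'a::euclidean_space"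
  assumes F: "\<And>n. C2_jet a b (M n) (F n)" and M: "summable M"
  shows "C2_jet a b (suminf M) (\<lambda>k t. \<Sum>n. F n k t)"
proof (rule C2_jetI)
  have sm: "summable (\<lambda>n. F n k t)" if "k \<le> 2" for k t
    by (rule summable_comparison_test'[OF M]) (use C2_jet_bound[OF F that] in auto)
  have ul: "uniform_limit UNIV (\<lambda>n t. \<Sum>i<n. F i k t) (\<lambda>t. \<Sum>n. F n k t) sequentially"
    if "k \<le> 2" for k
    by (rule Weierstrass_m_test[OF _ M]) (use C2_jet_bound[OF F that] in auto)
  show "continuous_on UNIV (\<lambda>t. \<Sum>n. F n 2 t)"
    by (rule uniform_limit_theorem[OF _ ul])
       (auto intro!: always_eventually continuous_on_sum C2_jet_continuous[OF F])
  show "norm (\<Sum>n. F n k t) \<le> suminf M" if k: "k \<le> 2" for k t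
  proof -
    have s: "summable (\<lambda>n. norm (F n k t))"
      by (rule summable_comparison_test'[OF M]) (use C2_jet_bound[OF F k] in auto)
    have "norm (\<Sum>n. F n k t) \<le> (\<Sum>n. norm (F n k t))" by (rule summable_norm[OF s])
    also have "\<dots> \<le> suminf M" by (intro suminf_le C2_jet_bound[OF F k] s M)
    finally show ?thesis .
  qed
  show "(\<Sum>n. F n k t) = 0" if "k \<le> 2" "t \<notin> {a<..<b}" for k t
    by (simp add: C2_jet_zero[OF F that])
  fix k t assume k: "k < (2::nat)"
  have "\<exists>g. \<forall>x\<in>UNIV. (\<lambda>n. F n k x) sums (g x) \<and>
          (g has_derivative (\<lambda>h. h *\<^sub>R (\<Sum>n. F n (Suc k) x))) (at x within UNIV)"
  proof (rule has_derivative_series[where f' = "\<lambda>n x h. h *\<^sub>R F n (Suc k) x"])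
    show "(F n k has_derivative (\<lambda>h. h *\<^sub>R F n (Suc k) x)) (at x within UNIV)" for n x
      using C2_jet_deriv[OF F k] by (simp add: has_vector_derivative_def)
    show "(\<lambda>n. F n k 0) sums (\<Sum>n. F n k 0)" using sm[of k] k by (simp add: summable_sums)
    fix e :: real assume e: "e > 0"
    have "\<forall>\<^sub>F n in sequentially. \<forall>x\<in>UNIV. dist (\<Sum>i<n. F i (Suc k) x) (\<Sum>n. F n (Suc k) x) < e"
      using uniform_limitD[OF ul[of "Suc k"] e] k by simp
    then show "\<forall>\<^sub>F n in sequentially. \<forall>x\<in>UNIV. \<forall>h.
      norm ((\<Sum>i<n. h *\<^sub>R F i (Suc k) x) - h *\<^sub>R (\<Sum>n. F n (Suc k) x)) \<le> e * norm h"
    proof eventually_elim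
      case (elim n)
      show ?case
      proof (intro ballI allI)
        fix x h
        have "(\<Sum>i<n. h *\<^sub>R F i (Suc k) x) - h *\<^sub>R (\<Sum>n. F n (Suc k) x)
              = h *\<^sub>R ((\<Sum>i<n. F i (Suc k) x) - (\<Sum>n. F n (Suc k) x))"
          by (simp add: scaleR_sum_right scaleR_diff_right)
        then have "norm ((\<Sum>i<n. h *\<^sub>R F i (Suc k) x) - h *\<^sub>R (\<Sum>n. F n (Suc k) x))
             = norm h * dist (\<Sum>i<n. F i (Suc k) x) (\<Sum>n. F n (Suc k) x)"
          by (simp add: dist_norm)
        also have "\<dots> \<le> norm h * e"
          by (rule mult_left_mono[OF less_imp_le]) (use elim in auto)
        finally show "norm ((\<Sum>i<n. h *\<^sub>R F i (Suc k) x) - h *\<^sub>R (\<Sum>n. F n (Suc k) x)) \<le> e * norm h"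
          by (simp add: mult.commute)
      qed
    qed
  qed auto
  then obtain g where g: "\<And>x. (\<lambda>n. F n k x) sums (g x)"
      "\<And>x. (g has_derivative (\<lambda>h. h *\<^sub>R (\<Sum>n. F n (Suc k) x))) (at x)" by auto
  have "g = (\<lambda>x. \<Sum>n. F n k x)" using g(1) by (auto simp: sums_iff)
  then show "((\<lambda>t. \<Sum>n. F n k t) has_vector_derivative (\<Sum>n. F n (Suc k) t)) (at t)"
    using g(2) by (simp add: has_vector_derivative_def)
qed

text \<open>The power \<open>t ^ i\<close> is there for the double characteristic exponent, which occurs when \<open>0\<close> is an
eigenvalue of \<open>A\<close>: only \<open>i = 0\<close> and \<open>i = 1\<close> matter.\<close>

definition moment :: "real \<Rightarrow> nat \<Rightarrow> complex \<Rightarrow> (real \<Rightarrow> complex) \<Rightarrow> complex" where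
  "moment T i lam f = integral {0..T} (\<lambda>t. of_real t ^ i * exp (lam * of_real t) * f t)"

lemma moment_integrable:
  fixes f :: "real \<Rightarrow> complex"
  assumes "continuous_on {0..T} f"
  shows "(\<lambda>t. of_real t ^ i * exp (lam * of_real t) * f t) integrable_on {0..T}"
  by (intro integrable_continuous_real continuous_intros assms)

lemma moment_add:
  assumes "continuous_on {0..T} f" "continuous_on {0..T} g"
  shows "moment T i lam (\<lambda>t. f t + g t) = moment T i lam f + moment T i lam g"
  unfolding moment_def distrib_left
  by (rule integral_add[OF moment_integrable[OF assms(1)] moment_integrable[OF assms(2)]])

lemma moment_cmult: "moment T i lam (\<lambda>t. c * f t) = c * moment T i lam f"
  unfolding moment_def
  by (subst integral_mult_right[symmetric]) (simp add: algebra_simps)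

lemma moment_sum:
  assumes "finite I" "\<And>j. j \<in> I \<Longrightarrow> continuous_on {0..T} (f j)"
  shows "moment T i lam (\<lambda>t. \<Sum>j\<in>I. f j t) = (\<Sum>j\<in>I. moment T i lam (f j))"
  using assms
proof (induction I rule: finite_induct)
  case empty
  then show ?case by (simp add: moment_def)
next
  case (insert x I)
  then show ?case by (simp add: moment_add continuous_on_sum)
qed

lemma moment_limit:
  assumes "\<And>n. continuous_on {0..T} (f n)" "uniform_limit {0..T} f g sequentially"
  shows "(\<lambda>n. moment T i lam (f n)) \<longlonglongrightarrow> moment T i lam g"
proof -
  have bd: "bounded ((\<lambda>t. complex_of_real t ^ i * exp (lam * of_real t)) ` {0..T})"
    by (intro compact_imp_bounded compact_continuous_image continuous_intros) auto
  have cg: "continuous_on {0..T} g"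
    by (rule uniform_limit_theorem[OF _ assms(2)]) (auto simp: assms(1))
  have bg: "bounded (g ` {0..T})"
    by (intro compact_imp_bounded compact_continuous_image cg) auto
  have "uniform_limit {0..T} (\<lambda>n t. of_real t ^ i * exp (lam * of_real t) * f n t)
          (\<lambda>t. of_real t ^ i * exp (lam * of_real t) * g t) sequentially"
    by (intro bounded_bilinear.bounded_uniform_limit[OF bounded_bilinear_mult] uniform_limit_const
        assms(2) bd bg)
  then obtain I J where IJ: "\<And>n. ((\<lambda>t. of_real t ^ i * exp (lam * of_real t) * f n t) has_integral I n) {0..T}"
     "((\<lambda>t. of_real t ^ i * exp (lam * of_real t) * g t) has_integral J) {0..T}" "I \<longlonglongrightarrow> J"
    by (rule uniform_limit_integral) (auto intro!: continuous_intros assms(1))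
  have "I = (\<lambda>n. moment T i lam (f n))"
    unfolding moment_def by (rule ext) (rule integral_unique[OF IJ(1), symmetric])
  moreover have "J = moment T i lam g"
    unfolding moment_def using IJ(2) by (simp add: integral_unique)
  ultimately show ?thesis using IJ(3) by simp
qed

lemma moment_sums:
  assumes c: "\<And>n. continuous_on {0..T} (f n)"
    and b: "\<And>n t. t \<in> {0..T} \<Longrightarrow> norm (f n t) \<le> M n" and M: "summable M"
  shows "(\<lambda>n. moment T i lam (f n)) sums moment T i lam (\<lambda>t. \<Sum>n. f n t)"
proof -
  have "uniform_limit {0..T} (\<lambda>n t. \<Sum>i<n. f i t) (\<lambda>t. \<Sum>n. f n t) sequentially"
    by (rule Weierstrass_m_test[OF b M]) auto
  then have "(\<lambda>n. moment T i lam (\<lambda>t. \<Sum>i<n. f i t)) \<longlonglongrightarrow> moment T i lam (\<lambda>t. \<Sum>n. f n t)"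
    by (intro moment_limit continuous_on_sum c)
  then show ?thesis by (simp add: sums_def moment_sum c)
qed

lemma moment_norm_bound:
  assumes "continuous_on {0..T} f" "\<And>t. t \<in> {0..T} \<Longrightarrow> norm (f t) \<le> M" "0 \<le> T" "0 \<le> Re lam"
  shows "norm (moment T i lam f) \<le> T ^ i * exp (Re lam * T) * M * T"
proof -
  have M: "0 \<le> M" using order_trans[OF norm_ge_zero assms(2)[of 0]] assms(3) by simp
  have "norm (moment T i lam f) \<le> (T ^ i * exp (Re lam * T) * M) * (T - 0)"
    unfolding moment_def
  proof (rule integral_bound[OF assms(3)])
    show "continuous_on {0..T} (\<lambda>t. complex_of_real t ^ i * exp (lam * of_real t) * f t)"
      by (intro continuous_intros assms(1))
    fix t assume t: "t \<in> {0..T}"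
    have "norm (complex_of_real t ^ i * exp (lam * of_real t) * f t)
       = t ^ i * exp (Re lam * t) * norm (f t)"
      using t by (simp add: norm_mult norm_power)
    also have "\<dots> \<le> T ^ i * exp (Re lam * T) * M"
      using t assms by (intro mult_mono power_mono) (auto intro: mult_left_mono simp: M)
    finally show "norm (complex_of_real t ^ i * exp (lam * of_real t) * f t) \<le> T ^ i * exp (Re lam * T) * M" .
  qed
  then show ?thesis by simp
qed

text \<open>Translation invariance of the integral on the fixed interval \<open>{0..T}\<close>: the shifted support must not
leave it.\<close>

lemma integral_shifted_support:
  fixes f h :: "real \<Rightarrow> complex"
  assumes cf: "continuous_on UNIV f" and ch: "continuous_on UNIV h"
    and zf: "\<And>t. t \<notin> {a<..<b} \<Longrightarrow> f t = 0"
    and ab: "0 \<le> a" "0 \<le> tau" "b + tau \<le> T"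
  shows "integral {0..T} (\<lambda>t. h t * f (t - tau)) = integral {0..T} (\<lambda>t. h (t + tau) * f t)"
proof -
  have cf': "continuous_on S (\<lambda>t. f (t - c))" for c S
    by (rule continuous_on_compose2[OF cf]) (auto intro!: continuous_intros)
  have ch': "continuous_on S (\<lambda>t. h (t + c))" for c S
    by (rule continuous_on_compose2[OF ch]) (auto intro!: continuous_intros)
  have 1: "((\<lambda>t. h (t + tau) * f t) has_integral integral {0..T} (\<lambda>t. h (t + tau) * f t)) {0..T}"
    by (intro integrable_integral integrable_continuous_real continuous_on_mult ch'
        continuous_on_subset[OF cf]) auto
  have 2: "((\<lambda>t. h (t + tau) * f t) has_integral integral {0..T} (\<lambda>t. h (t + tau) * f t)) {-tau..T}"
    by (rule has_integral_on_superset[OF 1]) (use zf ab in auto)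
  have "((\<lambda>t. h t * f (t - tau)) has_integral integral {0..T} (\<lambda>t. h (t + tau) * f t)) {0..T+tau}"
    using has_integral_shift_real_ivl[OF 2, of "-tau"] by simp
  moreover have 3: "((\<lambda>t. h t * f (t - tau)) has_integral integral {0..T} (\<lambda>t. h t * f (t - tau))) {0..T}"
    by (intro integrable_integral integrable_continuous_real continuous_on_mult cf'
        continuous_on_subset[OF ch]) auto
  have "((\<lambda>t. h t * f (t - tau)) has_integral integral {0..T} (\<lambda>t. h t * f (t - tau))) {0..T+tau}"
    by (rule has_integral_on_superset[OF 3]) (use zf ab in auto)
  ultimately show ?thesis by (metis has_integral_unique)
qed

lemma moment_shift:
  assumes cf: "continuous_on UNIV f" and zf: "\<And>t. t \<notin> {a<..<b} \<Longrightarrow> f t = 0"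
    and ab: "0 \<le> a" "0 \<le> tau" "b + tau \<le> T"
  shows "moment T 0 lam (\<lambda>t. f (t - tau)) = exp (lam * of_real tau) * moment T 0 lam f"
    and "moment T 1 lam (\<lambda>t. f (t - tau))
          = exp (lam * of_real tau) * (moment T 1 lam f + of_real tau * moment T 0 lam f)"
proof -
  have cf': "continuous_on {0..T} f" by (rule continuous_on_subset[OF cf]) auto
  have *: "moment T i lam (\<lambda>t. f (t - tau))
     = integral {0..T} (\<lambda>t. of_real (t + tau) ^ i * exp (lam * of_real (t + tau)) * f t)" for i
    unfolding moment_def
    by (rule integral_shifted_support[OF cf _ zf ab]) (auto intro!: continuous_intros)
  have e: "exp (lam * of_real (t + tau)) = exp (lam * of_real tau) * exp (lam * of_real t)" for t
    by (simp add: distrib_left exp_add)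
  have "moment T 0 lam (\<lambda>t. f (t - tau))
    = integral {0..T} (\<lambda>t. exp (lam * of_real tau) * (of_real t ^ 0 * exp (lam * of_real t) * f t))"
    unfolding * e by (simp add: mult.assoc)
  then show "moment T 0 lam (\<lambda>t. f (t - tau)) = exp (lam * of_real tau) * moment T 0 lam f"
    unfolding moment_def by simp
  have "moment T 1 lam (\<lambda>t. f (t - tau))
    = integral {0..T} (\<lambda>t. exp (lam * of_real tau) * (of_real t ^ 1 * exp (lam * of_real t) * f t)
        + exp (lam * of_real tau) * of_real tau * (of_real t ^ 0 * exp (lam * of_real t) * f t))"
    unfolding * e by (intro arg_cong[where f = "integral {0..T}"] ext) (simp add: ring_distribs mult_ac)
  also have "\<dots> = integral {0..T} (\<lambda>t. exp (lam * of_real tau) * (of_real t ^ 1 * exp (lam * of_real t) * f t))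
       + integral {0..T} (\<lambda>t. exp (lam * of_real tau) * of_real tau * (of_real t ^ 0 * exp (lam * of_real t) * f t))"
    by (rule integral_add) (rule integrable_on_mult_right[OF moment_integrable[OF cf']])+
  also have "\<dots> = exp (lam * of_real tau) * moment T 1 lam f
        + exp (lam * of_real tau) * of_real tau * moment T 0 lam f"
    unfolding moment_def by (simp only: integral_mult_right)
  finally show "moment T 1 lam (\<lambda>t. f (t - tau))
          = exp (lam * of_real tau) * (moment T 1 lam f + of_real tau * moment T 0 lam f)"
    by (simp only: distrib_left mult.assoc)
qed

section \<open>Products of shift differences\<close>

text \<open>If \<open>f\<close> has the moment function $\hat f(z) = \int e^{zt} f(t)\,dt$, the shift difference has the moment
function $(1 - e^{(z - \lambda)\tau}) \hat f(z)$. It vanishes at \<open>lam\<close>, and two such factors produce a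
double zero.\<close>

definition shift_diff ::
    "complex \<Rightarrow> real \<Rightarrow> (nat \<Rightarrow> real \<Rightarrow> complex) \<Rightarrow> nat \<Rightarrow> real \<Rightarrow> complex" where
  "shift_diff lam tau F = (\<lambda>k t. F k t - exp (- lam * of_real tau) * F k (t - tau))"

lemma C2_jet_shift:
  assumes "C2_jet a b M F" "0 \<le> tau"
  shows "C2_jet a (b + tau) M (\<lambda>k t. F k (t - tau))"
proof (rule C2_jetI)
  fix k t assume k: "k < (2::nat)"
  have "((F k \<circ> (\<lambda>t. t - tau)) has_vector_derivative 1 *\<^sub>R F (Suc k) (t - tau)) (at t)"
    by (rule vector_diff_chain_at) (auto intro!: derivative_eq_intros C2_jet_deriv[OF assms(1) k])
  then show "((\<lambda>t. F k (t - tau)) has_vector_derivative F (Suc k) (t - tau)) (at t)"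
    by (simp add: o_def)
next
  show "continuous_on UNIV (\<lambda>t. F 2 (t - tau))"
    by (rule continuous_on_compose2[OF C2_jet_continuous[OF assms(1), of 2 UNIV]])
       (auto intro!: continuous_intros)
next
  fix k t assume k: "k \<le> (2::nat)"
  show "norm (F k (t - tau)) \<le> M" by (rule C2_jet_bound[OF assms(1) k])
  show "F k (t - tau) = 0" if "t \<notin> {a<..<b + tau}"
    by (rule C2_jet_zero[OF assms(1) k]) (use that assms(2) in auto)
qed

lemma C2_jet_shift_diff:
  assumes "C2_jet a b M F" "0 \<le> tau"
  shows "C2_jet a (b + tau) (M * (1 + exp (- Re lam * tau))) (shift_diff lam tau F)"
proof -
  have "C2_jet a (b + tau) (M + M * norm (- exp (- lam * of_real tau)))
          (\<lambda>k t. F k t + (- exp (- lam * of_real tau)) * F k (t - tau))"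
    by (intro C2_jet_add C2_jet_scale C2_jet_shift assms
        C2_jet_mono[OF assms(1)]) (use assms(2) in auto)
  then show ?thesis by (simp add: shift_diff_def algebra_simps)
qed

text \<open>Value and derivative at \<open>mu\<close> of the product of $\hat f$ with $1 - e^{(z - \lambda)\tau}$. If the moments
of order \<open>0\<close> and \<open>1\<close> of \<open>F\<close> vanish at \<open>mu\<close>, they still do after any further shift difference, so the
order of the factors in a product is irrelevant for the zeros.\<close>

lemma moment_shift_diff:
  fixes lam mu :: complex and tau :: real
  defines "rho \<equiv> exp ((mu - lam) * of_real tau)"
  assumes F: "C2_jet a b M F" and ab: "0 \<le> a" "0 \<le> tau" "b + tau \<le> T"
  shows "moment T 0 mu (shift_diff lam tau F 0) = (1 - rho) * moment T 0 mu (F 0)"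
    and "moment T 1 mu (shift_diff lam tau F 0)
          = (1 - rho) * moment T 1 mu (F 0) - rho * of_real tau * moment T 0 mu (F 0)"
proof -
  have c: "continuous_on S (F 0)" for S by (rule C2_jet_continuous[OF F]) simp
  have cs: "continuous_on {0..T} (\<lambda>t. F 0 (t - tau))"
    by (rule C2_jet_continuous[OF C2_jet_shift[OF F ab(2)]]) simp
  have z: "\<And>t. t \<notin> {a<..<b} \<Longrightarrow> F 0 t = 0" by (rule C2_jet_zero[OF F]) auto
  have "moment T i mu (shift_diff lam tau F 0)
     = moment T i mu (\<lambda>t. F 0 t + (- exp (- lam * of_real tau)) * F 0 (t - tau))" for i
    by (simp add: shift_diff_def)
  then have *: "moment T i mu (shift_diff lam tau F 0)
     = moment T i mu (F 0) - exp (- lam * of_real tau) * moment T i mu (\<lambda>t. F 0 (t - tau))" for i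
    unfolding moment_add[OF c continuous_on_mult[OF continuous_on_const cs]] moment_cmult
    by simp
  have rho: "exp (- lam * of_real tau) * exp (mu * of_real tau) = rho"
    unfolding rho_def by (simp add: left_diff_distrib flip: exp_add)
  have sh0: "moment T 0 mu (\<lambda>t. F 0 (t - tau)) = exp (mu * of_real tau) * moment T 0 mu (F 0)"
    by (rule moment_shift(1)[OF c z ab])
  have sh1: "moment T 1 mu (\<lambda>t. F 0 (t - tau))
     = exp (mu * of_real tau) * (moment T 1 mu (F 0) + of_real tau * moment T 0 mu (F 0))"
    by (rule moment_shift(2)[OF c z ab])
  show "moment T 0 mu (shift_diff lam tau F 0) = (1 - rho) * moment T 0 mu (F 0)"
    unfolding * sh0 by (simp only: left_diff_distrib mult_1 mult.assoc flip: rho)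
  show "moment T 1 mu (shift_diff lam tau F 0)
          = (1 - rho) * moment T 1 mu (F 0) - rho * of_real tau * moment T 0 mu (F 0)"
    unfolding * sh1 rho[symmetric] by algebra
qed

text \<open>Applying infinitely many shift differences, one for every \<open>k\<close> with \<open>P k\<close>. The \<open>k\<close>-th one extends the
support by \<open>tau k\<close> and changes the function by at most $e^{-\mathrm{Re}\,\lambda_k \tau_k}$ times its size.
Hence summability of these two quantities gives convergence in $C^2$ with compact support. An exponent
that is listed twice becomes a double zero. At any other point \<open>mu\<close> the moment is multiplied by
$\prod_k (1 - e^{(\mu - \lambda_k)\tau_k})$, which lower bounds for the single factors control from
below. The predicate \<open>P\<close> serves to spare one exponent.\<close>

lemma annihilating_shift_product:
  fixes lam :: "nat \<Rightarrow> complex" and tau :: "nat \<Rightarrow> real" and P :: "nat \<Rightarrow> bool"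
  defines "S \<equiv> \<Sum>k. exp (- Re (lam k) * tau k)"
  assumes F: "C2_jet a b M F" and a: "0 \<le> a" and tau: "\<And>k. 0 \<le> tau k" "summable tau"
    and T: "b + suminf tau \<le> b'" "b' \<le> T" and S: "summable (\<lambda>k. exp (- Re (lam k) * tau k))"
  obtains G where "C2_jet a b' (M * (1 + S * exp S)) G"
    and "\<And>k. P k \<Longrightarrow> moment T 0 (lam k) (G 0) = 0"
    and "\<And>j k. j < k \<Longrightarrow> P j \<Longrightarrow> P k \<Longrightarrow> lam j = lam k \<Longrightarrow> moment T 1 (lam k) (G 0) = 0"
    and "\<And>mu w W. (\<And>k. P k \<Longrightarrow> exp (- w k) \<le> norm (1 - exp ((mu - lam k) * of_real (tau k))))
           \<Longrightarrow> (\<And>k. 0 \<le> w k) \<Longrightarrow> (\<And>N. sum w {..<N} \<le> W)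
           \<Longrightarrow> exp (- W) * norm (moment T 0 mu (F 0)) \<le> norm (moment T 0 mu (G 0))"
proof -
  define al where "al k = exp (- Re (lam k) * tau k)" for k
  have al0: "0 \<le> al k" for k by (simp add: al_def)
  have al: "summable al" "S = suminf al" using S by (simp_all add: al_def[abs_def] S_def)
  have M0: "0 \<le> M" by (rule C2_jet_nonneg[OF F])
  define H where "H = rec_nat F (\<lambda>k X. if P k then shift_diff (lam k) (tau k) X else X)"
  have H0: "H 0 = F" and HS: "H (Suc k) = (if P k then shift_diff (lam k) (tau k) (H k) else H k)" for k
    by (simp_all add: H_def)
  have jN: "C2_jet a (b + sum tau {..<N}) (M * (\<Prod>k<N. 1 + al k)) (H N)" for N
  proof (induction N)
    case 0
    then show ?case using F by (simp add: H0)
  next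
    case (Suc N)
    have 1: "C2_jet a (b + sum tau {..<N} + tau N) (M * (\<Prod>k<N. 1 + al k) * (1 + al N))
      (shift_diff (lam N) (tau N) (H N))"
      unfolding al_def[of N] by (rule C2_jet_shift_diff[OF Suc tau(1)])
    have 2: "C2_jet a (b + sum tau {..<N} + tau N) (M * (\<Prod>k<N. 1 + al k) * (1 + al N)) (H N)"
      by (rule C2_jet_mono[OF Suc])
         (use tau(1)[of N] al0[of N] C2_jet_nonneg[OF Suc] in
            \<open>auto simp: mult_le_cancel_left1 not_less\<close>)
    show ?case using 1 2 by (simp add: HS algebra_simps)
  qed
  have tauN: "b + sum tau {..<N} \<le> b'" for N
    using sum_le_suminf[OF tau(2), of "{..<N}"] tau(1) T by simp
  have prodN: "(\<Prod>k<N. 1 + al k) \<le> exp S" for N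
  proof -
    have "(\<Prod>k<N. 1 + al k) \<le> (\<Prod>k<N. exp (al k))"
      by (intro prod_mono) (simp add: al0 add_nonneg_nonneg exp_ge_add_one_self)
    also have "\<dots> = exp (sum al {..<N})" by (simp add: exp_sum)
    also have "\<dots> \<le> exp S" using sum_le_suminf[OF al(1), of "{..<N}"] al0 al(2) by simp
    finally show ?thesis .
  qed
  have jH: "C2_jet a (b + sum tau {..<N}) (M * exp S) (H N)" for N
    by (rule C2_jet_mono[OF jN]) (auto intro: mult_left_mono prodN M0)
  define D where "D N k t = H (Suc N) k t - H N k t" for N k t
  have jD: "C2_jet a b' (al N * (M * exp S)) (D N)" for N
  proof (cases "P N")
    case True
    have "C2_jet a (b + sum tau {..<N} + tau N) ((M * exp S) * norm (- exp (- lam N * of_real (tau N))))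
       (\<lambda>k t. (- exp (- lam N * of_real (tau N))) * H N k (t - tau N))"
      by (intro C2_jet_scale C2_jet_shift jH tau(1))
    then have "C2_jet a (b + sum tau {..<Suc N}) (al N * (M * exp S)) (D N)"
      using True by (simp add: D_def[abs_def] HS shift_diff_def al_def algebra_simps)
    then show ?thesis by (rule C2_jet_mono) (use tauN[of "Suc N"] in auto)
  next
    case False
    then have "D N = (\<lambda>k t. 0)" by (simp add: D_def[abs_def] HS)
    then show ?thesis using M0 al0 by (auto intro: C2_jet_mono[OF C2_jet_const_zero])
  qed
  have sD: "summable (\<lambda>N. al N * (M * exp S))" by (rule summable_mult2[OF al(1)])
  define R where "R k t = (\<Sum>n. D n k t)" for k t
  have jR: "C2_jet a b' (S * (M * exp S)) R"
    unfolding R_def[abs_def] al(2) suminf_mult2[OF al(1)]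
    using C2_jet_suminf[OF jD sD] by (simp add: al(2))
  define G where "G k t = F k t + R k t" for k t
  have jF: "C2_jet a b' M F" by (rule C2_jet_mono[OF F]) (use tauN[of 0] in auto)
  have "C2_jet a b' (M + S * (M * exp S)) G"
    unfolding G_def[abs_def] by (rule C2_jet_add[OF jF jR])
  then have jG: "C2_jet a b' (M * (1 + S * exp S)) G" by (simp add: algebra_simps)
  have cH: "continuous_on X (H N 0)" for X N by (rule C2_jet_continuous[OF jH]) simp
  have lim: "(\<lambda>N. moment T i mu (H N 0)) \<longlonglongrightarrow> moment T i mu (G 0)" for i mu
  proof -
    have D': "moment T i mu (D n 0) = moment T i mu (H (Suc n) 0) - moment T i mu (H n 0)" for n
    proof -
      have "moment T i mu (D n 0) = moment T i mu (\<lambda>t. H (Suc n) 0 t + (-1) * H n 0 t)"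
        by (simp add: D_def[abs_def])
      also have "\<dots> = moment T i mu (H (Suc n) 0) + (-1) * moment T i mu (H n 0)"
        by (subst moment_add) (intro continuous_on_mult continuous_on_const cH | simp only: moment_cmult)+
      finally show ?thesis by simp
    qed
    have "(\<lambda>n. moment T i mu (D n 0)) sums moment T i mu (R 0)"
      unfolding R_def[abs_def]
      by (rule moment_sums[OF _ _ sD]) (use C2_jet_continuous[OF jD] C2_jet_bound[OF jD] in auto)
    then have "(\<lambda>N. \<Sum>n<N. moment T i mu (H (Suc n) 0) - moment T i mu (H n 0)) \<longlonglongrightarrow> moment T i mu (R 0)"
      by (simp add: sums_def D')
    then have "(\<lambda>N. moment T i mu (H N 0) - moment T i mu (F 0)) \<longlonglongrightarrow> moment T i mu (R 0)"
      by (simp add: sum_lessThan_telescope[of "\<lambda>n. moment T i mu (H n 0)"] H0)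
    then have "(\<lambda>N. moment T i mu (H N 0) - moment T i mu (F 0) + moment T i mu (F 0))
       \<longlonglongrightarrow> moment T i mu (R 0) + moment T i mu (F 0)"
      by (intro tendsto_add tendsto_const)
    moreover have "moment T i mu (G 0) = moment T i mu (F 0) + moment T i mu (R 0)"
      unfolding G_def[abs_def]
      by (rule moment_add) (rule C2_jet_continuous[OF jF] C2_jet_continuous[OF jR], simp)+
    ultimately show ?thesis by (simp add: add.commute)
  qed
  define rho where "rho mu k = exp ((mu - lam k) * of_real (tau k))" for mu k
  have tN: "b + sum tau {..<N} + tau N \<le> T" for N using tauN[of "Suc N"] T(2) by simp
  have m0: "moment T 0 mu (H (Suc N) 0)
      = (if P N then (1 - rho mu N) * moment T 0 mu (H N 0) else moment T 0 mu (H N 0))" for mu N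
    unfolding HS rho_def using moment_shift_diff(1)[OF jH a tau(1) tN] by simp
  have m1: "moment T 1 mu (H (Suc N) 0)
      = (if P N then (1 - rho mu N) * moment T 1 mu (H N 0) - rho mu N * of_real (tau N) * moment T 0 mu (H N 0)
         else moment T 1 mu (H N 0))" for mu N
    unfolding HS rho_def using moment_shift_diff(2)[OF jH a tau(1) tN] by simp
  have z0: "moment T 0 (lam k) (H N 0) = 0" if "P k" "k < N" for k N
    using that(2)
  proof (induction N)
    case (Suc N)
    show ?case
    proof (cases "k = N")
      case True
      then show ?thesis using that(1) by (simp add: m0 rho_def)
    next
      case False
      then show ?thesis using Suc by (simp add: m0)
    qed
  qed simp
  have z1: "moment T 1 (lam k) (H N 0) = 0" if "P j" "P k" "j < k" "lam j = lam k" "k < N" for j k N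
    using that(5)
  proof (induction N)
    case (Suc N)
    show ?case
    proof (cases "k = N")
      case True
      then show ?thesis using that z0[of j k] unfolding m1 by (simp add: rho_def)
    next
      case False
      then show ?thesis using Suc z0[of k N] that(2) unfolding m1 by simp
    qed
  qed simp
  show ?thesis
  proof (rule that[OF jG])
    fix k assume "P k"
    then have "\<forall>\<^sub>F N in sequentially. moment T 0 (lam k) (H N 0) = 0"
      using z0 by (auto intro!: eventually_sequentiallyI[of "Suc k"])
    then show "moment T 0 (lam k) (G 0) = 0"
      using LIMSEQ_unique[OF lim tendsto_eventually] by metis
  next
    fix j k assume "j < k" "P j" "P k" "lam j = lam k"
    then have "\<forall>\<^sub>F N in sequentially. moment T 1 (lam k) (H N 0) = 0"
      using z1 by (auto intro!: eventually_sequentiallyI[of "Suc k"])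
    then show "moment T 1 (lam k) (G 0) = 0"
      using LIMSEQ_unique[OF lim tendsto_eventually] by metis
  next
    fix mu w W
    assume w: "\<And>k. P k \<Longrightarrow> exp (- w k) \<le> norm (1 - exp ((mu - lam k) * of_real (tau k)))"
      and w0: "\<And>k. 0 \<le> w k" and W: "\<And>N. sum w {..<N} \<le> W"
    have "exp (- sum w {..<N}) * norm (moment T 0 mu (F 0)) \<le> norm (moment T 0 mu (H N 0))" for N
    proof (induction N)
      case 0
      then show ?case by (simp add: H0)
    next
      case (Suc N)
      have e: "exp (- sum w {..<Suc N}) = exp (- w N) * exp (- sum w {..<N})"
        by (simp flip: exp_add)
      have "exp (- sum w {..<Suc N}) * norm (moment T 0 mu (F 0))
         \<le> exp (- w N) * norm (moment T 0 mu (H N 0))"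
        unfolding e mult.assoc by (rule mult_left_mono[OF Suc]) simp
      also have "\<dots> \<le> norm (moment T 0 mu (H (Suc N) 0))"
      proof (cases "P N")
        case True
        then show ?thesis using w[OF True] by (simp add: m0 norm_mult rho_def mult_right_mono)
      next
        case False
        then show ?thesis using w0[of N] by (simp add: m0 mult_left_le_one_le)
      qed
      finally show ?case .
    qed
    moreover have "exp (- W) * norm (moment T 0 mu (F 0)) \<le> exp (- sum w {..<N}) * norm (moment T 0 mu (F 0))" for N
      using W[of N] by (intro mult_right_mono) auto
    ultimately have "exp (- W) * norm (moment T 0 mu (F 0)) \<le> norm (moment T 0 mu (H N 0))" for N
      using order_trans by blast
    then show "exp (- W) * norm (moment T 0 mu (F 0)) \<le> norm (moment T 0 mu (G 0))"
      by (intro LIMSEQ_le_const[OF tendsto_norm[OF lim]]) auto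
  qed
qed

section \<open>Lower bounds for single factors and for a bump\<close>

text \<open>With $y = e^x - 1 \ge x^3/6$ one has $1 - e^{-x} = 1/(1 + 1/y) \ge e^{-1/y}$. The cubic term is a
compromise: the losses \<open>6 / x^3\<close> of the single factors must have a finite sum over all levels,
and this sum must grow more slowly than \<open>n^2\<close> with the level \<open>n\<close> at which the product is evaluated.\<close>

lemma one_minus_exp_lower:
  fixes x :: real
  assumes "0 < x"
  shows "exp (- (6 / x ^ 3)) \<le> 1 - exp (- x)"
proof -
  define y where "y = exp x - 1"
  have "(\<Sum>k<4. x ^ k / fact k) \<le> exp x"
  proof -
    have "(\<Sum>k<4. inverse (fact k) *\<^sub>R x ^ k) \<le> (\<Sum>k. inverse (fact k) *\<^sub>R x ^ k)"
      by (rule sum_le_suminf[OF summable_exp_generic]) (use assms in auto)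
    then show ?thesis by (simp add: exp_def divide_inverse mult.commute)
  qed
  then have "1 + x + x\<^sup>2 / 2 + x ^ 3 / 6 \<le> exp x"
    by (simp add: eval_nat_numeral fact_numeral)
  then have y: "x ^ 3 / 6 \<le> y"
    using assms zero_le_power2[of x] unfolding y_def by linarith
  have x3: "0 < x ^ 3 / 6" using assms by simp
  then have y0: "0 < y" using y by linarith
  have "exp (- (6 / x ^ 3)) \<le> exp (- (1 / y))"
    using frac_le[OF _ order_refl x3 y, of 1] by simp
  also have "\<dots> \<le> 1 / (1 + 1 / y)"
    using exp_ge_add_one_self[of "1 / y"] y0
    by (simp add: exp_minus inverse_eq_divide frac_le add_pos_pos)
  also have "\<dots> = 1 - exp (- x)"
    using y0 by (simp add: y_def exp_minus field_simps)
  finally show ?thesis .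
qed

lemma norm_one_minus_exp_lower_Re:
  fixes z :: complex
  assumes "Re z \<noteq> 0"
  shows "exp (- (6 / \<bar>Re z\<bar> ^ 3)) \<le> norm (1 - exp z)"
proof -
  have "exp (- (6 / \<bar>Re z\<bar> ^ 3)) \<le> 1 - exp (- \<bar>Re z\<bar>)"
    by (rule one_minus_exp_lower) (use assms in simp)
  also have "\<dots> \<le> \<bar>1 - exp (Re z)\<bar>"
  proof (cases "Re z < 0")
    case True
    then show ?thesis by simp
  next
    case False
    have "exp (Re z) + exp (- Re z) - 2 = (exp (Re z / 2) - exp (- (Re z / 2)))\<^sup>2"
      unfolding power2_diff by (simp add: mult.assoc flip: exp_add exp_of_nat_mult)
    then have "0 \<le> exp (Re z) + exp (- Re z) - 2" by simp
    then show ?thesis using False by simp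
  qed
  also have "\<dots> \<le> norm (1 - exp z)"
    using norm_triangle_ineq3[of 1 "exp z"] by (simp add: norm_exp)
  finally show ?thesis .
qed

lemma half_le_sin:
  fixes x :: real
  assumes "0 \<le> x" "x \<le> 1"
  shows "1 / 2 \<le> cos x" "x / 2 \<le> sin x"
proof -
  have c: "1 / 2 \<le> cos y" if "0 \<le> y" "y \<le> 1" for y :: real
  proof -
    have "cos (pi / 3) \<le> cos y"
      by (rule cos_monotone_0_pi_le) (use that pi_gt3 in auto)
    then show ?thesis by (simp add: cos_60)
  qed
  then show "1 / 2 \<le> cos x" using assms by blast
  have "sin 0 - 0 / 2 \<le> sin x - x / 2"
  proof (rule DERIV_nonneg_imp_nondecreasing[OF assms(1)])
    fix y :: real assume "0 \<le> y" "y \<le> x"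
    then show "\<exists>D. ((\<lambda>x. sin x - x / 2) has_real_derivative D) (at y) \<and> 0 \<le> D"
      using c[of y] assms by (intro exI[of _ "cos y - 1 / 2"] conjI) (auto intro!: derivative_eq_intros)
  qed
  then show "x / 2 \<le> sin x" by simp
qed

text \<open>The case of two exponents with the same real part \<open>m^2\<close>. The bound $x/2 \ge e^{-2/x}$ is wasteful,
but it has the same exponential form as the other factors.\<close>

lemma norm_one_minus_exp_lower_Im:
  fixes z :: complex
  assumes "Re z = 0" "Im z \<noteq> 0" "\<bar>Im z\<bar> \<le> 1"
  shows "exp (- (2 / \<bar>Im z\<bar>)) \<le> norm (1 - exp z)"
proof -
  define x where "x = \<bar>Im z\<bar>"
  have x: "0 < x" "x \<le> 1" using assms by (simp_all add: x_def)
  have "exp (- (2 / x)) \<le> x / 2"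
    using exp_ge_add_one_self[of "2 / x"] x by (simp add: exp_minus field_simps)
  also have "\<dots> \<le> sin x" by (rule half_le_sin) (use x in auto)
  also have "\<dots> \<le> \<bar>sin (Im z)\<bar>" by (simp add: x_def abs_if)
  also have "\<dots> = \<bar>Im (1 - exp z)\<bar>" using assms(1) by (simp add: Im_exp)
  also have "\<dots> \<le> norm (1 - exp z)" by (rule abs_Im_le_cmod)
  finally show ?thesis by (simp add: x_def)
qed

text \<open>Positive parts of powers glue the bump below to zero without case distinctions.\<close>

lemma has_derivative_pos_part_power:
  assumes "1 \<le> n"
  shows "((\<lambda>x. max 0 x ^ Suc n) has_real_derivative real (Suc n) * max 0 x ^ n) (at x)"
proof -
  consider "x < 0" | "x = 0" | "x > 0" by linarith
  then show ?thesis
  proof cases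
    case 1
    have "((\<lambda>x. 0) has_real_derivative real (Suc n) * max 0 x ^ n) (at x)"
      using 1 assms by (cases n) (auto simp: max_def)
    then show ?thesis
      by (rule has_field_derivative_transform_within_open[of _ _ _ "{..<0}"]) (use 1 in auto)
  next
    case 3
    have "((\<lambda>x. x ^ Suc n) has_real_derivative real (Suc n) * max 0 x ^ n) (at x)"
      using 3 DERIV_pow[of "Suc n" x UNIV] by (simp add: max_def)
    then show ?thesis
      by (rule has_field_derivative_transform_within_open[of _ _ _ "{0<..}"]) (use 3 in auto)
  next
    case 2
    have l0: "((\<lambda>h. max 0 h ^ n) \<longlongrightarrow> max 0 (0::real) ^ n) (at 0)"
      by (intro tendsto_intros)
    have zn: "(0::real) ^ n = 0" using assms by simp
    have l: "((\<lambda>h::real. max 0 h ^ n) \<longlongrightarrow> 0) (at 0)" using l0 unfolding max.idem zn .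
    have "((\<lambda>h. (max 0 (0 + h) ^ Suc n - max 0 0 ^ Suc n) / h) \<longlongrightarrow> (0::real)) (at 0)"
    proof (rule Lim_transform_eventually[OF l])
      show "\<forall>\<^sub>F h in at (0::real). max 0 h ^ n = (max 0 (0 + h) ^ Suc n - max 0 0 ^ Suc n) / h"
        using assms by (auto simp: eventually_at_filter max_def)
    qed
    moreover have z: "real (Suc n) * max 0 x ^ n = 0"
      unfolding 2 max.idem zn by simp
    ultimately show ?thesis unfolding z unfolding 2 by (simp add: DERIV_def)
  qed
qed

text \<open>The bump is $(t - a)_+^3 (b - t)_+^3$. Over an interval so short that the phase $\mathrm{Im}\,\lambda\, t$
turns by at most one radian there is no cancellation in the moment, and it is at least a fixed
multiple of $e^{\mathrm{Re}\,\lambda\, a}$.\<close>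

lemma bump_jet:
  fixes a b :: real
  assumes ab: "0 \<le> a" "a < b" "b \<le> T"
  obtains M kappa F where "C2_jet a b M F" and "0 < kappa"
    and "\<And>lam. 0 \<le> Re lam \<Longrightarrow> \<bar>Im lam\<bar> * (b - a) \<le> 1
           \<Longrightarrow> kappa * exp (Re lam * a) \<le> norm (moment T 0 lam (F 0))"
proof -
  define p where "p n t = max 0 (t - a) ^ n" for n t
  define r where "r n t = max 0 (b - t) ^ n" for n t
  have dp: "(p (Suc n) has_real_derivative real (Suc n) * p n t) (at t)" if "1 \<le> n" for n t
  proof -
    have "((\<lambda>t. t - a) has_real_derivative 1) (at t)" by (auto intro!: derivative_eq_intros)
    from DERIV_chain2[OF has_derivative_pos_part_power[OF that] this]
    show ?thesis by (simp add: p_def[abs_def])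
  qed
  have dr: "(r (Suc n) has_real_derivative - (real (Suc n) * r n t)) (at t)" if "1 \<le> n" for n t
  proof -
    have "((\<lambda>t. b - t) has_real_derivative - 1) (at t)" by (auto intro!: derivative_eq_intros)
    from DERIV_chain2[OF has_derivative_pos_part_power[OF that] this]
    show ?thesis by (simp add: r_def[abs_def])
  qed
  define g :: "nat \<Rightarrow> real \<Rightarrow> real" where "g k = (if k = 0 then (\<lambda>t. p 3 t * r 3 t)
     else if k = 1 then (\<lambda>t. 3 * p 2 t * r 3 t - 3 * p 3 t * r 2 t)
     else (\<lambda>t. 6 * p 1 t * r 3 t - 18 * p 2 t * r 2 t + 6 * p 3 t * r 1 t))" for k
  have d: "(g k has_real_derivative g (Suc k) t) (at t)" if k2: "k < 2" for k t
  proof -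
    have [derivative_intros]: "(p 3 has_real_derivative 3 * p 2 t) (at t)"
       "(p 2 has_real_derivative 2 * p 1 t) (at t)"
       "(r 3 has_real_derivative - (3 * r 2 t)) (at t)"
       "(r 2 has_real_derivative - (2 * r 1 t)) (at t)"
      using dp[of 2] dp[of 1] dr[of 2] dr[of 1] by (simp_all add: eval_nat_numeral)
    have [derivative_intros]: "((\<lambda>t. p 3 t) has_real_derivative 3 * p 2 t) (at t)"
       "((\<lambda>t. p 2 t) has_real_derivative 2 * p 1 t) (at t)"
       "((\<lambda>t. r 3 t) has_real_derivative - (3 * r 2 t)) (at t)"
       "((\<lambda>t. r 2 t) has_real_derivative - (2 * r 1 t)) (at t)" by fact+
    consider "k = 0" | "k = 1" using k2 by linarith
    then show ?thesis
    proof cases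
      case 1
      then show ?thesis by (auto simp: g_def intro!: derivative_eq_intros)
    next
      case 2
      then show ?thesis by (auto simp: g_def intro!: derivative_eq_intros)
    qed
  qed
  have cg: "continuous_on UNIV (g k)" for k
    unfolding g_def p_def r_def by (auto intro!: continuous_intros)
  have zg: "g k t = 0" if "t \<notin> {a<..<b}" for k t
    using that by (auto simp: g_def p_def r_def max_def)
  have "\<exists>M. \<forall>t. \<bar>g k t\<bar> \<le> M" for k
  proof -
    have "bounded (g k ` {a..b})"
      by (intro compact_imp_bounded compact_continuous_image continuous_on_subset[OF cg]) auto
    then obtain M where "\<forall>x\<in>g k ` {a..b}. norm x \<le> M"
      unfolding bounded_iff by blast
    then have M: "\<And>t. t \<in> {a..b} \<Longrightarrow> \<bar>g k t\<bar> \<le> M" by simp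
    have "\<bar>g k t\<bar> \<le> max 0 M" for t
      using M[of t] zg[of t k] by (cases "t \<in> {a..b}") auto
    then show ?thesis by blast
  qed
  then obtain Mk where Mk: "\<And>k t. \<bar>g k t\<bar> \<le> Mk k" by metis
  have Mk0: "0 \<le> Mk k" for k using order_trans[OF abs_ge_zero Mk[of k 0]] .
  define M where "M = Mk 0 + Mk 1 + Mk 2"
  have M: "\<bar>g k t\<bar> \<le> M" if "k \<le> 2" for k t
  proof -
    consider "k = 0" | "k = 1" | "k = 2" using \<open>k \<le> 2\<close> by linarith
    then show ?thesis
      by cases (use Mk[of k t] Mk0[of 0] Mk0[of 1] Mk0[of 2] in \<open>simp_all add: M_def\<close>)
  qed
  define F where "F k t = complex_of_real (g k t)" for k t
  have jF: "C2_jet a b M F"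
  proof (rule C2_jetI)
    show "(F k has_vector_derivative F (Suc k) t) (at t)" if "k < 2" for k t
      unfolding F_def[abs_def]
      by (rule has_vector_derivative_of_real) (use d[OF that] in \<open>simp add: has_real_derivative_iff_has_vector_derivative\<close>)
    show "continuous_on UNIV (F 2)" unfolding F_def[abs_def] by (intro continuous_intros cg)
    show "norm (F k t) \<le> M" if "k \<le> 2" for k t using M[OF that] by (simp add: F_def)
    show "F k t = 0" if "t \<notin> {a<..<b}" for k t using zg[OF that] by (simp add: F_def)
  qed
  have g0: "0 \<le> g 0 t" for t by (simp add: g_def p_def r_def)
  have ig: "g 0 integrable_on {x..y}" for x y
    by (intro integrable_continuous_real continuous_on_subset[OF cg]) auto
  define s where "s = (b - a) / 3"
  have s: "0 < s" using ab by (simp add: s_def)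
  have "integral {a + s..a + 2 * s} (\<lambda>t. s ^ 3 * s ^ 3) \<le> integral {a + s..a + 2 * s} (g 0)"
  proof (rule integral_le[OF _ ig])
    fix t assume t: "t \<in> {a + s..a + 2 * s}"
    have "s \<le> max 0 (t - a)" "s \<le> max 0 (b - t)" using t s by (auto simp: s_def field_simps)
    then have "s ^ 3 * s ^ 3 \<le> p 3 t * r 3 t"
      unfolding p_def r_def using s
      by (intro mult_mono power_mono) (simp_all add: less_imp_le)
    then show "s ^ 3 * s ^ 3 \<le> g 0 t" by (simp add: g_def)
  qed (intro integrable_continuous_real continuous_intros)
  also have "integral {a + s..a + 2 * s} (g 0) \<le> integral {0..T} (g 0)"
    by (rule integral_subset_le[OF _ ig ig]) (use g0 ab s in \<open>auto simp: s_def field_simps\<close>)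
  finally have "integral {a + s..a + 2 * s} (\<lambda>t. s ^ 3 * s ^ 3) \<le> integral {0..T} (g 0)" .
  moreover have "integral {a + s..a + 2 * s} (\<lambda>t. s ^ 3 * s ^ 3) = s * (s ^ 3 * s ^ 3)"
    using s by simp
  moreover have "0 < s * (s ^ 3 * s ^ 3)" using s by simp
  ultimately have ipos: "0 < integral {0..T} (g 0)" by linarith
  define kappa where "kappa = integral {0..T} (g 0) / 2"
  show ?thesis
  proof (rule that[OF jF])
    show "0 < kappa" using ipos by (simp add: kappa_def)
    fix lam :: complex assume lam: "0 \<le> Re lam" "\<bar>Im lam\<bar> * (b - a) \<le> 1"
    \<comment> \<open>The unimodular factor that makes the phase vanish at the left end point.\<close>
    define c where "c = exp (- (\<i> * of_real (Im lam * a)))"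
    define f where "f = (\<lambda>t. exp (lam * of_real t) * F 0 t)"
    have cf: "continuous_on S f" for S
      unfolding f_def by (intro continuous_intros C2_jet_continuous[OF jF]) auto
    have re: "Re (c * f t) = exp (Re lam * t) * cos (Im lam * (t - a)) * g 0 t" for t
    proof -
      have "c * exp (lam * of_real t) = exp (Complex (Re lam * t) (Im lam * (t - a)))"
        unfolding c_def exp_add[symmetric]
        by (rule arg_cong[where f = exp]) (simp add: complex_eq_iff algebra_simps)
      then have "c * f t = exp (Complex (Re lam * t) (Im lam * (t - a))) * of_real (g 0 t)"
        by (simp add: f_def F_def flip: mult.assoc)
      then show ?thesis by (simp add: Re_exp)
    qed
    have "kappa * exp (Re lam * a) = integral {0..T} (\<lambda>t. exp (Re lam * a) * (1 / 2) * g 0 t)"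
      unfolding integral_mult_right by (simp add: kappa_def)
    also have "\<dots> \<le> integral {0..T} (\<lambda>t. Re (c * f t))"
    proof (rule integral_le)
      show "(\<lambda>t. exp (Re lam * a) * (1 / 2) * g 0 t) integrable_on {0..T}"
        by (rule integrable_on_mult_right[OF ig])
      show "(\<lambda>t. Re (c * f t)) integrable_on {0..T}"
        by (intro integrable_continuous_real continuous_intros cf)
      fix t
      show "exp (Re lam * a) * (1 / 2) * g 0 t \<le> Re (c * f t)"
      proof (cases "t \<in> {a<..<b}")
        case True
        have "\<bar>Im lam * (t - a)\<bar> \<le> \<bar>Im lam\<bar> * (b - a)"
          using True by (simp add: abs_mult mult_left_mono)
        then have "\<bar>Im lam * (t - a)\<bar> \<le> 1" using lam(2) by linarith
        then have "1 / 2 \<le> cos \<bar>Im lam * (t - a)\<bar>" by (intro half_le_sin) auto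
        then have "1 / 2 \<le> cos (Im lam * (t - a))" by simp
        moreover have "exp (Re lam * a) \<le> exp (Re lam * t)"
          using True lam(1) by (simp add: mult_left_mono)
        ultimately have "exp (Re lam * a) * (1 / 2) \<le> exp (Re lam * t) * cos (Im lam * (t - a))"
          by (intro mult_mono) auto
        then show ?thesis unfolding re using g0 by (intro mult_right_mono) auto
      next
        case False
        then show ?thesis unfolding re by (simp add: zg)
      qed
    qed
    also have "\<dots> = Re (integral {0..T} (\<lambda>t. c * f t))"
      by (rule integral_linear[OF _ bounded_linear_Re, unfolded o_def])
         (intro integrable_continuous_real continuous_intros cf)
    also have "\<dots> \<le> norm (integral {0..T} (\<lambda>t. c * f t))" by (rule complex_Re_le_cmod)
    also have "\<dots> = norm (moment T 0 lam (F 0))"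
      by (simp add: moment_def f_def c_def norm_mult)
    finally show "kappa * exp (Re lam * a) \<le> norm (moment T 0 lam (F 0))" .
  qed
qed

section \<open>Exponents, shifts and the total loss in the product\<close>

text \<open>With \<open>th^2\<close> an eigenvalue of \<open>A\<close>, the numbers \<open>- freq m th\<close> and \<open>- freq m (- th)\<close> are the characteristic
exponents of the modes at level \<open>m\<close>. The opposite sign appears in the moments, since these pull the
state back to time \<open>0\<close>.\<close>

definition freq :: "nat \<Rightarrow> real \<Rightarrow> complex" where
  "freq m th = Complex ((real m)\<^sup>2) th"

lemma freq_simps [simp]: "Re (freq m th) = (real m)\<^sup>2" "Im (freq m th) = th"
  by (simp_all add: freq_def)

lemma freq_eq_iff: "freq m th = freq n ph \<longleftrightarrow> m = n \<and> th = ph"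
  by (auto simp: freq_def)

lemma finite_separation:
  assumes "finite (X :: real set)"
  obtains d D where "0 < d" "0 < D" "\<And>x y. x \<in> X \<Longrightarrow> y \<in> X \<Longrightarrow> x \<noteq> y \<Longrightarrow> d \<le> \<bar>x - y\<bar>"
    "\<And>x y. x \<in> X \<Longrightarrow> y \<in> X \<Longrightarrow> \<bar>x - y\<bar> \<le> D" "\<And>x. x \<in> X \<Longrightarrow> \<bar>x\<bar> \<le> D"
proof -
  define Y where "Y = (\<lambda>(x, y). \<bar>x - y\<bar>) ` (X \<times> X)"
  have fY: "finite Y" using assms by (simp add: Y_def)
  define d where "d = Min (insert 1 (Y - {0}))"
  define D where "D = 1 + Max (insert 0 (Y \<union> abs ` X))"
  have "d \<in> insert 1 (Y - {0})" unfolding d_def by (rule Min_in) (use fY in auto)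
  then have "0 < d" by (auto simp: Y_def)
  have D: "y < D" if "y \<in> insert 0 (Y \<union> abs ` X)" for y
    using Max_ge[OF _ that] fY assms by (simp add: D_def)
  show ?thesis
  proof (rule that[OF \<open>0 < d\<close>])
    show "0 < D" by (rule D) simp
    show "d \<le> \<bar>x - y\<bar>" if "x \<in> X" "y \<in> X" "x \<noteq> y" for x y
      unfolding d_def using that fY by (intro Min_le) (auto simp: Y_def)
    show "\<bar>x - y\<bar> \<le> D" if "x \<in> X" "y \<in> X" for x y
      using that by (intro less_imp_le D) (auto simp: Y_def)
    show "\<bar>x\<bar> \<le> D" if "x \<in> X" for x
      using that by (intro less_imp_le D) auto
  qed
qed

text \<open>The summable weight by which the loss at level \<open>m\<close>, seen from level \<open>n\<close>, decays in the gap
\<open>\<bar>m - n\<bar>\<close>; the gap \<open>0\<close> accounts for the other exponents at level \<open>n\<close> itself.\<close>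

definition gap_weight :: "nat \<Rightarrow> real" where
  "gap_weight j = (if j = 0 then 1 else real j powr (- (3/2)))"

lemma gap_weight_summable: "summable gap_weight"
proof (subst summable_cong)
  show "\<forall>\<^sub>F j in sequentially. gap_weight j = real j powr (- (3/2))"
    by (auto simp: gap_weight_def intro!: eventually_sequentiallyI[of 1])
  show "summable (\<lambda>j. real j powr (- (3/2)))"
    by (simp add: summable_real_powr_iff)
qed

lemma gap_weight_nonneg: "0 \<le> gap_weight j" by (simp add: gap_weight_def)

lemma gap_weight_sum_le:
  fixes n :: nat
  shows "(\<Sum>m<N. gap_weight (nat \<bar>int m - int n\<bar>)) \<le> 2 * suminf gap_weight"
proof -
  have s: "sum gap_weight A \<le> suminf gap_weight" if "finite A" for A
    by (rule sum_le_suminf[OF gap_weight_summable that]) (simp add: gap_weight_nonneg)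
  let ?A = "{m\<in>{..<N}. m \<le> n}" and ?B = "{m\<in>{..<N}. n < m}"
  have "(\<Sum>m<N. gap_weight (nat \<bar>int m - int n\<bar>))
      = (\<Sum>m\<in>?A. gap_weight (nat \<bar>int m - int n\<bar>)) + (\<Sum>m\<in>?B. gap_weight (nat \<bar>int m - int n\<bar>))"
    by (subst sum.union_disjoint[symmetric]) (auto intro!: sum.cong)
  moreover have "(\<Sum>m\<in>?A. gap_weight (nat \<bar>int m - int n\<bar>)) = sum gap_weight ((\<lambda>m. n - m) ` ?A)"
    by (subst sum.reindex) (auto simp: inj_on_def intro!: sum.cong arg_cong[where f = gap_weight])
  moreover have "(\<Sum>m\<in>?B. gap_weight (nat \<bar>int m - int n\<bar>)) = sum gap_weight ((\<lambda>m. m - n) ` ?B)"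
    by (subst sum.reindex) (auto simp: inj_on_def intro!: sum.cong arg_cong[where f = gap_weight])
  moreover have "sum gap_weight ((\<lambda>m. n - m) ` ?A) \<le> suminf gap_weight" by (rule s) simp
  moreover have "sum gap_weight ((\<lambda>m. m - n) ` ?B) \<le> suminf gap_weight" by (rule s) simp
  ultimately show ?thesis by linarith
qed

lemma exp_neg_le_quartic:
  fixes x :: real
  assumes "0 < x"
  shows "exp (- x) \<le> 24 / x ^ 4"
proof -
  have "(\<Sum>k\<in>{4}. inverse (fact k) *\<^sub>R x ^ k) \<le> (\<Sum>k. inverse (fact k) *\<^sub>R x ^ k)"
    by (rule sum_le_suminf[OF summable_exp_generic]) (use assms in auto)
  then have "inverse (fact 4) * x ^ 4 \<le> exp x" by (simp add: exp_def)
  moreover have "fact 4 = (24::real)" by (simp add: fact_numeral)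
  ultimately have "x ^ 4 / 24 \<le> exp x" by simp
  then have "exp (- x) * x ^ 4 \<le> 24" by (simp add: exp_minus field_simps)
  then show ?thesis using assms by (simp add: pos_le_divide_eq)
qed

text \<open>The choice $\tau_m = c\, m^{-3/2}$ is what makes the method work: the exponent \<open>-3/2\<close> lies between
\<open>-2\<close> and \<open>-1\<close>, so that $\sum \tau_m$ is finite, and small with \<open>c\<close>, while $m^2 \tau_m = c \sqrt m$ still
grows fast enough for $\sum e^{-m^2\tau_m}$ to converge. Every level is used \<open>K\<close> times, which is encoded
by the level \<open>k div K + 1\<close> of the index \<open>k\<close>.\<close>

lemma shift_times_summable:
  fixes K :: nat and c :: real
  assumes K: "1 \<le> K" and c: "0 < c"
  defines "m \<equiv> \<lambda>k. real (k div K + 1)"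
  shows "summable (\<lambda>k. c * m k powr (- (3/2)))"
    and "(\<Sum>k. c * m k powr (- (3/2))) \<le> c * (real K powr (3/2) * suminf gap_weight)"
    and "summable (\<lambda>k. exp (- ((m k)\<^sup>2) * (c * m k powr (- (3/2)))))"
proof -
  have m1: "1 \<le> m k" for k by (simp add: m_def)
  have mK: "real (k + 1) / real K \<le> m k" for k
  proof -
    have "k < K * (k div K + 1)" using K by (simp add: dividend_less_times_div)
    then have "k + 1 \<le> K * (k div K + 1)" by simp
    then have "real (k + 1) \<le> real K * m k" unfolding m_def of_nat_mult[symmetric] of_nat_le_iff .
    then show ?thesis using K by (simp add: divide_le_eq mult.commute)
  qed
  have b: "c * m k powr (- (3/2)) \<le> c * (real K powr (3/2) * gap_weight (Suc k))" for k
  proof -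
    have "m k powr (- (3/2)) \<le> (real (k + 1) / real K) powr (- (3/2))"
      by (rule powr_mono2') (use mK K in auto)
    also have "\<dots> = real K powr (3/2) * gap_weight (Suc k)"
      using K by (simp add: powr_divide powr_minus gap_weight_def field_simps)
    finally show ?thesis using c by (intro mult_left_mono) auto
  qed
  have sg: "summable (\<lambda>k. c * (real K powr (3/2) * gap_weight (Suc k)))"
    using gap_weight_summable by (intro summable_mult) (simp add: summable_Suc_iff)
  show 1: "summable (\<lambda>k. c * m k powr (- (3/2)))"
    by (rule summable_comparison_test'[OF sg]) (use b c in auto)
  have "(\<Sum>k. c * m k powr (- (3/2))) \<le> (\<Sum>k. c * (real K powr (3/2) * gap_weight (Suc k)))"
    by (rule suminf_le[OF b 1 sg])
  also have "\<dots> = c * (real K powr (3/2) * (\<Sum>k. gap_weight (Suc k)))"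
    using gap_weight_summable by (simp add: suminf_mult summable_mult summable_Suc_iff)
  also have "\<dots> \<le> c * (real K powr (3/2) * suminf gap_weight)"
    using suminf_split_head[OF gap_weight_summable] c gap_weight_nonneg[of 0]
    by (intro mult_left_mono) auto
  finally show "(\<Sum>k. c * m k powr (- (3/2))) \<le> c * (real K powr (3/2) * suminf gap_weight)" .
  have e: "exp (- ((m k)\<^sup>2) * (c * m k powr (- (3/2)))) \<le> (24 / c ^ 4 * (real K)\<^sup>2) * (1 / real (Suc k) ^ 2)" for k
  proof -
    have "(m k)\<^sup>2 * m k powr (- (3/2)) = m k powr (1/2)"
      using m1[of k] by (simp flip: powr_numeral powr_add)
    then have eq: "- ((m k)\<^sup>2) * (c * m k powr (- (3/2))) = - (c * sqrt (m k))"
      using m1[of k] by (simp add: powr_half_sqrt)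
    have "exp (- (c * sqrt (m k))) \<le> 24 / (c * sqrt (m k)) ^ 4"
      by (rule exp_neg_le_quartic) (use c m1[of k] in auto)
    also have "(c * sqrt (m k)) ^ 4 = c ^ 4 * (m k)\<^sup>2"
    proof -
      have "sqrt (m k) ^ 4 = ((sqrt (m k))\<^sup>2)\<^sup>2" by (simp flip: power_mult)
      then show ?thesis using m1[of k] by (simp add: power_mult_distrib)
    qed
    also have "24 / (c ^ 4 * (m k)\<^sup>2) \<le> 24 / (c ^ 4 * (real (k + 1) / real K)\<^sup>2)"
      using c K mK[of k] m1[of k] by (intro divide_left_mono mult_left_mono power_mono mult_pos_pos) auto
    also have "\<dots> = (24 / c ^ 4 * (real K)\<^sup>2) * (1 / real (Suc k) ^ 2)"
      using K c by (simp add: power_divide)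
    finally show ?thesis unfolding eq .
  qed
  have "summable (\<lambda>k. 1 / real (Suc k) ^ 2)"
    using inverse_power_summable[of 2, where 'a = real]
    by (subst summable_Suc_iff[of "\<lambda>n. 1 / real n ^ 2"]) (simp add: inverse_eq_divide)
  then have "summable (\<lambda>k. (24 / c ^ 4 * (real K)\<^sup>2) * (1 / real (Suc k) ^ 2))"
    by (rule summable_mult)
  then show "summable (\<lambda>k. exp (- ((m k)\<^sup>2) * (c * m k powr (- (3/2)))))"
    by (rule summable_comparison_test') (use e in auto)
qed

text \<open>For \<open>m\<close> different from \<open>n\<close> the real part of the exponent is
$(n^2 - m^2)\, c\, m^{-3/2}$, of size at least $c\,k\,m^{-1/2}$ with $k = |m - n|$. The cubic bound for one
factor gives the loss $6 m^{3/2} / (c k)^3$, and $m \le 2nk$ turns it into a multiple of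
$n^{3/2} k^{-3/2}$. At the same level the imaginary parts are separated by \<open>d\<close> and the factor is at
least of the order $c\, d\, n^{-3/2}$.\<close>

lemma freq_factor_lower:
  fixes m n :: nat and c d D :: real
  assumes c: "0 < c" "c * D \<le> 1" and d: "0 < d" and mn: "1 \<le> m" "1 \<le> n"
    and sep: "th \<noteq> ph \<Longrightarrow> d \<le> \<bar>th - ph\<bar>" "\<bar>th - ph\<bar> \<le> D"
    and ne: "freq m ph \<noteq> freq n th"
  shows "exp (- ((6 * 2 powr (3/2) / c ^ 3 + 2 / (c * d)) * real n powr (3/2) * gap_weight (nat \<bar>int m - int n\<bar>)))
     \<le> norm (1 - exp ((freq n th - freq m ph) * of_real (c * real m powr (- (3/2)))))"
proof -
  define z where "z = (freq n th - freq m ph) * of_real (c * real m powr (- (3/2)))"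
  define t where "t = c * real m powr (- (3/2))"
  have t: "0 < t" using c mn by (simp add: t_def)
  have re: "Re z = ((real n)\<^sup>2 - (real m)\<^sup>2) * t" and im: "Im z = (th - ph) * t"
    by (simp_all add: z_def t_def)
  show ?thesis
  proof (cases "m = n")
    case True
    with ne have ne': "th \<noteq> ph" by auto
    have mp: "real m powr (- (3/2)) \<le> 1" using mn using powr_mono[of "- (3/2)" 0 "real m"] by simp
    have pos: "0 < \<bar>th - ph\<bar>" using ne' by simp
    have "\<bar>th - ph\<bar> * t \<le> D * c"
      using sep c mp unfolding t_def
      by (intro mult_mono) (auto simp: mult_left_le)
    then have "\<bar>Im z\<bar> \<le> 1" using c t by (simp add: im abs_mult mult.commute)
    then have "exp (- (2 / \<bar>Im z\<bar>)) \<le> norm (1 - exp z)"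
      using True t ne' by (intro norm_one_minus_exp_lower_Im) (simp_all add: re im)
    moreover have "2 / \<bar>Im z\<bar> \<le> (6 * 2 powr (3/2) / c ^ 3 + 2 / (c * d)) * real n powr (3/2)
        * gap_weight (nat \<bar>int m - int n\<bar>)"
    proof -
      have "\<bar>Im z\<bar> = \<bar>th - ph\<bar> * t" using t by (simp add: im abs_mult)
      moreover have "t = c / real n powr (3/2)"
        unfolding t_def True powr_minus divide_inverse ..
      ultimately have "2 / \<bar>Im z\<bar> = 2 / (\<bar>th - ph\<bar> * (c / real n powr (3/2)))" by (simp only:)
      also have "\<dots> = 2 * real n powr (3/2) / (c * \<bar>th - ph\<bar>)"
        by (simp only: times_divide_eq_right divide_divide_eq_right mult.commute)
      also have "\<dots> \<le> 2 * real n powr (3/2) / (c * d)"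
        using c d sep(1)[OF ne'] pos by (intro divide_left_mono mult_left_mono mult_pos_pos) auto
      also have "\<dots> \<le> (6 * 2 powr (3/2) / c ^ 3 + 2 / (c * d)) * real n powr (3/2)"
        using c d by (simp add: distrib_right)
      finally show ?thesis using True by (simp add: gap_weight_def)
    qed
    ultimately show ?thesis unfolding z_def[symmetric]
      by (intro order_trans[OF _ \<open>exp _ \<le> norm _\<close>]) simp
  next
    case False
    define k where "k = nat \<bar>int m - int n\<bar>"
    have k: "1 \<le> k" using False by (simp add: k_def)
    have k': "real k = \<bar>real n - real m\<bar>" by (simp add: k_def)
    have sq: "\<bar>(real n)\<^sup>2 - (real m)\<^sup>2\<bar> = real k * (real n + real m)"
      by (simp add: k' abs_mult power2_eq_square square_diff_square_factored)
    have "real k * real m \<le> \<bar>(real n)\<^sup>2 - (real m)\<^sup>2\<bar>" unfolding sq by (simp add: mult_left_mono)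
    then have x: "real k * real m * t \<le> \<bar>Re z\<bar>" using t by (simp add: re abs_mult)
    have kmt: "0 < real k * real m * t" using k mn t by simp
    have "exp (- (6 / \<bar>Re z\<bar> ^ 3)) \<le> norm (1 - exp z)"
      by (rule norm_one_minus_exp_lower_Re) (use x kmt in auto)
    moreover have "6 / \<bar>Re z\<bar> ^ 3 \<le> (6 * 2 powr (3/2) / c ^ 3 + 2 / (c * d)) * real n powr (3/2)
        * gap_weight k"
    proof -
      have "6 / \<bar>Re z\<bar> ^ 3 \<le> 6 / (real k * real m * t) ^ 3"
        by (rule frac_le[OF _ order_refl zero_less_power[OF kmt] power_mono[OF x less_imp_le[OF kmt]]]) simp
      also have "real m * t = c * real m powr (- (1/2))"
        using mn by (simp add: t_def powr_mult_base)
      then have "(real k * real m * t) ^ 3 = c ^ 3 * (real k ^ 3 * real m powr (- (3/2)))"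
        using mn by (simp add: mult.assoc power_mult_distrib powr_power)
      also have "6 / (c ^ 3 * (real k ^ 3 * real m powr (- (3/2))))
          = 6 / c ^ 3 * (real m powr (3/2) / real k ^ 3)"
        using mn c k by (simp add: powr_minus field_simps)
      also have "\<dots> \<le> 6 / c ^ 3 * ((2 * real n * real k) powr (3/2) / real k ^ 3)"
      proof -
        have "m \<le> n + k" by (simp add: k_def)
        also have "n + k \<le> 2 * n * k"
        proof -
          have "n \<le> n * k" "k \<le> n * k" using k mn(2) by simp_all
          moreover have "2 * n * k = n * k + n * k" by simp
          ultimately show ?thesis by linarith
        qed
        finally have "real m \<le> real (2 * n * k)" by (simp only: of_nat_le_iff)
        then have "real m \<le> 2 * real n * real k" by simp
        then show ?thesis using c
          by (intro mult_left_mono divide_right_mono powr_mono2) auto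
      qed
      also have "\<dots> = 6 * 2 powr (3/2) / c ^ 3 * real n powr (3/2) * gap_weight k"
      proof -
        have "real k powr (3/2) / real k ^ 3 = real k powr (- (3/2))"
          using k by (simp flip: powr_numeral powr_diff)
        then show ?thesis using k by (simp add: powr_mult gap_weight_def field_simps)
      qed
      also have "\<dots> \<le> (6 * 2 powr (3/2) / c ^ 3 + 2 / (c * d)) * real n powr (3/2) * gap_weight k"
        using c d gap_weight_nonneg by (intro mult_right_mono) auto
      finally show ?thesis .
    qed
    ultimately show ?thesis unfolding z_def[symmetric] k_def[symmetric]
      by (intro order_trans[OF _ \<open>exp _ \<le> norm _\<close>]) simp
  qed
qed

section \<open>A family biorthogonal to the exponentials\<close>

text \<open>The loss $e^{C n^{3/2}}$ of the product is negligible compared with the gain $e^{-\varepsilon n^2}$.\<close>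

lemma three_halves_power_absorbed:
  fixes B eps :: real
  assumes "0 < eps" "0 \<le> B"
  obtains C where "\<And>n::nat. B * real n powr (3/2) \<le> eps * (real n)\<^sup>2 + C"
proof -
  define s where "s = B / eps"
  have s: "0 \<le> s" "B = eps * s" using assms by (simp_all add: s_def)
  have "B * real n powr (3/2) \<le> eps * (real n)\<^sup>2 + eps * s ^ 4" for n :: nat
  proof -
    define x where "x = sqrt (real n)"
    have x: "0 \<le> x" "real n = x\<^sup>2" by (simp_all add: x_def)
    have p: "real n powr (3/2) = x ^ 3"
    proof (cases "n = 0")
      case False
      then have "real n powr (3/2) = (real n powr (1/2)) powr 3" by (simp add: powr_powr)
      also have "\<dots> = x ^ 3" using False by (simp add: powr_half_sqrt x_def)
      finally show ?thesis .
    qed (simp add: x_def)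
    have "s * x ^ 3 \<le> x ^ 4 + s ^ 4"
    proof (cases "s \<le> x")
      case True
      then have "s * x ^ 3 \<le> x * x ^ 3" using x by (intro mult_right_mono) auto
      then show ?thesis using s by (simp add: eval_nat_numeral) (smt (verit) mult_nonneg_nonneg)
    next
      case False
      then have "x ^ 3 \<le> s ^ 3" using x by (intro power_mono) auto
      then have "s * x ^ 3 \<le> s * s ^ 3" using s by (intro mult_left_mono) auto
      then show ?thesis using x by (simp add: eval_nat_numeral) (smt (verit) mult_nonneg_nonneg)
    qed
    then have "eps * (s * x ^ 3) \<le> eps * (x ^ 4 + s ^ 4)" using assms by (intro mult_left_mono) auto
    then show ?thesis unfolding p using s x
      by (simp add: distrib_left mult.assoc flip: power_mult)
  qed
  then show ?thesis by (rule that)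
qed

text \<open>The bump is placed just after \<open>2 T / 3\<close>, so its moments are at least of size $e^{2 n^2 T/3}$, and the product of
shift differences over all exponents but \<open>freq n th\<close>, each taken twice, multiplies the remaining one by
at least $e^{-W n^{3/2}}$. The constants do not depend on \<open>n\<close> and \<open>th\<close>. The shifts use up only part
of the remaining time and leave room for one more shift of length \<open>T / 12\<close>.\<close>

lemma annihilator_all_but_one:
  fixes Theta :: "real set"
  assumes T: "0 < T" and Theta: "finite Theta"
  obtains W C kappa :: real where "0 < kappa" "0 \<le> C" "0 \<le> W"
    and "\<And>n th. 1 \<le> n \<Longrightarrow> th \<in> Theta \<Longrightarrow> \<exists>G. C2_jet (2 * T / 3) (11 * T / 12) C G
      \<and> (\<forall>m\<ge>1. \<forall>ph\<in>Theta. freq m ph \<noteq> freq n th \<longrightarrow>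
            moment T 0 (freq m ph) (G 0) = 0 \<and> moment T 1 (freq m ph) (G 0) = 0)
      \<and> kappa * exp ((real n)\<^sup>2 * (2 * T / 3) - W * real n powr (3/2)) \<le> norm (moment T 0 (freq n th) (G 0))"
proof (cases "Theta = {}")
  case True
  show ?thesis by (rule that[of 1 0 0]) (use True in auto)
next
  case False
  obtain xs where xs: "set xs = Theta" using finite_list[OF Theta] by blast
  define L where "L = length xs"
  have L: "1 \<le> L" using False xs by (cases xs) (auto simp: L_def)
  define K where "K = 2 * L"
  have K: "1 \<le> K" using L by (simp add: K_def)
  obtain d D where dD: "0 < d" "0 < D" "\<And>x y. x \<in> Theta \<Longrightarrow> y \<in> Theta \<Longrightarrow> x \<noteq> y \<Longrightarrow> d \<le> \<bar>x - y\<bar>"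
    "\<And>x y. x \<in> Theta \<Longrightarrow> y \<in> Theta \<Longrightarrow> \<bar>x - y\<bar> \<le> D" "\<And>x. x \<in> Theta \<Longrightarrow> \<bar>x\<bar> \<le> D"
    using finite_separation[OF Theta] by blast
  define Z where "Z = real K powr (3/2) * suminf gap_weight"
  have g0: "0 \<le> suminf gap_weight" by (rule suminf_nonneg[OF gap_weight_summable gap_weight_nonneg])
  have Z: "0 \<le> Z" using g0 by (simp add: Z_def)
  \<comment> \<open>Small enough for the shifts to add up to at most \<open>T / 12\<close> and for phases at one level to stay below one radian.\<close>
  define c where "c = min (T / (12 * (Z + 1))) (1 / D)"
  have c: "0 < c" "c * Z \<le> T / 12" "c * D \<le> 1"
  proof -
    show "0 < c" using T Z dD by (simp add: c_def)
    have "c * Z \<le> T / (12 * (Z + 1)) * Z" unfolding c_def using Z by (intro mult_right_mono) auto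
    also have "\<dots> = (T / 12) * (Z / (Z + 1))" using Z by (simp add: field_simps)
    also have "\<dots> \<le> (T / 12) * 1" using T Z by (intro mult_left_mono) (auto simp: field_simps)
    finally show "c * Z \<le> T / 12" by simp
    have "c * D \<le> 1 / D * D" unfolding c_def using dD by (intro mult_right_mono) auto
    then show "c * D \<le> 1" using dD by simp
  qed
  \<comment> \<open>The indices \<open>k\<close> of one block of length \<open>K = 2 L\<close> run twice through the \<open>L\<close> exponents of one level.\<close>
  define lev where "lev k = k div K + 1" for k
  define ang where "ang k = xs ! ((k mod K) mod L)" for k
  define lam where "lam k = freq (lev k) (ang k)" for k
  define tau where "tau k = c * real (lev k) powr (- (3/2))" for k
  have lev1: "1 \<le> lev k" for k by (simp add: lev_def)
  have ang: "ang k \<in> Theta" for k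
  proof -
    have "(k mod K) mod L < L" using L by (intro mod_less_divisor) simp
    then show ?thesis unfolding ang_def xs[symmetric] by (intro nth_mem) (simp add: L_def)
  qed
  have lev_real: "real (lev k) = real (k div K + 1)" for k by (simp add: lev_def)
  note sumt = shift_times_summable[OF K c(1), folded lev_real]
  have tau0: "0 \<le> tau k" for k using c by (simp add: tau_def)
  have tau_s: "summable tau" unfolding tau_def[abs_def] by (rule sumt(1))
  have tau_le: "suminf tau \<le> T / 12"
    using sumt(2) c(2) unfolding tau_def[abs_def] Z_def by linarith
  have exp_s: "summable (\<lambda>k. exp (- Re (lam k) * tau k))"
    using sumt(3) by (simp add: lam_def tau_def)
  define S where "S = (\<Sum>k. exp (- Re (lam k) * tau k))"
  have S0: "0 \<le> S" unfolding S_def by (rule suminf_nonneg[OF exp_s]) simp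
  define b where "b = 2 * T / 3 + min (T / 6) (1 / D)"
  have b: "2 * T / 3 < b" "b \<le> 5 * T / 6" "D * (b - 2 * T / 3) \<le> 1"
  proof -
    show "2 * T / 3 < b" "b \<le> 5 * T / 6" using T dD by (auto simp: b_def)
    have "D * (b - 2 * T / 3) \<le> D * (1 / D)" unfolding b_def using dD by (intro mult_left_mono) auto
    then show "D * (b - 2 * T / 3) \<le> 1" using dD by simp
  qed
  obtain M kappa F where F: "C2_jet (2 * T / 3) b M F" and kappa: "0 < kappa"
    and Fm: "\<And>mu. 0 \<le> Re mu \<Longrightarrow> \<bar>Im mu\<bar> * (b - 2 * T / 3) \<le> 1
           \<Longrightarrow> kappa * exp (Re mu * (2 * T / 3)) \<le> norm (moment T 0 mu (F 0))"
    by (rule bump_jet[of "2 * T / 3" b T]) (use b T in auto)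
  define Q where "Q = 6 * 2 powr (3/2) / c ^ 3 + 2 / (c * d)"
  have Q: "0 \<le> Q" using c dD by (simp add: Q_def)
  define W where "W = Q * (real K * (2 * suminf gap_weight))"
  show ?thesis
  proof (rule that[OF kappa])
    show "0 \<le> M * (1 + S * exp S)" using C2_jet_nonneg[OF F] S0 by simp
    show "0 \<le> W" using Q g0 by (simp add: W_def)
    fix n :: nat and th assume n: "1 \<le> n" and th: "th \<in> Theta"
    define P where "P k \<longleftrightarrow> lam k \<noteq> freq n th" for k
    obtain G where G: "C2_jet (2 * T / 3) (11 * T / 12) (M * (1 + S * exp S)) G"
      and G0: "\<And>k. P k \<Longrightarrow> moment T 0 (lam k) (G 0) = 0"
      and G1: "\<And>j k. j < k \<Longrightarrow> P j \<Longrightarrow> P k \<Longrightarrow> lam j = lam k \<Longrightarrow> moment T 1 (lam k) (G 0) = 0"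
      and Glow: "\<And>mu w V. (\<And>k. P k \<Longrightarrow> exp (- w k) \<le> norm (1 - exp ((mu - lam k) * of_real (tau k))))
           \<Longrightarrow> (\<And>k. 0 \<le> w k) \<Longrightarrow> (\<And>N. sum w {..<N} \<le> V)
           \<Longrightarrow> exp (- V) * norm (moment T 0 mu (F 0)) \<le> norm (moment T 0 mu (G 0))"
      unfolding S_def
      by (rule annihilating_shift_product[OF F _ tau0 tau_s _ _ exp_s, of "11 * T / 12" T P])
         (use T b tau_le in auto)
    have zero: "moment T 0 (freq m ph) (G 0) = 0 \<and> moment T 1 (freq m ph) (G 0) = 0"
      if m: "1 \<le> (m::nat)" and ph: "ph \<in> Theta" and ne: "freq m ph \<noteq> freq n th" for m ph
    proof -
      obtain r where r: "r < L" "xs ! r = ph" using ph xs by (auto simp: in_set_conv_nth L_def)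
      define j where "j = (m - 1) * K + r"
      define k where "k = (m - 1) * K + (r + L)"
      have rK: "r < K" "r + L < K" using r by (simp_all add: K_def)
      have "lev j = m" "lev k = m" unfolding lev_def j_def k_def using rK K m by simp_all
      moreover have "ang j = ph" "ang k = ph" unfolding ang_def j_def k_def using rK r by simp_all
      ultimately have l: "lam j = freq m ph" "lam k = freq m ph" by (simp_all add: lam_def)
      have jk: "j < k" using L by (simp add: j_def k_def)
      have "P j" "P k" using l ne by (simp_all add: P_def)
      then show ?thesis using G0[of k] G1[OF jk] l by simp
    qed
    have low: "exp (- (W * real n powr (3/2))) * norm (moment T 0 (freq n th) (F 0))
        \<le> norm (moment T 0 (freq n th) (G 0))"
    proof (rule Glow[where w = "\<lambda>k. Q * real n powr (3/2) * gap_weight (nat \<bar>int (lev k) - int n\<bar>)"])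
      show "0 \<le> Q * real n powr (3/2) * gap_weight (nat \<bar>int (lev k) - int n\<bar>)" for k
        using Q gap_weight_nonneg by simp
      show "exp (- (Q * real n powr (3/2) * gap_weight (nat \<bar>int (lev k) - int n\<bar>)))
         \<le> norm (1 - exp ((freq n th - lam k) * of_real (tau k)))" if "P k" for k
        unfolding lam_def tau_def Q_def
        by (rule freq_factor_lower[OF c(1,3) dD(1) lev1 n dD(3)[OF th ang] dD(4)[OF th ang]])
           (use that in \<open>auto simp: P_def lam_def\<close>)
      fix N
      have "(\<Sum>k<N. gap_weight (nat \<bar>int (lev k) - int n\<bar>)) \<le> (\<Sum>k<N * K. gap_weight (nat \<bar>int (lev k) - int n\<bar>))"
        by (rule sum_mono2) (use K gap_weight_nonneg in \<open>auto intro: less_le_trans\<close>)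
      also have "\<dots> = (\<Sum>m<N. \<Sum>k\<in>{m * K..<m * K + K}. gap_weight (nat \<bar>int (lev k) - int n\<bar>))"
        by (rule sum.nat_group[symmetric])
      also have "\<dots> = (\<Sum>m<N. real K * gap_weight (nat \<bar>int m - int (n - 1)\<bar>))"
      proof (rule sum.cong[OF refl])
        fix m
        have "lev k = m + 1" if "k \<in> {m * K..<m * K + K}" for k
          using that by (auto simp: lev_def mult.commute intro!: div_nat_eqI)
        then have "(\<Sum>k\<in>{m * K..<m * K + K}. gap_weight (nat \<bar>int (lev k) - int n\<bar>))
            = (\<Sum>k\<in>{m * K..<m * K + K}. gap_weight (nat \<bar>int m - int (n - 1)\<bar>))"
          using n by (intro sum.cong refl arg_cong[where f = gap_weight]) (auto simp: of_nat_diff)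
        then show "(\<Sum>k\<in>{m * K..<m * K + K}. gap_weight (nat \<bar>int (lev k) - int n\<bar>))
            = real K * gap_weight (nat \<bar>int m - int (n - 1)\<bar>)" by simp
      qed
      also have "\<dots> \<le> real K * (2 * suminf gap_weight)"
        unfolding sum_distrib_left[symmetric] by (intro mult_left_mono gap_weight_sum_le) simp
      finally have "(\<Sum>k<N. gap_weight (nat \<bar>int (lev k) - int n\<bar>)) \<le> real K * (2 * suminf gap_weight)" .
      then have "Q * real n powr (3/2) * (\<Sum>k<N. gap_weight (nat \<bar>int (lev k) - int n\<bar>))
          \<le> Q * real n powr (3/2) * (real K * (2 * suminf gap_weight))"
        using Q by (intro mult_left_mono) auto
      then show "(\<Sum>k<N. Q * real n powr (3/2) * gap_weight (nat \<bar>int (lev k) - int n\<bar>)) \<le> W * real n powr (3/2)"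
        unfolding sum_distrib_left[symmetric] W_def by (simp add: mult_ac)
    qed
    have "\<bar>th\<bar> * (b - 2 * T / 3) \<le> D * (b - 2 * T / 3)"
      by (rule mult_right_mono) (use dD(5)[OF th] b in auto)
    then have "kappa * exp ((real n)\<^sup>2 * (2 * T / 3)) \<le> norm (moment T 0 (freq n th) (F 0))"
      using Fm[of "freq n th"] b(3) by simp
    then have "exp (- (W * real n powr (3/2))) * (kappa * exp ((real n)\<^sup>2 * (2 * T / 3)))
       \<le> exp (- (W * real n powr (3/2))) * norm (moment T 0 (freq n th) (F 0))"
      by (intro mult_left_mono) auto
    also note low
    also have "exp (- (W * real n powr (3/2))) * (kappa * exp ((real n)\<^sup>2 * (2 * T / 3)))
      = kappa * exp ((real n)\<^sup>2 * (2 * T / 3) - W * real n powr (3/2))"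
      by (simp only: exp_diff exp_minus divide_inverse mult_ac)
    finally show "\<exists>G. C2_jet (2 * T / 3) (11 * T / 12) (M * (1 + S * exp S)) G
      \<and> (\<forall>m\<ge>1. \<forall>ph\<in>Theta. freq m ph \<noteq> freq n th \<longrightarrow>
            moment T 0 (freq m ph) (G 0) = 0 \<and> moment T 1 (freq m ph) (G 0) = 0)
      \<and> kappa * exp ((real n)\<^sup>2 * (2 * T / 3) - W * real n powr (3/2)) \<le> norm (moment T 0 (freq n th) (G 0))"
      using G zero by blast
  qed
qed

text \<open>Let \<open>G\<close> be the function with all moments zero except those at \<open>freq n th\<close>. A further shift difference
at this exponent kills the moment of order \<open>0\<close> and leaves that of order \<open>1\<close>, a multiple of the
former; dividing gives \<open>q n th 1\<close>. Subtracting a multiple of it from \<open>G\<close> removes the moment of order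
\<open>1\<close> and gives \<open>q n th 0\<close>. The moment of order \<open>1\<close> of \<open>G\<close> may be as large as $e^{n^2 T}$, whereas two
normalisations gain $e^{-4 n^2 T/3}$: it is essential here that the support begins later than \<open>T / 2\<close>.\<close>

lemma biorthogonal_family:
  fixes Theta :: "real set"
  assumes T: "0 < T" and Theta: "finite Theta"
  obtains eps C :: real and q :: "nat \<Rightarrow> real \<Rightarrow> nat \<Rightarrow> nat \<Rightarrow> real \<Rightarrow> complex"
  where "0 < eps" "0 \<le> C"
    and "\<And>n th j. 1 \<le> n \<Longrightarrow> th \<in> Theta \<Longrightarrow> j < 2 \<Longrightarrow> C2_jet 0 T (C * exp (- eps * (real n)\<^sup>2)) (q n th j)"
    and "\<And>n th j m ph i. 1 \<le> n \<Longrightarrow> th \<in> Theta \<Longrightarrow> j < 2 \<Longrightarrow> 1 \<le> m \<Longrightarrow> ph \<in> Theta \<Longrightarrow> i < 2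
      \<Longrightarrow> moment T i (freq m ph) (q n th j 0) = (if m = n \<and> ph = th \<and> i = j then 1 else 0)"
proof -
  obtain W C0 kappa :: real where k: "0 < kappa" and C0: "0 \<le> C0" and W: "0 \<le> W"
    and ex: "\<And>n th. 1 \<le> n \<Longrightarrow> th \<in> Theta \<Longrightarrow> \<exists>G. C2_jet (2 * T / 3) (11 * T / 12) C0 G
      \<and> (\<forall>m\<ge>1. \<forall>ph\<in>Theta. freq m ph \<noteq> freq n th \<longrightarrow>
            moment T 0 (freq m ph) (G 0) = 0 \<and> moment T 1 (freq m ph) (G 0) = 0)
      \<and> kappa * exp ((real n)\<^sup>2 * (2 * T / 3) - W * real n powr (3/2)) \<le> norm (moment T 0 (freq n th) (G 0))"
    by (rule annihilator_all_but_one[OF T Theta]) metis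
  obtain B where B: "\<And>n::nat. 2 * W * real n powr (3/2) \<le> T / 6 * (real n)\<^sup>2 + B"
    using three_halves_power_absorbed[of "T / 6" "2 * W"] T W by auto
  define tau where "tau = T / 12"
  have tau: "0 < tau" using T by (simp add: tau_def)
  \<comment> \<open>Upper bound for the reciprocal of the surviving moment.\<close>
  define X where "X n = inverse kappa * exp (W * real n powr (3/2) - (real n)\<^sup>2 * (2 * T / 3))" for n :: nat
  have X0: "0 < X n" for n using k by (simp add: X_def)
  define E where "E n = exp (- (T / 6) * (real n)\<^sup>2)" for n :: nat
  define c1 where "c1 = inverse kappa * exp B"
  define c2 where "c2 = (inverse kappa)\<^sup>2 * exp B"
  have c0: "0 \<le> c1" "0 \<le> c2" using k by (simp_all add: c1_def c2_def)
  have XE: "X n \<le> c1 * E n" for n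
  proof -
    have "0 \<le> W * real n powr (3/2)" "0 \<le> T * (real n)\<^sup>2" using W T by auto
    then have "W * real n powr (3/2) - (real n)\<^sup>2 * (2 * T / 3) \<le> B - T / 6 * (real n)\<^sup>2"
      using B[of n] by (simp add: field_simps)
    then have "exp (W * real n powr (3/2) - (real n)\<^sup>2 * (2 * T / 3)) \<le> exp B * E n"
      unfolding E_def by (simp flip: exp_add)
    then show ?thesis using k by (simp add: X_def c1_def mult.assoc)
  qed
  have XXE: "exp ((real n)\<^sup>2 * T) * (X n)\<^sup>2 \<le> c2 * E n" for n
  proof -
    have "exp ((real n)\<^sup>2 * T) * (X n)\<^sup>2
      = (inverse kappa)\<^sup>2 * exp ((real n)\<^sup>2 * T + 2 * (W * real n powr (3/2) - (real n)\<^sup>2 * (2 * T / 3)))"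
      unfolding X_def power_mult_distrib exp_add by (simp flip: exp_double)
    also have "\<dots> \<le> (inverse kappa)\<^sup>2 * exp (B + - (T / 6) * (real n)\<^sup>2)"
    proof -
      have "0 \<le> T * (real n)\<^sup>2" using T by auto
      then have "(real n)\<^sup>2 * T + 2 * (W * real n powr (3/2) - (real n)\<^sup>2 * (2 * T / 3)) \<le> B + - (T / 6) * (real n)\<^sup>2"
        using B[of n] by (simp add: field_simps)
      then show ?thesis by (intro mult_left_mono) auto
    qed
    also have "\<dots> = c2 * E n" by (simp only: c2_def E_def exp_add mult.assoc)
    finally show ?thesis .
  qed
  define D1 where "D1 = 2 * C0 / tau * c1"
  define D0 where "D0 = C0 * c1 + T\<^sup>2 * C0 * (2 * C0 / tau) * c2"
  have D: "0 \<le> D1" "0 \<le> D0" using C0 c0 tau by (simp_all add: D1_def D0_def)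
  have E0: "0 \<le> E n" for n by (simp add: E_def)
  have main: "\<exists>Q. \<forall>j<2. C2_jet 0 T ((D0 + D1) * E n) (Q j) \<and>
      (\<forall>m\<ge>1. \<forall>ph\<in>Theta. \<forall>i<2. moment T i (freq m ph) (Q j 0) = (if m = n \<and> ph = th \<and> i = j then 1 else 0))"
    if n: "1 \<le> n" and th: "th \<in> Theta" for n :: nat and th
  proof -
    obtain G where G: "C2_jet (2 * T / 3) (11 * T / 12) C0 G"
      and G0: "\<And>m ph. 1 \<le> m \<Longrightarrow> ph \<in> Theta \<Longrightarrow> freq m ph \<noteq> freq n th \<Longrightarrow> moment T 0 (freq m ph) (G 0) = 0"
      and G1: "\<And>m ph. 1 \<le> m \<Longrightarrow> ph \<in> Theta \<Longrightarrow> freq m ph \<noteq> freq n th \<Longrightarrow> moment T 1 (freq m ph) (G 0) = 0"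
      and Gl: "kappa * exp ((real n)\<^sup>2 * (2 * T / 3) - W * real n powr (3/2)) \<le> norm (moment T 0 (freq n th) (G 0))"
      using ex[OF n th] by blast
    define lam where "lam = freq n th"
    define mom0 where "mom0 = moment T 0 lam (G 0)"
    define mom1 where "mom1 = moment T 1 lam (G 0)"
    have m0pos: "0 < norm mom0"
      using less_le_trans[OF _ Gl, of 0] k by (simp add: mom0_def lam_def)
    have m0inv: "inverse (norm mom0) \<le> X n"
    proof -
      have "inverse (norm mom0) \<le> inverse (kappa * exp ((real n)\<^sup>2 * (2 * T / 3) - W * real n powr (3/2)))"
        unfolding mom0_def lam_def by (rule le_imp_inverse_le[OF Gl]) (use k in simp)
      also have "\<dots> = X n" by (simp add: X_def flip: exp_minus)
      finally show ?thesis .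
    qed
    have m1: "norm mom1 \<le> T\<^sup>2 * C0 * exp ((real n)\<^sup>2 * T)"
    proof -
      have "norm mom1 \<le> T ^ 1 * exp (Re lam * T) * C0 * T"
        unfolding mom1_def
        by (rule moment_norm_bound[OF C2_jet_continuous[OF G] C2_jet_bound[OF G]])
           (use T in \<open>auto simp: lam_def\<close>)
      then show ?thesis by (simp add: lam_def power2_eq_square mult_ac)
    qed
    define H where "H = shift_diff lam tau G"
    have H: "C2_jet (2 * T / 3) T (C0 * 2) H"
    proof (rule C2_jet_mono[OF C2_jet_shift_diff[OF G, of tau lam, folded H_def]])
      have "exp (- Re lam * tau) \<le> 1" using tau by (simp add: lam_def)
      then show "C0 * (1 + exp (- Re lam * tau)) \<le> C0 * 2" using C0 by (intro mult_left_mono) auto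
    qed (use tau in \<open>auto simp: tau_def\<close>)
    have sd: "moment T 0 mu (H 0) = (1 - exp ((mu - lam) * of_real tau)) * moment T 0 mu (G 0)"
      "moment T 1 mu (H 0) = (1 - exp ((mu - lam) * of_real tau)) * moment T 1 mu (G 0)
         - exp ((mu - lam) * of_real tau) * of_real tau * moment T 0 mu (G 0)" for mu
      unfolding H_def
      by (rule moment_shift_diff[OF G]; use T tau in \<open>simp add: tau_def\<close>)+
    define q1 where "q1 k t = (- 1 / (of_real tau * mom0)) * H k t" for k t
    define q0 where "q0 k t = (1 / mom0) * (G k t + (- mom1) * q1 k t)" for k t
    have jq1: "C2_jet (2 * T / 3) T (C0 * 2 * norm (- 1 / (of_real tau * mom0))) q1"
      unfolding q1_def[abs_def] by (rule C2_jet_scale[OF H])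
    have n1: "C0 * 2 * norm (- 1 / (of_real tau * mom0)) \<le> 2 * C0 / tau * X n"
    proof -
      have "C0 * 2 * norm (- 1 / (of_real tau * mom0)) = 2 * C0 / tau * inverse (norm mom0)"
        using tau by (simp add: norm_divide norm_mult inverse_eq_divide)
      also have "\<dots> \<le> 2 * C0 / tau * X n" using m0inv C0 tau by (intro mult_left_mono) auto
      finally show ?thesis .
    qed
    have jq1': "C2_jet (2 * T / 3) T (2 * C0 / tau * X n) q1"
      by (rule C2_jet_mono[OF jq1 _ _ n1]) auto
    have jq0': "C2_jet (2 * T / 3) T ((C0 + 2 * C0 / tau * X n * norm (- mom1)) * norm (1 / mom0)) q0"
      unfolding q0_def[abs_def]
      by (intro C2_jet_scale C2_jet_add jq1' C2_jet_mono[OF G]) (use T in auto)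
    have "(C0 + 2 * C0 / tau * X n * norm (- mom1)) * norm (1 / mom0)
        \<le> (C0 + 2 * C0 / tau * X n * (T\<^sup>2 * C0 * exp ((real n)\<^sup>2 * T))) * X n"
      using m1 m0inv C0 tau X0[of n]
      by (intro mult_mono add_mono mult_left_mono add_nonneg_nonneg mult_nonneg_nonneg)
         (auto simp: norm_divide divide_inverse norm_inverse less_imp_le)
    also have "\<dots> = C0 * X n + T\<^sup>2 * C0 * (2 * C0 / tau) * (exp ((real n)\<^sup>2 * T) * (X n)\<^sup>2)"
      by (simp only: distrib_right distrib_left power2_eq_square mult_ac)
    also have "\<dots> \<le> C0 * (c1 * E n) + T\<^sup>2 * C0 * (2 * C0 / tau) * (c2 * E n)"
      using XE XXE C0 tau by (intro add_mono mult_left_mono) auto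
    also have "\<dots> = D0 * E n"
      by (simp only: D0_def distrib_right mult.assoc)
    also have "\<dots> \<le> (D0 + D1) * E n" using D E0 by (intro mult_right_mono) auto
    finally have jq0: "C2_jet 0 T ((D0 + D1) * E n) q0"
      using T by (intro C2_jet_mono[OF jq0']) auto
    have "2 * C0 / tau * X n \<le> D1 * E n"
      unfolding D1_def mult.assoc using XE C0 tau by (intro mult_left_mono) auto
    also have "\<dots> \<le> (D0 + D1) * E n" using D E0 by (intro mult_right_mono) auto
    finally have jq1'': "C2_jet 0 T ((D0 + D1) * E n) q1"
      using T by (intro C2_jet_mono[OF jq1']) auto
    have mq1: "moment T i mu (q1 0) = (- 1 / (of_real tau * mom0)) * moment T i mu (H 0)" for i mu
      unfolding q1_def[abs_def] by (rule moment_cmult)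
    have mq0: "moment T i mu (q0 0) = (1 / mom0) * (moment T i mu (G 0) + (- mom1) * moment T i mu (q1 0))" for i mu
    proof -
      have "moment T i mu (q0 0) = (1 / mom0) * moment T i mu (\<lambda>t. G 0 t + (- mom1) * q1 0 t)"
        unfolding q0_def[abs_def] by (rule moment_cmult)
      also have "moment T i mu (\<lambda>t. G 0 t + (- mom1) * q1 0 t)
         = moment T i mu (G 0) + moment T i mu (\<lambda>t. (- mom1) * q1 0 t)"
        by (rule moment_add; intro continuous_on_mult continuous_on_const
              C2_jet_continuous[OF G] C2_jet_continuous[OF jq1]; simp)
      also have "moment T i mu (\<lambda>t. (- mom1) * q1 0 t) = (- mom1) * moment T i mu (q1 0)"
        by (rule moment_cmult)
      finally show ?thesis .
    qed
    have mom0: "mom0 \<noteq> 0" using m0pos by auto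
    have "moment T i (freq m ph) (q1 0) = (if m = n \<and> ph = th \<and> i = 1 then 1 else 0) \<and>
          moment T i (freq m ph) (q0 0) = (if m = n \<and> ph = th \<and> i = 0 then 1 else 0)"
      if m: "1 \<le> (m::nat)" and ph: "ph \<in> Theta" and i: "i < 2" for m ph i
    proof (cases "freq m ph = freq n th")
      case True
      then have l: "freq m ph = lam" "m = n" "ph = th" by (simp_all add: lam_def freq_eq_iff)
      consider "i = 0" | "i = 1" using i by linarith
      then show ?thesis
      proof cases
        case 1
        then show ?thesis using mom0 l(2,3) unfolding l(1) mq0 mq1 1 sd mom0_def[symmetric] by simp
      next
        case 2
        then show ?thesis using mom0 l(2,3) tau
          unfolding l(1) mq0 mq1 2 sd mom0_def[symmetric] mom1_def[symmetric] by simp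
      qed
    next
      case False
      then have ne: "\<not> (m = n \<and> ph = th)" by auto
      consider "i = 0" | "i = 1" using i by linarith
      then show ?thesis
      proof cases
        case 1
        then show ?thesis using ne unfolding mq0 mq1 1 sd G0[OF m ph False] by simp
      next
        case 2
        then show ?thesis using ne unfolding mq0 mq1 2 sd G0[OF m ph False] G1[OF m ph False] by simp
      qed
    qed
    then show ?thesis
      using jq0 jq1''
      by (intro exI[of _ "\<lambda>j. if j = 0 then q0 else q1"]) (auto simp: less_2_cases_iff)
  qed
  then obtain q where q: "\<And>n th j. 1 \<le> n \<Longrightarrow> th \<in> Theta \<Longrightarrow> j < 2 \<Longrightarrow> C2_jet 0 T ((D0 + D1) * E n) (q n th j)"
    "\<And>n th j m ph i. 1 \<le> n \<Longrightarrow> th \<in> Theta \<Longrightarrow> j < 2 \<Longrightarrow> 1 \<le> m \<Longrightarrow> ph \<in> Theta \<Longrightarrow> i < 2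
      \<Longrightarrow> moment T i (freq m ph) (q n th j 0) = (if m = n \<and> ph = th \<and> i = j then 1 else 0)"
    by metis
  show ?thesis
    by (rule that[of "T / 6" "D0 + D1" q]) (use T D q in \<open>auto simp: E_def\<close>)
qed

section \<open>Spectral resolution and the Hautus condition\<close>

lemma inner_vec_complex:
  fixes x y :: "complex^'n"
  shows "x \<bullet> y = Re (\<Sum>i\<in>UNIV. cnj (x $ i) * y $ i)"
  by (simp add: inner_vec_def inner_complex_def)

lemma pos_semidef_hermitian:
  assumes "pos_semidef A"
  shows "cnj (A $ i $ j) = A $ j $ i"
proof -
  have "A = conj_transpose A" using assms by (simp add: pos_semidef_def)
  then have "A $ j $ i = conj_transpose A $ j $ i" by simp
  then show ?thesis by (simp add: conj_transpose_def)
qed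

lemma pos_semidef_symmetric:
  assumes "pos_semidef A"
  shows "(A *v x) \<bullet> y = x \<bullet> (A *v y)"
proof -
  have "(\<Sum>i\<in>UNIV. cnj ((A *v x) $ i) * y $ i) = (\<Sum>i\<in>UNIV. \<Sum>j\<in>UNIV. cnj (x $ j) * A $ j $ i * y $ i)"
    by (simp add: matrix_vector_mult_def sum_distrib_right sum_distrib_left
        pos_semidef_hermitian[OF assms] mult_ac)
  also have "\<dots> = (\<Sum>j\<in>UNIV. \<Sum>i\<in>UNIV. cnj (x $ j) * A $ j $ i * y $ i)"
    by (rule sum.swap)
  also have "\<dots> = (\<Sum>j\<in>UNIV. cnj (x $ j) * (A *v y) $ j)"
    by (simp add: matrix_vector_mult_def sum_distrib_left mult_ac)
  finally show ?thesis by (simp add: inner_vec_complex)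
qed

lemma linear_matrix_vector: "linear ((*v) (A :: complex^'n^'m))"
  by (rule linearI) (simp_all add: matrix_vector_right_distrib vec_eq_iff matrix_vector_mult_def
      scaleR_sum_right distrib_left sum.distrib)

text \<open>A maximiser \<open>z\<close> of the Rayleigh quotient on the unit sphere of \<open>V\<close> is an eigenvector. The defect
\<open>h = f z - lam z\<close> lies in \<open>V\<close>, and moving from \<open>z\<close> in its direction would increase the quotient to first
order unless \<open>h = 0\<close>.\<close>

lemma symmetric_invariant_subspace_eigenvector:
  fixes f :: "'a::euclidean_space \<Rightarrow> 'a"
  assumes f: "linear f" and sym: "\<And>x y. f x \<bullet> y = x \<bullet> f y"
    and V: "subspace V" "\<And>x. x \<in> V \<Longrightarrow> f x \<in> V" and ne: "w \<in> V" "w \<noteq> 0"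
  obtains z lam where "z \<in> V" "z \<noteq> 0" "f z = lam *\<^sub>R z"
proof -
  interpret linear f by (rule f)
  have cf: "continuous_on X f" for X by (rule linear_continuous_on_compose[OF continuous_on_id f])
  have "compact (V \<inter> sphere 0 1)"
    by (rule closed_Int_compact[OF closed_subspace[OF V(1)] compact_sphere])
  moreover have "(1 / norm w) *\<^sub>R w \<in> V \<inter> sphere 0 1"
    using ne V(1) by (simp add: subspace_scale)
  moreover have "continuous_on (V \<inter> sphere 0 1) (\<lambda>x. x \<bullet> f x)"
    by (intro continuous_intros cf)
  ultimately have "\<exists>z\<in>V \<inter> sphere 0 1. \<forall>x\<in>V \<inter> sphere 0 1. x \<bullet> f x \<le> z \<bullet> f z"
    by (intro continuous_attains_sup) auto
  then obtain z where z: "z \<in> V" "norm z = 1"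
    and max: "\<And>x. x \<in> V \<Longrightarrow> norm x = 1 \<Longrightarrow> x \<bullet> f x \<le> z \<bullet> f z" by auto
  define lam where "lam = z \<bullet> f z"
  have ray: "x \<bullet> f x \<le> lam * (x \<bullet> x)" if "x \<in> V" for x
  proof (cases "x = 0")
    case False
    have "((1 / norm x) *\<^sub>R x) \<bullet> f ((1 / norm x) *\<^sub>R x) \<le> lam"
      unfolding lam_def by (rule max) (use that False V(1) in \<open>auto simp: subspace_scale\<close>)
    then have "(x \<bullet> f x) / (norm x)\<^sup>2 \<le> lam" by (simp add: scale power2_eq_square)
    then show ?thesis using False by (simp add: divide_le_eq dot_square_norm)
  qed (simp add: zero)
  define h where "h = f z - lam *\<^sub>R z"
  have hV: "h \<in> V" unfolding h_def using z V by (intro subspace_diff subspace_scale) auto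
  have hh: "h \<bullet> f z - lam * (h \<bullet> z) = h \<bullet> h" by (simp add: h_def inner_diff_right)
  have quad: "0 \<le> t\<^sup>2 * (lam * (h \<bullet> h) - h \<bullet> f h) - 2 * t * (h \<bullet> h)" for t
  proof -
    have "(z + t *\<^sub>R h) \<bullet> f (z + t *\<^sub>R h) \<le> lam * ((z + t *\<^sub>R h) \<bullet> (z + t *\<^sub>R h))"
      by (rule ray) (use z hV V(1) in \<open>auto intro: subspace_add subspace_scale\<close>)
    moreover have "(z + t *\<^sub>R h) \<bullet> f (z + t *\<^sub>R h) = lam + 2 * t * (h \<bullet> f z) + t\<^sup>2 * (h \<bullet> f h)"
      using sym[of z h]
      by (simp add: add scale inner_add_left inner_add_right lam_def power2_eq_square inner_commute algebra_simps)
    moreover have "z \<bullet> z = 1" using z(2) by (simp add: dot_square_norm)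
    then have "(z + t *\<^sub>R h) \<bullet> (z + t *\<^sub>R h) = 1 + 2 * t * (h \<bullet> z) + t\<^sup>2 * (h \<bullet> h)"
      by (simp add: inner_add_left inner_add_right power2_eq_square inner_commute algebra_simps)
    ultimately have "lam + 2 * t * (h \<bullet> f z) + t\<^sup>2 * (h \<bullet> f h) \<le> lam * (1 + 2 * t * (h \<bullet> z) + t\<^sup>2 * (h \<bullet> h))"
      by simp
    then have "2 * t * (h \<bullet> f z - lam * (h \<bullet> z)) \<le> t\<^sup>2 * (lam * (h \<bullet> h) - h \<bullet> f h)"
      by (simp add: algebra_simps)
    then show ?thesis unfolding hh by simp
  qed
  have "h = 0"
  proof (rule ccontr)
    assume "h \<noteq> 0"
    then have p: "0 < h \<bullet> h" by simp
    define c where "c = lam * (h \<bullet> h) - h \<bullet> f h"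
    have "0 \<le> c - 2 * (h \<bullet> h)" using quad[of 1] by (simp add: c_def)
    then have c: "0 < c" using p by linarith
    have "0 \<le> ((h \<bullet> h) / c)\<^sup>2 * c - 2 * ((h \<bullet> h) / c) * (h \<bullet> h)"
      using quad[of "(h \<bullet> h) / c"] unfolding c_def .
    also have "\<dots> = - ((h \<bullet> h)\<^sup>2 / c)" using c by (simp add: power2_eq_square field_simps)
    finally show False using p c by (simp add: field_simps)
  qed
  then have "f z = lam *\<^sub>R z" by (simp add: h_def)
  moreover have "z \<noteq> 0" using z by auto
  ultimately show ?thesis using z that by blast
qed

definition real_eigenvalues :: "complex^'n^'n \<Rightarrow> real set" where
  "real_eigenvalues A = {mu. \<exists>z. z \<noteq> 0 \<and> A *v z = mu *\<^sub>R z}"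

text \<open>The sums of eigenvectors form an invariant subspace; its orthogonal complement is invariant by symmetry
and would contain an eigenvector if it were not trivial. The space is regarded as a real Euclidean
space, in which \<open>A\<close> is symmetric and its eigenvalues are real scalars.\<close>

lemma pos_semidef_eigen_decomposition:
  fixes A :: "complex^'n^'n"
  assumes A: "pos_semidef A"
  shows "\<exists>S p. finite S \<and> S \<subseteq> real_eigenvalues A \<and> (\<forall>mu. A *v p mu = mu *\<^sub>R p mu)
    \<and> (\<forall>mu. mu \<notin> S \<longrightarrow> p mu = 0) \<and> z = (\<Sum>mu\<in>S. p mu)"
proof -
  define dec where "dec z S p \<longleftrightarrow> finite S \<and> S \<subseteq> real_eigenvalues A \<and> (\<forall>mu. A *v p mu = mu *\<^sub>R p mu)
    \<and> (\<forall>mu. mu \<notin> S \<longrightarrow> p mu = 0) \<and> z = (\<Sum>mu\<in>S. p mu)" for z S p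
  define D where "D = {z. \<exists>S p. dec z S p}"
  interpret A: linear "(*v) A" by (rule linear_matrix_vector)
  have subD: "subspace D"
  proof (rule subspaceI)
    show "0 \<in> D" unfolding D_def dec_def
      by (rule CollectI, rule exI[of _ "{}"], rule exI[of _ "\<lambda>_. 0"]) simp
  next
    fix x y assume "x \<in> D" "y \<in> D"
    then obtain S p S' p' where d: "dec x S p" "dec y S' p'" by (auto simp: D_def)
    have 1: "finite S" "S \<subseteq> real_eigenvalues A" "\<forall>mu. A *v p mu = mu *\<^sub>R p mu"
      "\<forall>mu. mu \<notin> S \<longrightarrow> p mu = 0" "x = (\<Sum>mu\<in>S. p mu)"
      using d(1) by (simp_all add: dec_def)
    have 2: "finite S'" "S' \<subseteq> real_eigenvalues A" "\<forall>mu. A *v p' mu = mu *\<^sub>R p' mu"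
      "\<forall>mu. mu \<notin> S' \<longrightarrow> p' mu = 0" "y = (\<Sum>mu\<in>S'. p' mu)"
      using d(2) by (simp_all add: dec_def)
    have x: "x = (\<Sum>mu\<in>S \<union> S'. p mu)" unfolding 1(5)
      by (rule sum.mono_neutral_left) (use 1 2 in auto)
    have y: "y = (\<Sum>mu\<in>S \<union> S'. p' mu)" unfolding 2(5)
      by (rule sum.mono_neutral_left) (use 1 2 in auto)
    show "x + y \<in> D" unfolding D_def dec_def
      by (rule CollectI, rule exI[of _ "S \<union> S'"], rule exI[of _ "\<lambda>mu. p mu + p' mu"])
         (use 1 2 in \<open>auto simp: x y sum.distrib A.add scaleR_add_right\<close>)
  next
    fix c x assume "x \<in> D"
    then obtain S p where d: "dec x S p" by (auto simp: D_def)
    have 1: "finite S" "S \<subseteq> real_eigenvalues A" "\<forall>mu. A *v p mu = mu *\<^sub>R p mu"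
      "\<forall>mu. mu \<notin> S \<longrightarrow> p mu = 0" "x = (\<Sum>mu\<in>S. p mu)"
      using d by (simp_all add: dec_def)
    show "c *\<^sub>R x \<in> D" unfolding D_def dec_def
      by (rule CollectI, rule exI[of _ S], rule exI[of _ "\<lambda>mu. c *\<^sub>R p mu"])
         (use 1 in \<open>auto simp: scaleR_sum_right A.scale\<close>)
  qed
  have eig: "z \<in> D" if "A *v z = mu *\<^sub>R z" for z mu
  proof (cases "z = 0")
    case True
    then show ?thesis using subspace_0[OF subD] by simp
  next
    case False
    then have "mu \<in> real_eigenvalues A" using that by (auto simp: real_eigenvalues_def)
    then show ?thesis using that unfolding D_def dec_def
      by (intro CollectI exI[of _ "{mu}"] exI[of _ "\<lambda>nu. if nu = mu then z else 0"]) auto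
  qed
  have inv: "A *v z \<in> D" if zD: "z \<in> D" for z
  proof -
    obtain S p where d: "dec z S p" using zD by (auto simp: D_def)
    have 1: "\<And>mu. A *v p mu = mu *\<^sub>R p mu" "z = (\<Sum>mu\<in>S. p mu)"
      using d by (simp_all add: dec_def)
    have "A *v z = (\<Sum>mu\<in>S. mu *\<^sub>R p mu)" unfolding 1(2) A.sum 1(1) ..
    also have "\<dots> \<in> D"
      by (intro subspace_sum[OF subD] subspace_scale[OF subD] eig[OF 1(1)])
    finally show ?thesis .
  qed
  have "D = UNIV"
  proof (rule ccontr)
    assume "D \<noteq> UNIV"
    moreover have "span D = D" using subD by (simp only: span_eq_iff)
    ultimately have "span D \<subset> span UNIV" unfolding span_UNIV psubset_eq by (metis subset_UNIV)
    then obtain w where w: "w \<noteq> 0" "\<And>y. y \<in> span D \<Longrightarrow> orthogonal w y"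
      using orthogonal_to_subspace_exists_gen by metis
    define V where "V = {x. \<forall>y\<in>D. x \<bullet> y = 0}"
    have V: "subspace V" by (auto simp: V_def subspace_def inner_add_left)
    have Vinv: "A *v x \<in> V" if "x \<in> V" for x
      using that inv by (simp add: V_def pos_semidef_symmetric[OF A])
    have "w \<in> V" using w(2) span_base by (auto simp: V_def orthogonal_def)
    then obtain z lam where z: "z \<in> V" "z \<noteq> 0" "A *v z = lam *\<^sub>R z"
      using symmetric_invariant_subspace_eigenvector[OF linear_matrix_vector pos_semidef_symmetric[OF A] V Vinv] w(1)
      by blast
    then have "z \<bullet> z = 0" using eig by (auto simp: V_def)
    then show False using z(2) by simp
  qed
  then have "z \<in> D" by simp
  then show ?thesis by (simp add: D_def dec_def)
qed

lemma real_eigenvalues_nonneg: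
  assumes "pos_semidef A" "mu \<in> real_eigenvalues A"
  shows "0 \<le> mu"
proof -
  obtain z where z: "z \<noteq> 0" "A *v z = mu *\<^sub>R z" using assms(2) by (auto simp: real_eigenvalues_def)
  have "0 \<le> z \<bullet> (A *v z)" using assms(1) by (simp add: pos_semidef_def inner_vec_complex)
  then have "0 \<le> mu * (z \<bullet> z)" by (simp add: z(2))
  moreover have "0 < z \<bullet> z" using z(1) by simp
  ultimately show ?thesis by (simp add: zero_le_mult_iff)
qed

lemma real_eigenvalues_spectrum:
  assumes "mu \<in> real_eigenvalues A"
  shows "complex_of_real mu \<in> spectrum A"
proof -
  have "mu *\<^sub>R z = complex_of_real mu *s z" for z :: "complex^'a"
    by (simp add: vec_eq_iff scaleR_conv_of_real[where 'a = complex])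
  then show ?thesis using assms by (auto simp: spectrum_def real_eigenvalues_def)
qed

text \<open>The columns of \<open>E mu\<close> are the \<open>mu\<close>-components of the unit vectors, which makes \<open>E mu\<close> complex linear.
The adjoints \<open>G mu\<close> satisfy the mirrored identity \<open>G mu A = mu G mu\<close>. Solutions are assembled with
\<open>E\<close>, and \<open>G\<close> reads off scalar equations from a given solution.\<close>

lemma spectral_resolution:
  fixes A :: "complex^'n^'n"
  assumes A: "pos_semidef A"
  obtains S :: "real set" and E G :: "real \<Rightarrow> complex^'n^'n"
  where "finite S" "S \<subseteq> real_eigenvalues A"
    and "\<And>v. (\<Sum>mu\<in>S. E mu *v v) = v" "\<And>mu v. A *v (E mu *v v) = mu *\<^sub>R (E mu *v v)"
    and "\<And>v. (\<Sum>mu\<in>S. G mu *v v) = v" "\<And>mu v. G mu *v (A *v v) = mu *\<^sub>R (G mu *v v)"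
proof -
  obtain S p where Sp: "\<And>i. finite (S i)" "\<And>i. S i \<subseteq> real_eigenvalues A"
    "\<And>i mu. A *v p i mu = mu *\<^sub>R p i mu" "\<And>i mu. mu \<notin> S i \<Longrightarrow> p i mu = 0"
    "\<And>i::'n. axis i 1 = (\<Sum>mu\<in>S i. p i mu)"
    using pos_semidef_eigen_decomposition[OF A, of "axis _ 1"] by metis
  define X where "X = (\<Union>i. S i)"
  have X: "finite X" "X \<subseteq> real_eigenvalues A" using Sp(1,2) by (auto simp: X_def)
  define E :: "real \<Rightarrow> complex^'n^'n" where "E mu = (\<chi> r c. p c mu $ r)" for mu
  have ax: "axis i 1 = (\<Sum>mu\<in>X. p i mu)" for i
    unfolding Sp(5) by (rule sum.mono_neutral_left) (use X Sp(4) in \<open>auto simp: X_def\<close>)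
  have E1: "(\<Sum>mu\<in>X. E mu $ r $ c) = (if r = c then 1 else 0)" for r c
  proof -
    have "(\<Sum>mu\<in>X. E mu $ r $ c) = axis c 1 $ r" unfolding ax by (simp add: E_def)
    then show ?thesis by (simp add: axis_def)
  qed
  have E2: "(\<Sum>k\<in>UNIV. A $ r $ k * E mu $ k $ c) = of_real mu * E mu $ r $ c" for mu r c
  proof -
    have "(A *v p c mu) $ r = (mu *\<^sub>R p c mu) $ r" using Sp(3) by simp
    then show ?thesis by (simp add: matrix_vector_mult_def E_def scaleR_conv_of_real[where 'a = complex])
  qed
  define G where "G mu = conj_transpose (E mu)" for mu
  have G1: "(\<Sum>mu\<in>X. G mu $ r $ c) = (if r = c then 1 else 0)" for r c
  proof -
    have "(\<Sum>mu\<in>X. G mu $ r $ c) = cnj (\<Sum>mu\<in>X. E mu $ c $ r)"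
      by (simp add: G_def conj_transpose_def)
    then show ?thesis unfolding E1 by auto
  qed
  have G2: "(\<Sum>k\<in>UNIV. G mu $ r $ k * A $ k $ c) = of_real mu * G mu $ r $ c" for mu r c
  proof -
    have "(\<Sum>k\<in>UNIV. G mu $ r $ k * A $ k $ c) = cnj (\<Sum>k\<in>UNIV. A $ c $ k * E mu $ k $ r)"
      by (simp add: G_def conj_transpose_def pos_semidef_hermitian[OF A] mult.commute)
    then show ?thesis unfolding E2 by (simp add: G_def conj_transpose_def)
  qed
  have sum_id: "(\<Sum>mu\<in>X. H mu *v v) = v"
    if "\<And>r c. (\<Sum>mu\<in>X. H mu $ r $ c) = (if r = c then 1 else 0)" for H :: "real \<Rightarrow> complex^'n^'n" and v
  proof (rule vec_eq_iff[THEN iffD2], rule allI)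
    fix r
    have "(\<Sum>mu\<in>X. H mu *v v) $ r = (\<Sum>mu\<in>X. \<Sum>c\<in>UNIV. H mu $ r $ c * v $ c)"
      by (simp add: matrix_vector_mult_def)
    also have "\<dots> = (\<Sum>c\<in>UNIV. (\<Sum>mu\<in>X. H mu $ r $ c) * v $ c)"
      unfolding sum_distrib_right by (rule sum.swap)
    also have "\<dots> = v $ r" unfolding that by (simp add: if_distrib[of "\<lambda>x. x * _"] cong: if_cong)
    finally show "(\<Sum>mu\<in>X. H mu *v v) $ r = v $ r" .
  qed
  have mm: "M *v v = mu *\<^sub>R (N *v v)"
    if "\<And>r c. M $ r $ c = of_real mu * N $ r $ c" for M N :: "complex^'n^'n" and mu v
    by (simp add: vec_eq_iff matrix_vector_mult_def that scaleR_conv_of_real[where 'a = complex] sum_distrib_left mult.assoc)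
  show ?thesis
  proof (rule that[OF X sum_id[OF E1] _ sum_id[OF G1]])
    show "A *v (E mu *v v) = mu *\<^sub>R (E mu *v v)" for mu v
      unfolding matrix_vector_mul_assoc by (rule mm) (simp add: matrix_matrix_mult_def E2)
    show "G mu *v (A *v v) = mu *\<^sub>R (G mu *v v)" for mu v
      unfolding matrix_vector_mul_assoc by (rule mm) (simp add: matrix_matrix_mult_def G2)
  qed
qed

text \<open>The rank is the dimension of the span of the set of rows: when it equals the number of rows, these are
pairwise distinct and independent.\<close>

lemma full_row_rank_left_kernel:
  fixes M :: "complex^'k^'n"
  assumes rank: "rank M = CARD('n)" and w: "\<And>j. (\<Sum>i\<in>UNIV. w $ i * M $ i $ j) = 0"
  shows "w = 0"
proof -
  have rows: "rows M = range (\<lambda>i. row i M)" by (auto simp: rows_def)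
  have dim: "vec.dim (rows M) = CARD('n)" using rank by (simp add: row_rank_def_gen)
  have fin: "finite (rows M)" by (simp add: rows)
  have "card (rows M) \<le> CARD('n)" unfolding rows by (rule card_image_le) simp
  then have indep: "vec.independent (rows M)"
    by (intro vec.card_le_dim_spanning[of _ "rows M"]) (auto simp: dim fin vec.span_base)
  have "CARD('n) \<le> card (rows M)"
    using vec.dim_le_card'[OF fin] dim by simp
  then have inj: "inj (\<lambda>i. row i M)"
    unfolding rows by (intro eq_card_imp_inj_on) (use \<open>card (rows M) \<le> CARD('n)\<close> rows in auto)
  define u where "u x = w $ (the_inv (\<lambda>i. row i M) x)" for x
  have u: "u (row i M) = w $ i" for i unfolding u_def by (simp add: the_inv_f_f[OF inj])
  have "(\<Sum>x\<in>rows M. u x *s x) = (\<Sum>i\<in>UNIV. w $ i *s row i M)"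
    unfolding rows by (subst sum.reindex[OF inj]) (simp add: u)
  also have "\<dots> = 0" using w by (simp add: vec_eq_iff row_def)
  finally have "(\<Sum>x\<in>rows M. u x *s x) = 0" .
  then have "u (row i M) = 0" for i
    by (rule vec.independentD[OF indep fin subset_refl]) (simp add: rows)
  then show ?thesis by (simp add: u vec_eq_iff)
qed

text \<open>The Gram matrix $M M^*$ is injective, hence surjective.\<close>

lemma full_row_rank_surj:
  fixes M :: "complex^'k^'n"
  assumes rank: "rank M = CARD('n)"
  shows "\<exists>x. M *v x = v"
proof -
  define N where "N = M ** conj_transpose M"
  have inj: "w = 0" if "N *v w = 0" for w
  proof -
    define y where "y = conj_transpose M *v w"
    have yj: "y $ j = (\<Sum>i\<in>UNIV. cnj (M $ i $ j) * w $ i)" for j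
      by (simp add: y_def conj_transpose_def matrix_vector_mult_def)
    have cy: "cnj (y $ j) = (\<Sum>i\<in>UNIV. cnj (w $ i) * M $ i $ j)" for j
      by (simp add: yj mult.commute)
    have "M *v y = 0" using that by (simp add: N_def y_def matrix_vector_mul_assoc)
    then have "0 = (\<Sum>i\<in>UNIV. cnj (w $ i) * (M *v y) $ i)" by simp
    also have "\<dots> = (\<Sum>i\<in>UNIV. \<Sum>j\<in>UNIV. cnj (w $ i) * M $ i $ j * y $ j)"
      by (simp add: matrix_vector_mult_def sum_distrib_left mult.assoc)
    also have "\<dots> = (\<Sum>j\<in>UNIV. \<Sum>i\<in>UNIV. cnj (w $ i) * M $ i $ j * y $ j)" by (rule sum.swap)
    also have "\<dots> = (\<Sum>j\<in>UNIV. cnj (y $ j) * y $ j)"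
      unfolding cy sum_distrib_right ..
    finally have "y \<bullet> y = 0" by (simp add: inner_vec_complex)
    then have y0: "y = 0" by simp
    have "(\<Sum>i\<in>UNIV. (\<chi> i. cnj (w $ i)) $ i * M $ i $ j) = cnj (y $ j)" for j
      by (simp add: yj mult.commute)
    then have "(\<chi> i. cnj (w $ i)) = 0"
      using y0 by (intro full_row_rank_left_kernel[OF rank]) simp
    then show ?thesis by (simp add: vec_eq_iff)
  qed
  have "surj ((*v) N)"
    by (rule linear_inj_imp_surj[OF linear_matrix_vector])
       (use inj in \<open>simp add: linear_injective_0[OF linear_matrix_vector]\<close>)
  then obtain w where "v = N *v w" by (metis surjD)
  then have "M *v (conj_transpose M *v w) = v" by (simp add: N_def matrix_vector_mul_assoc)
  then show ?thesis by blast
qed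

text \<open>Solve \<open>(mu I - A) a + B b = v\<close> and apply \<open>G\<close>, which annihilates the first summand: controls act
surjectively on the component belonging to \<open>mu\<close>.\<close>

lemma hautus_right_inverse:
  fixes A G :: "complex^'n^'n" and B :: "complex^'l^'n" and mu :: real
  assumes rank: "rank (hcat (mat (complex_of_real mu) - A) B) = CARD('n)"
    and G: "\<And>v. G *v (A *v v) = mu *\<^sub>R (G *v v)"
  obtains R :: "complex^'n^'l" where "\<And>v. G *v (B *v (R *v v)) = G *v v"
proof -
  have "\<exists>y. G *v (B *v y) = G *v v" for v
  proof -
    obtain x where x: "hcat (mat (complex_of_real mu) - A) B *v x = v"
      using full_row_rank_surj[OF rank] by blast
    define a where "a = (\<chi> i. x $ Inl i)"
    define b where "b = (\<chi> i. x $ Inr i)"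
    have "hcat (mat (complex_of_real mu) - A) B *v x = (mat (complex_of_real mu) - A) *v a + B *v b"
    proof (rule vec_eq_iff[THEN iffD2], rule allI)
      fix r
      have Plus: "(\<Sum>j\<in>UNIV. g j) = (\<Sum>p\<in>UNIV. g (Inl p)) + (\<Sum>q\<in>UNIV. g (Inr q))"
        for g :: "'n + 'l \<Rightarrow> complex"
        unfolding UNIV_Plus_UNIV[symmetric] by (subst sum.Plus) (simp_all add: o_def)
      have "(hcat (mat (complex_of_real mu) - A) B *v x) $ r
         = (\<Sum>j\<in>UNIV. hcat (mat (complex_of_real mu) - A) B $ r $ j * x $ j)"
        by (simp add: matrix_vector_mult_def)
      also have "\<dots> = ((mat (complex_of_real mu) - A) *v a + B *v b) $ r"
        unfolding Plus by (simp add: hcat_def a_def b_def matrix_vector_mult_def)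
      finally show "(hcat (mat (complex_of_real mu) - A) B *v x) $ r
         = ((mat (complex_of_real mu) - A) *v a + B *v b) $ r" .
    qed
    moreover have "(mat (complex_of_real mu) - A) *v a = mu *\<^sub>R a - A *v a"
    proof -
      have "mat (complex_of_real mu) *v a = mu *\<^sub>R a"
        by (simp add: vec_eq_iff matrix_vector_mult_def mat_def scaleR_conv_of_real[where 'a = complex]
            if_distrib[of "\<lambda>x. x * _"] cong: if_cong)
      then show ?thesis by (simp add: matrix_vector_mult_diff_rdistrib)
    qed
    ultimately have v: "v = mu *\<^sub>R a - A *v a + B *v b" using x by simp
    interpret G: linear "(*v) G" by (rule linear_matrix_vector)
    have "G *v v = G *v (B *v b)" unfolding v by (simp add: G.add G.diff G.scale G)
    then show ?thesis by metis
  qed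
  then obtain y where y: "\<And>v. G *v (B *v y v) = G *v v" by metis
  define R :: "complex^'n^'l" where "R = (\<chi> r c. y (axis c 1) $ r)"
  have "(G ** B) ** R = G"
  proof (rule vec_eq_iff[THEN iffD2], rule allI, rule vec_eq_iff[THEN iffD2], rule allI)
    fix r c
    have "((G ** B) ** R) $ r $ c = ((G ** B) *v y (axis c 1)) $ r"
      by (simp add: matrix_matrix_mult_def R_def matrix_vector_mult_def)
    also have "\<dots> = (G *v axis c 1) $ r" using y[of "axis c 1"] by (simp add: matrix_vector_mul_assoc)
    also have "\<dots> = (\<Sum>j\<in>UNIV. if j = c then G $ r $ c else 0)"
      unfolding matrix_vector_mult_def vec_lambda_beta by (intro sum.cong refl) (simp add: axis_def)
    also have "\<dots> = G $ r $ c" by simp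
    finally show "((G ** B) ** R) $ r $ c = G $ r $ c" .
  qed
  then have "G *v (B *v (R *v v)) = G *v v" for v
    by (simp add: matrix_vector_mul_assoc matrix_mul_assoc)
  then show ?thesis by (rule that)
qed

section \<open>Sine series in the spectral spaces\<close>

lemma integrable_Omega:
  fixes f :: "real \<Rightarrow> 'a::euclidean_space"
  assumes "continuous_on UNIV f"
  shows "integrable Omega f"
proof -
  have "f absolutely_integrable_on {0..pi}"
    by (intro absolutely_integrable_continuous_real continuous_on_subset[OF assms]) auto
  then have "f absolutely_integrable_on {0<..<pi}"
    by (rule set_integrable_subset) auto
  then show ?thesis by (simp add: integrable_restrict_space set_integrable_def)
qed

lemma LINT_Omega:
  fixes f :: "real \<Rightarrow> 'a::euclidean_space"
  assumes "continuous_on UNIV f"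
  shows "(LINT x|Omega. f x) = integral {0..pi} f"
  using lebesgue_integral_eq_integral[OF integrable_Omega[OF assms]]
  by (simp add: integral_open_interval_real)

lemma sq_integrable_continuous:
  assumes "continuous_on UNIV f"
  shows "sq_integrable Omega f"
  unfolding sq_integrable_def
proof
  show "f \<in> borel_measurable Omega" using integrable_Omega[OF assms] by simp
  show "integrable Omega (\<lambda>x. (norm (f x))\<^sup>2)"
    by (intro integrable_Omega continuous_intros assms)
qed

lemma norm_diff_sq_le:
  fixes a b :: "'a::real_normed_vector"
  shows "(norm (a - b))\<^sup>2 \<le> 2 * (norm a)\<^sup>2 + 2 * (norm b)\<^sup>2"
proof -
  have "(norm (a - b))\<^sup>2 \<le> (norm a + norm b)\<^sup>2"
    by (intro power_mono norm_triangle_ineq4) auto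
  also have "\<dots> \<le> 2 * (norm a)\<^sup>2 + 2 * (norm b)\<^sup>2"
    using sum_squares_bound[of "norm a" "norm b"] by (simp add: power2_sum)
  finally show ?thesis .
qed

lemma sq_integrable_diff:
  assumes "sq_integrable M f" "sq_integrable M g"
  shows "sq_integrable M (\<lambda>x. f x - g x)"
proof -
  have m[measurable]: "f \<in> borel_measurable M" "g \<in> borel_measurable M"
    and i: "integrable M (\<lambda>x. (norm (f x))\<^sup>2)" "integrable M (\<lambda>x. (norm (g x))\<^sup>2)"
    using assms by (auto simp: sq_integrable_def)
  have "integrable M (\<lambda>x. (norm (f x - g x))\<^sup>2)"
    by (rule Bochner_Integration.integrable_bound[of M "\<lambda>x. 2 * (norm (f x))\<^sup>2 + 2 * (norm (g x))\<^sup>2"])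
       (use i norm_diff_sq_le in auto)
  then show ?thesis by (simp add: sq_integrable_def)
qed

lemma phi_0 [simp]: "phi 0 x = 0" by (simp add: phi_def)

lemma phi_le_1: "\<bar>phi m x\<bar> \<le> 1"
proof -
  have "sqrt (2 / pi) \<le> 1" using pi_gt3 by simp
  then have "sqrt (2 / pi) * \<bar>sin (real m * x)\<bar> \<le> 1 * 1"
    by (intro mult_mono) auto
  then show ?thesis by (simp add: phi_def abs_mult)
qed

lemma continuous_on_phi [continuous_intros]: "continuous_on S (phi m)"
  unfolding phi_def[abs_def] by (intro continuous_intros)

lemma phi_orthonormal:
  assumes "1 \<le> m"
  shows "integral {0..pi} (\<lambda>x. phi m x * phi n x) = (if m = n then 1 else 0)"
proof -
  have prod: "phi m x * phi n x = (2 / pi) * (sin (real m * x) * sin (real n * x))" for x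
  proof -
    have "phi m x * phi n x = (sqrt (2 / pi) * sqrt (2 / pi)) * (sin (real m * x) * sin (real n * x))"
      by (simp only: phi_def mult_ac)
    then show ?thesis by simp
  qed
  have ss: "sin (real m * x) * sin (real n * x)
      = (cos ((real m - real n) * x) - cos ((real m + real n) * x)) / 2" for x
    by (simp add: sin_times_sin algebra_simps)
  have pos: "0 < real m + real n" using assms by simp
  have z: "sin ((real m + real n) * pi) = 0"
    using sin_npi[of "m + n"] by simp
  have d: "((\<lambda>x. sin (p * x) / (2 * p)) has_vector_derivative cos (p * x) / 2) (at x within X)"
    if "p \<noteq> 0" for p x :: real and X
    unfolding has_real_derivative_iff_has_vector_derivative[symmetric]
    by (rule derivative_eq_intros refl | simp add: that)+
  have I: "((\<lambda>x. cos (p * x) / 2) has_integral sin (p * pi) / (2 * p)) {0..pi}" if "p \<noteq> 0" for p :: real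
    using fundamental_theorem_of_calculus[OF _ d[OF that], of 0 pi] by simp
  have "((\<lambda>x. sin (real m * x) * sin (real n * x)) has_integral (if m = n then pi / 2 else 0)) {0..pi}"
  proof (cases "m = n")
    case True
    have "((\<lambda>x. 1 / 2 - cos ((real m + real n) * x) / 2) has_integral
       pi / 2 - sin ((real m + real n) * pi) / (2 * (real m + real n))) {0..pi}"
      using has_integral_const_real[of "1 / 2 :: real" 0 pi] pos
      by (intro has_integral_diff I) auto
    then show ?thesis using True z unfolding ss by (simp add: diff_divide_distrib)
  next
    case False
    then have ne: "real m - real n \<noteq> 0" by simp
    have "(real m - real n) * pi = of_int (int m - int n) * pi" by simp
    then have z': "sin ((real m - real n) * pi) = 0"
      by (metis sin_npi_int mult.commute)
    have "((\<lambda>x. cos ((real m - real n) * x) / 2 - cos ((real m + real n) * x) / 2) has_integral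
       sin ((real m - real n) * pi) / (2 * (real m - real n)) - sin ((real m + real n) * pi) / (2 * (real m + real n))) {0..pi}"
      using pos ne by (intro has_integral_diff I) auto
    then show ?thesis using False z z' unfolding ss by (simp add: diff_divide_distrib)
  qed
  then have "integral {0..pi} (\<lambda>x. sin (real m * x) * sin (real n * x)) = (if m = n then pi / 2 else 0)"
    by (rule integral_unique)
  then show ?thesis unfolding prod by simp
qed

text \<open>The sine series with coefficients \<open>c\<close>. All series below have absolutely summable coefficients, so they
converge uniformly; the index \<open>0\<close> contributes nothing because \<open>phi 0 = 0\<close>.\<close>

definition synth :: "(nat \<Rightarrow> 'a::euclidean_space) \<Rightarrow> real \<Rightarrow> 'a" where
  "synth c x = (\<Sum>m. phi m x *\<^sub>R c m)"

lemma synth_term_bound: "norm (phi m x *\<^sub>R c) \<le> norm c"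
  using mult_right_mono[OF phi_le_1 norm_ge_zero] by simp

lemma synth_uniform:
  assumes "summable (\<lambda>m. norm (c m))"
  shows "uniform_limit UNIV (\<lambda>M x. \<Sum>m<M. phi m x *\<^sub>R c m) (synth c) sequentially"
  unfolding synth_def[abs_def]
  by (rule Weierstrass_m_test[OF _ assms]) (rule synth_term_bound)

lemma synth_continuous:
  assumes "summable (\<lambda>m. norm (c m))"
  shows "continuous_on S (synth c)"
proof -
  have "continuous_on UNIV (synth c)"
    by (rule uniform_limit_theorem[OF _ synth_uniform[OF assms]])
       (auto intro!: always_eventually continuous_intros)
  then show ?thesis by (rule continuous_on_subset) simp
qed

lemma synth_diff:
  assumes "summable (\<lambda>m. norm (c m))" "summable (\<lambda>m. norm (d m))"
  shows "synth c x - synth d x = synth (\<lambda>m. c m - d m) x"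
proof -
  have "summable (\<lambda>m. phi m x *\<^sub>R c m)" "summable (\<lambda>m. phi m x *\<^sub>R d m)"
    by (rule summable_comparison_test'[OF assms(1)] summable_comparison_test'[OF assms(2)],
        rule synth_term_bound)+
  then show ?thesis unfolding synth_def by (simp add: suminf_diff scaleR_diff_right)
qed

lemma synth_scaleR:
  assumes "summable (\<lambda>m. norm (c m))"
  shows "a *\<^sub>R synth c x = synth (\<lambda>m. a *\<^sub>R c m) x"
proof -
  have "summable (\<lambda>m. phi m x *\<^sub>R c m)"
    by (rule summable_comparison_test'[OF assms(1)], rule synth_term_bound)
  then show ?thesis unfolding synth_def by (simp add: suminf_scaleR_right mult.commute)
qed

lemma coef_0 [simp]: "coef 0 y = 0" by (simp add: coef_def)

lemma coef_synth:
  fixes c :: "nat \<Rightarrow> 'a::euclidean_space"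
  assumes c: "summable (\<lambda>m. norm (c m))" and m: "1 \<le> m"
  shows "coef m (synth c) = c m"
proof -
  have "uniform_limit {0..pi} (\<lambda>M x. phi m x *\<^sub>R (\<Sum>k<M. phi k x *\<^sub>R c k)) (\<lambda>x. phi m x *\<^sub>R synth c x) sequentially"
  proof (rule bounded_bilinear.bounded_uniform_limit[OF bounded_bilinear_scaleR uniform_limit_const])
    show "uniform_limit {0..pi} (\<lambda>M x. \<Sum>k<M. phi k x *\<^sub>R c k) (synth c) sequentially"
      by (rule uniform_limit_on_subset[OF synth_uniform[OF c]]) simp
    show "bounded (phi m ` {0..pi})"
      by (intro compact_imp_bounded compact_continuous_image continuous_intros) auto
    show "bounded (synth c ` {0..pi})"
      by (intro compact_imp_bounded compact_continuous_image synth_continuous[OF c]) auto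
  qed
  then obtain I J where IJ: "\<And>M. ((\<lambda>x. phi m x *\<^sub>R (\<Sum>k<M. phi k x *\<^sub>R c k)) has_integral I M) {0..pi}"
      "((\<lambda>x. phi m x *\<^sub>R synth c x) has_integral J) {0..pi}" "I \<longlonglongrightarrow> J"
    by (rule uniform_limit_integral) (auto intro!: continuous_intros)
  have I: "I M = (\<Sum>k<M. if m = k then c k else 0)" for M
  proof -
    have "((\<lambda>x. \<Sum>k<M. (phi m x * phi k x) *\<^sub>R c k) has_integral (\<Sum>k<M. (if m = k then 1 else 0) *\<^sub>R c k)) {0..pi}"
    proof (rule has_integral_sum)
      fix k assume "k \<in> {..<M}"
      have "((\<lambda>x. phi m x * phi k x) has_integral (if m = k then 1 else 0)) {0..pi}"
        unfolding phi_orthonormal[OF m, symmetric]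
        by (intro integrable_integral integrable_continuous_real continuous_intros)
      then show "((\<lambda>x. (phi m x * phi k x) *\<^sub>R c k) has_integral (if m = k then 1 else 0) *\<^sub>R c k) {0..pi}"
        by (rule has_integral_scaleR_left)
    qed simp
    then have "((\<lambda>x. phi m x *\<^sub>R (\<Sum>k<M. phi k x *\<^sub>R c k)) has_integral (\<Sum>k<M. if m = k then c k else 0)) {0..pi}"
      by (simp add: scaleR_sum_right if_distrib[of "\<lambda>a. a *\<^sub>R _"] cong: if_cong)
    then show ?thesis using has_integral_unique[OF IJ(1)] by blast
  qed
  have "\<forall>\<^sub>F M in sequentially. I M = c m"
    by (rule eventually_sequentiallyI[of "Suc m"]) (simp add: I)
  then have "J = c m" using LIMSEQ_unique[OF IJ(3) tendsto_eventually] by blast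
  then show ?thesis
    unfolding coef_def using IJ(2)
    by (subst LINT_Omega) (auto intro!: continuous_intros synth_continuous[OF c] simp: integral_unique)
qed

lemma synth_partial_sum_error:
  assumes c: "summable (\<lambda>m. norm (c m))"
  shows "norm (synth c x - (\<Sum>m=1..M. phi m x *\<^sub>R c m)) \<le> (\<Sum>m. norm (c (m + Suc M)))"
proof -
  have s: "summable (\<lambda>m. phi m x *\<^sub>R c m)"
    by (rule summable_comparison_test'[OF c], rule synth_term_bound)
  have "(\<Sum>m=1..M. phi m x *\<^sub>R c m) = (\<Sum>m<Suc M. phi m x *\<^sub>R c m)"
    by (rule sum.mono_neutral_left) (auto simp: not_le less_Suc_eq_le)
  then have "synth c x - (\<Sum>m=1..M. phi m x *\<^sub>R c m) = (\<Sum>m. phi (m + Suc M) x *\<^sub>R c (m + Suc M))"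
    unfolding synth_def using suminf_split_initial_segment[OF s, of "Suc M"] by simp
  moreover have sn: "summable (\<lambda>m. norm (c (m + Suc M)))" using c by (subst summable_iff_shift)
  ultimately show ?thesis
    by (metis (no_types, lifting) norm_suminf_le synth_term_bound)
qed

lemma synth_tail_tendsto:
  assumes c: "summable (\<lambda>m. norm (c m))"
  shows "(\<lambda>M. \<Sum>m. norm (c (m + Suc M))) \<longlonglongrightarrow> 0"
  using LIMSEQ_Suc[OF suminf_exist_split2[OF c]] by simp

lemma sq_integrable_synth:
  "summable (\<lambda>m. norm (c m)) \<Longrightarrow> sq_integrable Omega (synth c)"
  by (intro sq_integrable_continuous synth_continuous)

lemma measure_Omega [simp]: "measure Omega {0<..<pi} = pi"
  by (simp add: measure_restrict_space)

text \<open>The weight vanishes at \<open>m = 0\<close>, so sums over \<open>{1..}\<close> agree with series over all natural numbers.\<close>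

lemma weight_summable_on_iff:
  fixes a :: "nat \<Rightarrow> real"
  assumes a: "\<And>m. 0 \<le> a m"
  shows "(\<lambda>m. real m powr s * a m) summable_on {1..} \<longleftrightarrow> summable (\<lambda>m. real m powr s * a m)"
proof -
  let ?f = "\<lambda>m. real m powr s * a m"
  have "?f summable_on {1..} \<longleftrightarrow> ?f summable_on UNIV"
    by (rule summable_on_cong_neutral) (auto simp: not_le less_Suc_eq_le)
  also have "\<dots> \<longleftrightarrow> summable ?f"
    by (rule summable_on_UNIV_nonneg_real_iff) (simp add: a)
  finally show ?thesis .
qed

lemma weight_infsum_eq:
  fixes a :: "nat \<Rightarrow> real"
  assumes a: "\<And>m. 0 \<le> a m" and s: "summable (\<lambda>m. real m powr s * a m)"
  shows "infsum (\<lambda>m. real m powr s * a m) {1..} = (\<Sum>m. real m powr s * a m)"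
proof -
  let ?f = "\<lambda>m. real m powr s * a m"
  have "infsum ?f {1..} = infsum ?f UNIV"
    by (rule infsum_cong_neutral) (auto simp: not_le less_Suc_eq_le)
  also have "(?f has_sum suminf ?f) UNIV"
    by (rule sums_nonneg_imp_has_sum) (use s a in \<open>auto simp: summable_sums\<close>)
  then have "infsum ?f UNIV = suminf ?f" by (rule infsumI)
  finally show ?thesis .
qed

lemma synth_weight_cong:
  assumes "summable (\<lambda>m. norm (c m))"
  shows "(\<lambda>m. real m powr s * (norm (coef m (synth c)))\<^sup>2) = (\<lambda>m. real m powr s * (norm (c m))\<^sup>2)"
proof
  fix m :: nat
  show "real m powr s * (norm (coef m (synth c)))\<^sup>2 = real m powr s * (norm (c m))\<^sup>2"
    by (cases "m = 0") (simp_all add: coef_synth[OF assms])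
qed

lemma synth_in_Xs:
  assumes c: "summable (\<lambda>m. norm (c m))" and s: "summable (\<lambda>m. real m powr (2 * s) * (norm (c m))\<^sup>2)"
  shows "synth c \<in> Xs s"
proof -
  have "(\<lambda>M. LINT x|Omega. (norm (synth c x - (\<Sum>m=1..M. phi m x *\<^sub>R coef m (synth c))))\<^sup>2) \<longlonglongrightarrow> 0"
  proof (rule tendsto_sandwich[of "\<lambda>_. 0" _ _ "\<lambda>M. pi * (\<Sum>m. norm (c (m + Suc M)))\<^sup>2"])
    show "(\<lambda>M. pi * (\<Sum>m. norm (c (m + Suc M)))\<^sup>2) \<longlonglongrightarrow> 0"
      using tendsto_mult_left[OF tendsto_power[OF synth_tail_tendsto[OF c], of 2], of pi] by simp
    show "\<forall>\<^sub>F M in sequentially. 0 \<le> (LINT x|Omega. (norm (synth c x - (\<Sum>m=1..M. phi m x *\<^sub>R coef m (synth c))))\<^sup>2)"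
      by (intro always_eventually allI integral_nonneg) auto
    show "\<forall>\<^sub>F M in sequentially. (LINT x|Omega. (norm (synth c x - (\<Sum>m=1..M. phi m x *\<^sub>R coef m (synth c))))\<^sup>2)
        \<le> pi * (\<Sum>m. norm (c (m + Suc M)))\<^sup>2"
    proof (intro always_eventually allI)
      fix M
      have eq: "(\<Sum>m=1..M. phi m x *\<^sub>R coef m (synth c)) = (\<Sum>m=1..M. phi m x *\<^sub>R c m)" for x
        by (intro sum.cong refl) (simp add: coef_synth[OF c])
      have "(LINT x|Omega. (norm (synth c x - (\<Sum>m=1..M. phi m x *\<^sub>R c m)))\<^sup>2)
         \<le> (LINT x|Omega. (\<Sum>m. norm (c (m + Suc M)))\<^sup>2)"
        by (intro integral_mono integrable_Omega power_mono synth_partial_sum_error[OF c])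
           (auto intro!: continuous_intros synth_continuous[OF c])
      also have "\<dots> = pi * (\<Sum>m. norm (c (m + Suc M)))\<^sup>2" by (simp add: measure_Omega)
      finally show "(LINT x|Omega. (norm (synth c x - (\<Sum>m=1..M. phi m x *\<^sub>R coef m (synth c))))\<^sup>2)
        \<le> pi * (\<Sum>m. norm (c (m + Suc M)))\<^sup>2" unfolding eq .
    qed
  qed simp
  then show ?thesis
    unfolding Xs_def mem_Collect_eq synth_weight_cong[OF c]
    using s sq_integrable_synth[OF c] weight_summable_on_iff[of "\<lambda>m. (norm (c m))\<^sup>2" "2 * s"] by simp
qed

lemma Xs_norm_synth:
  assumes c: "summable (\<lambda>m. norm (c m))" and s: "summable (\<lambda>m. real m powr (2 * s) * (norm (c m))\<^sup>2)"
  shows "Xs_norm s (synth c) = sqrt (\<Sum>m. real m powr (2 * s) * (norm (c m))\<^sup>2)"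
  unfolding Xs_norm_def synth_weight_cong[OF c]
  by (subst weight_infsum_eq[OF _ s]) simp_all

text \<open>An element of \<open>Xs s\<close> is the mean square limit of its partial sums; if the coefficients are absolutely
summable these also converge uniformly, and the two limits agree almost everywhere. In particular
an element with vanishing coefficients is null.\<close>

lemma Xs_AE_synth:
  fixes y :: "real \<Rightarrow> 'a::euclidean_space"
  assumes y: "y \<in> Xs s" and c: "summable (\<lambda>m. norm (coef m y))"
  shows "AE x in Omega. y x = synth (\<lambda>m. coef m y) x"
proof -
  define c where "c = (\<lambda>m. coef m y)"
  have c: "summable (\<lambda>m. norm (c m))" using c by (simp add: c_def)
  have sy: "sq_integrable Omega y"
    and lim: "(\<lambda>M. LINT x|Omega. (norm (y x - (\<Sum>m=1..M. phi m x *\<^sub>R c m)))\<^sup>2) \<longlonglongrightarrow> 0"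
    using y by (auto simp: Xs_def c_def)
  let ?P = "\<lambda>M x. \<Sum>m=1..M. phi m x *\<^sub>R c m"
  have sP: "sq_integrable Omega (?P M)" for M
    by (intro sq_integrable_continuous continuous_intros)
  have iyP: "integrable Omega (\<lambda>x. (norm (y x - ?P M x))\<^sup>2)" for M
    using sq_integrable_diff[OF sy sP] by (simp add: sq_integrable_def)
  have iys: "integrable Omega (\<lambda>x. (norm (y x - synth c x))\<^sup>2)"
    using sq_integrable_diff[OF sy sq_integrable_synth[OF c]] by (simp add: sq_integrable_def)
  let ?I = "LINT x|Omega. (norm (y x - synth c x))\<^sup>2"
  have "?I \<le> 2 * (LINT x|Omega. (norm (y x - ?P M x))\<^sup>2) + 2 * (pi * (\<Sum>m. norm (c (m + Suc M)))\<^sup>2)" for M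
  proof -
    have "?I \<le> (LINT x|Omega. 2 * (norm (y x - ?P M x))\<^sup>2 + 2 * (\<Sum>m. norm (c (m + Suc M)))\<^sup>2)"
    proof (rule integral_mono[OF iys])
      show "integrable Omega (\<lambda>x. 2 * (norm (y x - ?P M x))\<^sup>2 + 2 * (\<Sum>m. norm (c (m + Suc M)))\<^sup>2)"
        by (intro Bochner_Integration.integrable_add Bochner_Integration.integrable_mult_right iyP integrable_Omega)
           (auto intro!: continuous_intros)
      fix x
      have "(norm (y x - synth c x))\<^sup>2 = (norm ((y x - ?P M x) - (synth c x - ?P M x)))\<^sup>2" by simp
      also have "\<dots> \<le> 2 * (norm (y x - ?P M x))\<^sup>2 + 2 * (norm (synth c x - ?P M x))\<^sup>2"
        by (rule norm_diff_sq_le)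
      also have "\<dots> \<le> 2 * (norm (y x - ?P M x))\<^sup>2 + 2 * (\<Sum>m. norm (c (m + Suc M)))\<^sup>2"
        by (intro add_left_mono mult_left_mono power_mono synth_partial_sum_error[OF c]) auto
      finally show "(norm (y x - synth c x))\<^sup>2 \<le> 2 * (norm (y x - ?P M x))\<^sup>2 + 2 * (\<Sum>m. norm (c (m + Suc M)))\<^sup>2" .
    qed
    also have "\<dots> = (LINT x|Omega. 2 * (norm (y x - ?P M x))\<^sup>2) + (LINT x|Omega. 2 * (\<Sum>m. norm (c (m + Suc M)))\<^sup>2)"
      by (intro Bochner_Integration.integral_add Bochner_Integration.integrable_mult_right iyP integrable_Omega)
         (auto intro!: continuous_intros)
    also have "(LINT x|Omega. 2 * (\<Sum>m. norm (c (m + Suc M)))\<^sup>2) = 2 * (pi * (\<Sum>m. norm (c (m + Suc M)))\<^sup>2)"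
      by (simp add: measure_Omega)
    finally show ?thesis by simp
  qed
  moreover have "(\<lambda>M. 2 * (LINT x|Omega. (norm (y x - ?P M x))\<^sup>2) + 2 * (pi * (\<Sum>m. norm (c (m + Suc M)))\<^sup>2))
      \<longlonglongrightarrow> 2 * 0 + 2 * (pi * 0\<^sup>2)"
    by (intro tendsto_intros lim synth_tail_tendsto[OF c])
  ultimately have "?I \<le> 0" by (intro LIMSEQ_le_const) auto
  moreover have "0 \<le> ?I" by (intro Bochner_Integration.integral_nonneg) auto
  ultimately have "?I = 0" by simp
  then have "AE x in Omega. (norm (y x - synth c x))\<^sup>2 = 0"
    by (subst (asm) integral_nonneg_eq_0_iff_AE[OF iys]) auto
  then show ?thesis unfolding c_def by simp
qed

lemma Xs_AE_zero:
  assumes "y \<in> Xs s" "\<And>m. 1 \<le> m \<Longrightarrow> coef m y = 0"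
  shows "AE x in Omega. y x = 0"
proof -
  have z: "coef m y = 0" for m using assms(2)[of m] by (cases "m = 0") auto
  show ?thesis using Xs_AE_synth[OF assms(1)] by (simp add: z synth_def)
qed

lemma coef_cong_AE:
  assumes "sq_integrable Omega y" "sq_integrable Omega z" "AE x in Omega. y x = z x"
  shows "coef m y = coef m z"
proof -
  have [measurable]: "phi m \<in> borel_measurable Omega"
    using integrable_Omega[OF continuous_on_phi[of UNIV m]] by simp
  have [measurable]: "y \<in> borel_measurable Omega" "z \<in> borel_measurable Omega"
    using assms by (auto simp: sq_integrable_def)
  show ?thesis unfolding coef_def
    by (rule integral_cong_AE) (use assms(3) in auto)
qed

lemma Xs_coef_summable:
  assumes "y \<in> Xs s"
  shows "summable (\<lambda>m. real m powr (2 * s) * (norm (coef m y))\<^sup>2)"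
  by (subst weight_summable_on_iff[symmetric]) (use assms in \<open>auto simp: Xs_def\<close>)

lemma Xs_coef_bound:
  assumes "y \<in> Xs s" "1 \<le> m"
  shows "real m powr s * norm (coef m y) \<le> Xs_norm s y"
proof -
  have s: "summable (\<lambda>m. real m powr (2 * s) * (norm (coef m y))\<^sup>2)"
    by (rule Xs_coef_summable[OF assms(1)])
  have "real m powr (2 * s) * (norm (coef m y))\<^sup>2 \<le> (\<Sum>m. real m powr (2 * s) * (norm (coef m y))\<^sup>2)"
    using sum_le_suminf[OF s, of "{m}"] by simp
  also have "real m powr (2 * s) = (real m powr s)\<^sup>2"
    using assms(2) by (simp add: powr_power mult.commute)
  finally have "(real m powr s * norm (coef m y))\<^sup>2 \<le> (\<Sum>m. real m powr (2 * s) * (norm (coef m y))\<^sup>2)"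
    by (simp add: power_mult_distrib)
  then show ?thesis
    unfolding Xs_norm_def by (subst weight_infsum_eq[OF _ s]) (simp_all add: real_le_rsqrt)
qed

text \<open>Young's inequality $2 |c_m| \le m^2 |c_m|^2 + m^{-2}$: both \<open>Xs 1\<close> and \<open>Xs 3\<close> have absolutely
summable coefficients.\<close>

lemma summable_norm_of_weighted:
  assumes "summable (\<lambda>m. real m powr 2 * (norm (c m))\<^sup>2)"
  shows "summable (\<lambda>m. norm (c m))"
proof -
  have "summable (\<lambda>m. (real m powr 2 * (norm (c m))\<^sup>2 + 1 / (real m)\<^sup>2) / 2)"
    using assms inverse_power_summable[of 2, where 'a = real]
    by (intro summable_divide summable_add) (simp_all add: inverse_eq_divide)
  then show ?thesis
  proof (rule summable_comparison_test'[where N = 1])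
    fix m :: nat assume m: "1 \<le> m"
    have "2 * (real m * norm (c m)) * (1 / real m) \<le> (real m * norm (c m))\<^sup>2 + (1 / real m)\<^sup>2"
      by (rule sum_squares_bound)
    then show "norm (norm (c m)) \<le> (real m powr 2 * (norm (c m))\<^sup>2 + 1 / (real m)\<^sup>2) / 2"
      using m by (simp add: power_mult_distrib power_divide)
  qed
qed

text \<open>Dominated convergence for the weighted square sums, by Tannery's theorem.\<close>

lemma Xs_norm_synth_tendsto:
  fixes d :: "real \<Rightarrow> nat \<Rightarrow> 'a::euclidean_space"
  assumes lim: "\<And>m. ((\<lambda>r. d r m) \<longlongrightarrow> 0) F" and F: "F \<noteq> bot"
    and bound: "\<forall>\<^sub>F r in F. \<forall>m. norm (d r m) \<le> b m"
    and b: "summable b" "summable (\<lambda>m. real m powr (2 * s) * (b m)\<^sup>2)"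
  shows "((\<lambda>r. Xs_norm s (synth (d r))) \<longlongrightarrow> 0) F"
proof -
  have "((\<lambda>r. \<Sum>m. real m powr (2 * s) * (norm (d r m))\<^sup>2) \<longlongrightarrow> (\<Sum>m. 0)) F"
  proof (rule tannerys_theorem[THEN conjunct2, THEN conjunct2, OF _ _ b(2) F])
    show "((\<lambda>r. real m powr (2 * s) * (norm (d r m))\<^sup>2) \<longlongrightarrow> 0) F" for m
      using tendsto_mult_left[OF tendsto_power[OF tendsto_norm[OF lim[of m]], of 2], of "real m powr (2 * s)"]
      by simp
    show "\<forall>\<^sub>F (m, r) in at_top \<times>\<^sub>F F. norm (real m powr (2 * s) * (norm (d r m))\<^sup>2) \<le> real m powr (2 * s) * (b m)\<^sup>2"
      unfolding eventually_prod_filter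
    proof (intro exI conjI allI impI)
      show "\<forall>\<^sub>F m::nat in at_top. True" by simp
      show "\<forall>\<^sub>F r in F. \<forall>m. norm (d r m) \<le> b m" by (rule bound)
      fix m r assume "\<forall>m. norm (d r m) \<le> b m"
      then show "case (m, r) of (m, r) \<Rightarrow> norm (real m powr (2 * s) * (norm (d r m))\<^sup>2) \<le> real m powr (2 * s) * (b m)\<^sup>2"
        by (auto intro!: mult_left_mono power_mono)
    qed
  qed
  then have "((\<lambda>r. sqrt (\<Sum>m. real m powr (2 * s) * (norm (d r m))\<^sup>2)) \<longlongrightarrow> 0) F"
    using tendsto_real_sqrt by fastforce
  then show ?thesis
  proof (rule Lim_transform_eventually)
    show "\<forall>\<^sub>F r in F. sqrt (\<Sum>m. real m powr (2 * s) * (norm (d r m))\<^sup>2) = Xs_norm s (synth (d r))"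
      using bound
    proof eventually_elim
      case (elim r)
      have "summable (\<lambda>m. norm (d r m))"
        by (rule summable_comparison_test'[OF b(1)]) (use elim in auto)
      moreover have "summable (\<lambda>m. real m powr (2 * s) * (norm (d r m))\<^sup>2)"
        by (rule summable_comparison_test'[OF b(2)])
           (use elim in \<open>auto intro!: mult_left_mono power_mono\<close>)
      ultimately show ?case by (simp add: Xs_norm_synth)
    qed
  qed
qed

lemma C0_Xs_synth:
  fixes c :: "real \<Rightarrow> nat \<Rightarrow> 'a::euclidean_space"
  assumes T: "0 < T" and cont: "\<And>m. continuous_on {0..T} (\<lambda>t. c t m)"
    and bound: "\<And>t m. t \<in> {0..T} \<Longrightarrow> norm (c t m) \<le> b m"
    and b: "summable b" "summable (\<lambda>m. real m powr (2 * s) * (b m)\<^sup>2)"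
  shows "C0_Xs T s (\<lambda>t. synth (c t))"
proof -
  have sc: "summable (\<lambda>m. norm (c t m))" if "t \<in> {0..T}" for t
    by (rule summable_comparison_test'[OF b(1)]) (use bound[OF that] in auto)
  show ?thesis unfolding C0_Xs_def
  proof (intro ballI conjI)
    fix t assume t: "t \<in> {0..T}"
    have "summable (\<lambda>m. real m powr (2 * s) * (norm (c t m))\<^sup>2)"
      by (rule summable_comparison_test'[OF b(2)])
         (use bound[OF t] in \<open>auto intro!: mult_left_mono power_mono\<close>)
    then show "synth (c t) \<in> Xs s" by (rule synth_in_Xs[OF sc[OF t]])
    have nb: "at t within {0..T} \<noteq> bot" using t T by (simp add: trivial_limit_within islimpt_Icc)
    have ev: "\<forall>\<^sub>F r in at t within {0..T}. r \<in> {0..T}" by (auto simp: eventually_at_filter)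
    have "((\<lambda>r. Xs_norm s (synth (\<lambda>m. c r m - c t m))) \<longlongrightarrow> 0) (at t within {0..T})"
    proof (rule Xs_norm_synth_tendsto[OF _ nb, where b = "\<lambda>m. 2 * b m"])
      show "((\<lambda>r. c r m - c t m) \<longlongrightarrow> 0) (at t within {0..T})" for m
        using cont[of m] t by (simp add: continuous_on_def LIM_zero_iff)
      show "\<forall>\<^sub>F r in at t within {0..T}. \<forall>m. norm (c r m - c t m) \<le> 2 * b m"
        using ev
      proof eventually_elim
        case (elim r)
        show ?case
        proof
          fix m
          show "norm (c r m - c t m) \<le> 2 * b m"
            using norm_triangle_ineq4[of "c r m" "c t m"] bound[OF elim, of m] bound[OF t, of m] by linarith
        qed
      qed
      show "summable (\<lambda>m. 2 * b m)" using b(1) by (rule summable_mult)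
      have "summable (\<lambda>m. 4 * (real m powr (2 * s) * (b m)\<^sup>2))" using b(2) by (rule summable_mult)
      then show "summable (\<lambda>m. real m powr (2 * s) * (2 * b m)\<^sup>2)" by (simp add: power_mult_distrib mult_ac)
    qed
    moreover have "\<forall>\<^sub>F r in at t within {0..T}. Xs_norm s (synth (\<lambda>m. c r m - c t m))
       = Xs_norm s (\<lambda>x. synth (c r) x - synth (c t) x)"
      using ev
    proof eventually_elim
      case (elim r)
      have "(\<lambda>x. synth (c r) x - synth (c t) x) = synth (\<lambda>m. c r m - c t m)"
        by (rule ext) (rule synth_diff[OF sc[OF elim] sc[OF t]])
      then show ?case by simp
    qed
    ultimately show "((\<lambda>r. Xs_norm s (\<lambda>x. synth (c r) x - synth (c t) x)) \<longlongrightarrow> 0) (at t within {0..T})"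
      by (rule Lim_transform_eventually)
  qed
qed

lemma has_vector_derivative_difference_quotient:
  assumes "(f has_vector_derivative f') (at t within S)"
  shows "((\<lambda>r. (f r - f t) /\<^sub>R (r - t) - f') \<longlongrightarrow> 0) (at t within S)"
proof -
  have "((\<lambda>r. (1 / norm (r - t)) *\<^sub>R (f r - (f t + (r - t) *\<^sub>R f'))) \<longlongrightarrow> 0) (at t within S)"
    using assms unfolding has_vector_derivative_def has_derivative_within by simp
  then have "((\<lambda>r. norm ((1 / norm (r - t)) *\<^sub>R (f r - (f t + (r - t) *\<^sub>R f')))) \<longlongrightarrow> 0) (at t within S)"
    by (rule tendsto_norm_zero)
  then have "((\<lambda>r. norm ((f r - f t) /\<^sub>R (r - t) - f')) \<longlongrightarrow> 0) (at t within S)"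
  proof (rule Lim_transform_eventually)
    have "norm ((1 / norm (r - t)) *\<^sub>R (f r - (f t + (r - t) *\<^sub>R f'))) = norm ((f r - f t) /\<^sub>R (r - t) - f')"
      if "r \<noteq> t" for r
    proof -
      have "f r - (f t + (r - t) *\<^sub>R f') = (r - t) *\<^sub>R ((f r - f t) /\<^sub>R (r - t) - f')"
        using that by (simp add: scaleR_diff_right)
      then show ?thesis using that by simp
    qed
    then show "\<forall>\<^sub>F r in at t within S. norm ((1 / norm (r - t)) *\<^sub>R (f r - (f t + (r - t) *\<^sub>R f')))
        = norm ((f r - f t) /\<^sub>R (r - t) - f')"
      by (simp add: eventually_at_filter)
  qed
  then show ?thesis by (rule tendsto_norm_zero_cancel)
qed

text \<open>The mean value inequality bounds the difference quotients of the coefficients by the same \<open>b\<close> as their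
derivatives, so dominated convergence applies to them.\<close>

lemma C1_Xs_synth:
  fixes c d :: "real \<Rightarrow> nat \<Rightarrow> 'a::euclidean_space"
  assumes T: "0 < T"
    and deriv: "\<And>t m. t \<in> {0..T} \<Longrightarrow> ((\<lambda>t. c t m) has_vector_derivative d t m) (at t within {0..T})"
    and contd: "\<And>m. continuous_on {0..T} (\<lambda>t. d t m)"
    and bound: "\<And>t m. t \<in> {0..T} \<Longrightarrow> norm (c t m) \<le> a m" "\<And>t m. t \<in> {0..T} \<Longrightarrow> norm (d t m) \<le> b m"
    and a: "summable a" "summable (\<lambda>m. real m powr (2 * s) * (a m)\<^sup>2)"
    and b: "summable b" "summable (\<lambda>m. real m powr (2 * s) * (b m)\<^sup>2)"
  shows "C1_Xs T s (\<lambda>t. synth (c t)) (\<lambda>t. synth (d t))"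
proof -
  have sc: "summable (\<lambda>m. norm (c t m))" if "t \<in> {0..T}" for t
    by (rule summable_comparison_test'[OF a(1)]) (use bound(1)[OF that] in auto)
  have sd: "summable (\<lambda>m. norm (d t m))" if "t \<in> {0..T}" for t
    by (rule summable_comparison_test'[OF b(1)]) (use bound(2)[OF that] in auto)
  have contc: "continuous_on {0..T} (\<lambda>t. c t m)" for m
    by (rule continuous_on_vector_derivative[OF deriv])
  have b0: "0 \<le> b m" for m using order_trans[OF norm_ge_zero bound(2)[of 0 m]] T by simp
  have lip: "norm ((c r m - c t m) /\<^sub>R (r - t)) \<le> b m" if "r \<in> {0..T}" "t \<in> {0..T}" for r t m
  proof -
    have "norm (c r m - c t m) \<le> b m * norm (r - t)"
    proof (rule differentiable_bound[of "{0..T}" _ "\<lambda>t h. h *\<^sub>R d t m"])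
      fix x assume x: "x \<in> {0..T}"
      show "((\<lambda>t. c t m) has_derivative (\<lambda>h. h *\<^sub>R d x m)) (at x within {0..T})"
        using deriv[OF x] by (simp add: has_vector_derivative_def)
      show "onorm (\<lambda>h. h *\<^sub>R d x m) \<le> b m"
        by (rule onorm_bound[OF b0]) (simp add: mult.commute[of "b m"] mult_left_mono bound(2)[OF x])
    qed (use that in auto)
    moreover have "norm ((c r m - c t m) /\<^sub>R (r - t)) = norm (c r m - c t m) / \<bar>r - t\<bar>"
      by (simp add: divide_inverse mult.commute)
    ultimately show ?thesis
      using b0[of m] by (cases "r = t") (simp_all add: pos_divide_le_eq)
  qed
  show ?thesis unfolding C1_Xs_def
  proof (intro conjI ballI)
    show "C0_Xs T s (\<lambda>t. synth (c t))" by (rule C0_Xs_synth[OF T contc bound(1) a])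
    show "C0_Xs T s (\<lambda>t. synth (d t))" by (rule C0_Xs_synth[OF T contd bound(2) b])
    fix t assume t: "t \<in> {0..T}"
    have nb: "at t within {0..T} \<noteq> bot" using t T by (simp add: trivial_limit_within islimpt_Icc)
    have ev: "\<forall>\<^sub>F r in at t within {0..T}. r \<in> {0..T}" by (auto simp: eventually_at_filter)
    have "((\<lambda>r. Xs_norm s (synth (\<lambda>m. (c r m - c t m) /\<^sub>R (r - t) - d t m))) \<longlongrightarrow> 0) (at t within {0..T})"
    proof (rule Xs_norm_synth_tendsto[OF _ nb, where b = "\<lambda>m. 2 * b m"])
      show "((\<lambda>r. (c r m - c t m) /\<^sub>R (r - t) - d t m) \<longlongrightarrow> 0) (at t within {0..T})" for m
        by (rule has_vector_derivative_difference_quotient[OF deriv[OF t]])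
      show "\<forall>\<^sub>F r in at t within {0..T}. \<forall>m. norm ((c r m - c t m) /\<^sub>R (r - t) - d t m) \<le> 2 * b m"
        using ev
      proof eventually_elim
        case (elim r)
        show ?case
        proof
          fix m
          show "norm ((c r m - c t m) /\<^sub>R (r - t) - d t m) \<le> 2 * b m"
            using norm_triangle_ineq4[of "(c r m - c t m) /\<^sub>R (r - t)" "d t m"] lip[OF elim t, of m]
              bound(2)[OF t, of m] by linarith
        qed
      qed
      show "summable (\<lambda>m. 2 * b m)" using b(1) by (rule summable_mult)
      have "summable (\<lambda>m. 4 * (real m powr (2 * s) * (b m)\<^sup>2))" using b(2) by (rule summable_mult)
      then show "summable (\<lambda>m. real m powr (2 * s) * (2 * b m)\<^sup>2)" by (simp add: power_mult_distrib mult_ac)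
    qed
    moreover have "\<forall>\<^sub>F r in at t within {0..T}. Xs_norm s (synth (\<lambda>m. (c r m - c t m) /\<^sub>R (r - t) - d t m))
       = Xs_norm s (\<lambda>x. (synth (c r) x - synth (c t) x) /\<^sub>R (r - t) - synth (d t) x)"
      using ev
    proof eventually_elim
      case (elim r)
      have s1: "summable (\<lambda>m. norm (c r m - c t m))"
        by (rule summable_comparison_test'[OF summable_add[OF sc[OF elim] sc[OF t]]])
           (simp add: norm_triangle_ineq4)
      have s2: "summable (\<lambda>m. norm ((c r m - c t m) /\<^sub>R (r - t)))"
        using summable_mult[OF s1, of "inverse \<bar>r - t\<bar>"] by simp
      have "(synth (c r) x - synth (c t) x) /\<^sub>R (r - t) - synth (d t) x
          = synth (\<lambda>m. (c r m - c t m) /\<^sub>R (r - t) - d t m) x" for x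
        by (simp add: synth_diff[OF sc[OF elim] sc[OF t]] synth_scaleR[OF s1] synth_diff[OF s2 sd[OF t]])
      then show ?case by presburger
    qed
    ultimately show "((\<lambda>r. Xs_norm s (\<lambda>x. (synth (c r) x - synth (c t) x) /\<^sub>R (r - t) - synth (d t) x)) \<longlongrightarrow> 0)
        (at t within {0..T})"
      by (rule Lim_transform_eventually)
  qed
qed

section \<open>Absolutely continuous functions and the equation of a single mode\<close>

lemma H2I:
  fixes f f1 f2 :: "real \<Rightarrow> 'a::euclidean_space"
  assumes f: "\<And>t. t \<in> {0..T} \<Longrightarrow> (f has_vector_derivative f1 t) (at t within {0..T})"
    and f1: "\<And>t. t \<in> {0..T} \<Longrightarrow> (f1 has_vector_derivative f2 t) (at t within {0..T})"
    and f2: "continuous_on {0..T} f2"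
  shows "H2 T f f1 f2"
  unfolding H2_def
proof (intro conjI ballI f)
  have "continuous_on {0..T} (\<lambda>t. (norm (f2 t))\<^sup>2)" by (intro continuous_intros f2)
  then show "sq_integrable (lebesgue_on {0..T}) f2"
    using continuous_imp_integrable_real[OF f2] continuous_imp_integrable_real
    by (auto simp: sq_integrable_def)
  fix t assume t: "t \<in> {0..T}"
  have "(f2 has_integral (f1 t - f1 0)) {0..t}"
    by (rule fundamental_theorem_of_calculus)
       (use t in \<open>auto intro!: has_vector_derivative_within_subset[OF f1]\<close>)
  moreover have "(LINT r|lebesgue_on {0..t}. f2 r) = integral {0..t} f2"
    by (rule lebesgue_integral_eq_integral)
       (use t in \<open>auto intro!: continuous_imp_integrable_real continuous_on_subset[OF f2]\<close>)
  ultimately show "f1 t = f1 0 + (LINT r|lebesgue_on {0..t}. f2 r)"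
    by (simp add: integral_unique)
qed

lemma H2_deriv:
  "H2 T f f1 f2 \<Longrightarrow> t \<in> {0..T} \<Longrightarrow> (f has_vector_derivative f1 t) (at t within {0..T})"
  unfolding H2_def by blast

lemma H2_primitive:
  fixes f f1 f2 :: "real \<Rightarrow> 'a::euclidean_space"
  assumes H: "H2 T f f1 f2"
  shows "f2 integrable_on {0..T}" "\<And>t. t \<in> {0..T} \<Longrightarrow> f1 t = f1 0 + integral {0..t} f2"
proof -
  have m: "f2 \<in> borel_measurable (lebesgue_on {0..T})"
    and sq: "integrable (lebesgue_on {0..T}) (\<lambda>x. (norm (f2 x))\<^sup>2)"
    using H by (auto simp: H2_def sq_integrable_def)
  have "integrable (lebesgue_on {0..T}) (\<lambda>x. 1 + (norm (f2 x))\<^sup>2)"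
    by (intro Bochner_Integration.integrable_add sq continuous_imp_integrable_real continuous_intros)
  then have int: "integrable (lebesgue_on {0..T}) f2"
  proof (rule Bochner_Integration.integrable_bound[OF _ m])
    have "norm (f2 x) \<le> 1 + (norm (f2 x))\<^sup>2" for x
    proof -
      have "2 * norm (f2 x) \<le> 1 + (norm (f2 x))\<^sup>2"
        using sum_squares_bound[of 1 "norm (f2 x)"] by simp
      then show ?thesis using norm_ge_zero[of "f2 x"] by linarith
    qed
    then show "AE x in lebesgue_on {0..T}. norm (f2 x) \<le> norm (1 + (norm (f2 x))\<^sup>2)" by simp
  qed
  then show "f2 integrable_on {0..T}"
    by (simp add: integrable_on_lebesgue_on)
  fix t assume t: "t \<in> {0..T}"
  have "set_integrable lebesgue {0..T} f2"
    using int by (simp add: integrable_restrict_space set_integrable_def)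
  then have "set_integrable lebesgue {0..t} f2"
    by (rule set_integrable_subset) (use t in auto)
  then have "integrable (lebesgue_on {0..t}) f2"
    by (simp add: integrable_restrict_space set_integrable_def)
  then have "(LINT r|lebesgue_on {0..t}. f2 r) = integral {0..t} f2"
    by (rule lebesgue_integral_eq_integral) simp
  moreover have "f1 t = f1 0 + (LINT r|lebesgue_on {0..t}. f2 r)"
    using H t unfolding H2_def by blast
  ultimately show "f1 t = f1 0 + integral {0..t} f2" by (simp only:)
qed

lemma H2_continuous:
  assumes "H2 T f f1 f2"
  shows "continuous_on {0..T} f" "continuous_on {0..T} f1"
proof -
  show "continuous_on {0..T} f"
    by (rule continuous_on_vector_derivative[OF H2_deriv[OF assms]])
  have "continuous_on {0..T} (\<lambda>t. f1 0 + integral {0..t} f2)"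
    by (intro continuous_intros indefinite_integral_continuous_1 H2_primitive(1)[OF assms])
  then show "continuous_on {0..T} f1"
    by (rule continuous_on_eq) (rule H2_primitive(2)[OF assms, symmetric])
qed

text \<open>If the second derivative has a continuous representative, the almost everywhere equations of the solution
concept hold classically.\<close>

lemma H2_classical:
  assumes H: "H2 T f f1 f2" and c: "continuous_on {0..T} f2" and t: "t \<in> {0..T}"
  shows "(f1 has_vector_derivative f2 t) (at t within {0..T})"
proof -
  have "((\<lambda>t. f1 0 + integral {0..t} f2) has_vector_derivative 0 + f2 t) (at t within {0..T})"
    by (intro has_vector_derivative_add has_vector_derivative_const integral_has_vector_derivative[OF c t])
  then show ?thesis
    by (intro has_vector_derivative_transform[OF t _ \<open>(_ has_vector_derivative 0 + f2 t) _\<close>[simplified]])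
       (rule H2_primitive(2)[OF H])
qed

lemma has_vector_derivative_exp_of_real:
  "((\<lambda>t. exp (lam * complex_of_real t)) has_vector_derivative lam * exp (lam * of_real t)) (at t within X)"
proof -
  have "((\<lambda>z. exp (lam * z)) has_field_derivative lam * exp (lam * of_real t)) (at (of_real t) within of_real ` X)"
    by (auto intro!: derivative_eq_intros)
  then have "(((\<lambda>z. exp (lam * z)) \<circ> complex_of_real) has_vector_derivative 1 * (lam * exp (lam * of_real t))) (at t within X)"
    by (intro field_vector_diff_chain_within) (auto intro!: derivative_eq_intros)
  then show ?thesis by (simp add: o_def)
qed

lemma first_order_ode:
  fixes lam y0 :: complex and g :: "real \<Rightarrow> complex"
  assumes g: "continuous_on {0..T} g" "\<And>t. t \<in> {0..T} \<Longrightarrow> norm (g t) \<le> Gam"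
    and lam: "0 < Re lam"
  obtains y where "y 0 = y0"
    and "\<And>t. t \<in> {0..T} \<Longrightarrow> (y has_vector_derivative g t - lam * y t) (at t within {0..T})"
    and "\<And>t. t \<in> {0..T} \<Longrightarrow> norm (y t) \<le> norm y0 + Gam / Re lam"
proof -
  define h where "h s = exp (lam * of_real s) * g s" for s
  have ch: "continuous_on {0..T} h" unfolding h_def[abs_def] by (intro continuous_intros g(1))
  define y where "y t = exp (- lam * of_real t) * (y0 + integral {0..t} h)" for t
  show ?thesis
  proof (rule that[of y])
    show "y 0 = y0" by (simp add: y_def)
    fix t assume t: "t \<in> {0..T}"
    have "(y has_vector_derivative (exp (- lam * of_real t) * (0 + h t)
       + (- lam * exp (- lam * of_real t)) * (y0 + integral {0..t} h))) (at t within {0..T})"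
      unfolding y_def[abs_def]
      by (intro has_vector_derivative_mult has_vector_derivative_exp_of_real has_vector_derivative_add
          has_vector_derivative_const integral_has_vector_derivative[OF ch t])
    moreover have "exp (- lam * of_real t) * h t = g t"
      by (simp add: h_def mult.assoc[symmetric] flip: exp_add)
    ultimately show "(y has_vector_derivative g t - lam * y t) (at t within {0..T})"
      by (simp add: y_def mult.assoc)
    define a where "a = Re lam"
    have a: "0 < a" using lam by (simp add: a_def)
    have Gam: "0 \<le> Gam" using order_trans[OF norm_ge_zero g(2)[OF t]] .
    have I: "((\<lambda>s. Gam * exp (a * s)) has_integral Gam * exp (a * t) / a - Gam * exp (a * 0) / a) {0..t}"
      by (rule fundamental_theorem_of_calculus)
         (use t a in \<open>auto intro!: derivative_eq_intros simp flip: has_real_derivative_iff_has_vector_derivative\<close>)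
    have "norm (integral {0..t} h) \<le> integral {0..t} (\<lambda>s. Gam * exp (a * s))"
    proof (rule integral_norm_bound_integral)
      show "h integrable_on {0..t}"
        by (intro integrable_continuous_real continuous_on_subset[OF ch]) (use t in auto)
      show "(\<lambda>s. Gam * exp (a * s)) integrable_on {0..t}" using I by blast
      fix s assume "s \<in> {0..t}"
      then have "norm (g s) \<le> Gam" using g(2) t by auto
      then show "norm (h s) \<le> Gam * exp (a * s)"
        by (simp add: h_def norm_mult a_def mult.commute mult_right_mono)
    qed
    also have "\<dots> \<le> Gam * exp (a * t) / a"
      unfolding integral_unique[OF I] using Gam a by simp
    finally have "norm (y0 + integral {0..t} h) \<le> norm y0 + Gam * exp (a * t) / a"
      using norm_triangle_ineq[of y0 "integral {0..t} h"] by linarith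
    then have "norm (y t) \<le> exp (- (a * t)) * (norm y0 + Gam * exp (a * t) / a)"
      by (simp add: y_def norm_mult a_def)
    also have "\<dots> = exp (- (a * t)) * norm y0 + Gam / a"
      by (simp add: distrib_left exp_minus)
    also have "\<dots> \<le> 1 * norm y0 + Gam / a"
      using a t by (intro add_right_mono mult_right_mono) auto
    finally show "norm (y t) \<le> norm y0 + Gam / Re lam" by (simp add: a_def)
  qed
qed

text \<open>The operator factors into $(\partial_t + \lambda')(\partial_t + \lambda)$ with
$\lambda, \lambda' = m^2 \pm i\omega$. Solving two first-order equations in turn gains a factor $m^{-2}$
each time, also for $\omega = 0$ when the two exponents coincide.\<close>

lemma second_order_ode:
  fixes m :: nat and om Gam :: real and y0 y1 :: complex and g :: "real \<Rightarrow> complex"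
  defines "K \<equiv> (1 + om) * (3 + om)"
  defines "Y \<equiv> norm y0 + norm y1 / (real m)\<^sup>2 + Gam / real m ^ 4"
  assumes m: "1 \<le> m" and om: "0 \<le> om" and T: "0 \<le> T"
    and g: "continuous_on {0..T} g" "\<And>t. t \<in> {0..T} \<Longrightarrow> norm (g t) \<le> Gam"
  obtains y z where "y 0 = y0" "z 0 = y1"
    and "\<And>t. t \<in> {0..T} \<Longrightarrow> (y has_vector_derivative z t) (at t within {0..T})"
    and "\<And>t. t \<in> {0..T} \<Longrightarrow> (z has_vector_derivative
          g t - (2 * (real m)\<^sup>2) *\<^sub>R z t - (real m ^ 4 + om\<^sup>2) *\<^sub>R y t) (at t within {0..T})"
    and "\<And>t. t \<in> {0..T} \<Longrightarrow> norm (y t) \<le> K * Y"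
    and "\<And>t. t \<in> {0..T} \<Longrightarrow> norm (z t) \<le> K * ((real m)\<^sup>2 * Y)"
proof -
  define M where "M = (real m)\<^sup>2"
  have M: "1 \<le> M" using m by (simp add: M_def)
  have M2: "real m ^ 4 = M\<^sup>2" by (simp add: M_def flip: power_mult)
  have Y: "Y = norm y0 + norm y1 / M + Gam / M\<^sup>2" by (simp add: Y_def M_def flip: power_mult)
  define lam where "lam = Complex M om"
  define lam' where "lam' = Complex M (- om)"
  have ll: "lam + lam' = of_real (2 * M)" "lam' * lam = of_real (M\<^sup>2 + om\<^sup>2)"
    by (simp_all add: lam_def lam'_def complex_eq_iff power2_eq_square)
  have nl: "norm lam \<le> (1 + om) * M"
  proof -
    have "norm lam \<le> \<bar>M\<bar> + \<bar>om\<bar>" using cmod_le[of lam] by (simp add: lam_def)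
    also have "\<dots> \<le> M + om * M" using M om mult_left_mono[of 1 M om] by simp
    finally show ?thesis by (simp add: distrib_right)
  qed
  have Gam: "0 \<le> Gam" using order_trans[OF norm_ge_zero g(2)[of 0]] T by simp
  have Y0: "0 \<le> Y" using Gam M by (simp add: Y)
  obtain q where q: "q 0 = y1 + lam * y0"
    "\<And>t. t \<in> {0..T} \<Longrightarrow> (q has_vector_derivative g t - lam' * q t) (at t within {0..T})"
    and qb: "\<And>t. t \<in> {0..T} \<Longrightarrow> norm (q t) \<le> norm (y1 + lam * y0) + Gam / Re lam'"
    by (rule first_order_ode[OF g, of lam' "y1 + lam * y0"]) (use M in \<open>auto simp: lam'_def\<close>)
  have qb': "norm (q t) \<le> (1 + om) * (M * Y)" if t: "t \<in> {0..T}" for t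
  proof -
    have "norm (q t) \<le> norm (y1 + lam * y0) + Gam / M" using qb[OF t] by (simp add: lam'_def)
    also have "\<dots> \<le> norm y1 + (1 + om) * M * norm y0 + Gam / M"
      using norm_triangle_ineq[of y1 "lam * y0"] mult_right_mono[OF nl norm_ge_zero[of y0]]
      by (simp add: norm_mult)
    also have "\<dots> \<le> (1 + om) * norm y1 + (1 + om) * M * norm y0 + (1 + om) * (Gam / M)"
    proof -
      have "1 * norm y1 \<le> (1 + om) * norm y1" "1 * (Gam / M) \<le> (1 + om) * (Gam / M)"
        using om Gam M by (intro mult_right_mono; simp)+
      then show ?thesis by linarith
    qed
    also have "\<dots> = (1 + om) * (M * Y)"
      using M by (simp add: Y distrib_left power2_eq_square)
    finally show ?thesis .
  qed
  have cq: "continuous_on {0..T} q" by (rule continuous_on_vector_derivative[OF q(2)])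
  obtain y where y: "y 0 = y0"
    "\<And>t. t \<in> {0..T} \<Longrightarrow> (y has_vector_derivative q t - lam * y t) (at t within {0..T})"
    and yb: "\<And>t. t \<in> {0..T} \<Longrightarrow> norm (y t) \<le> norm y0 + ((1 + om) * (M * Y)) / Re lam"
    by (rule first_order_ode[OF cq qb', of lam y0]) (use M in \<open>auto simp: lam_def\<close>)
  have yb': "norm (y t) \<le> (2 + om) * Y" if t: "t \<in> {0..T}" for t
  proof -
    have "norm y0 \<le> Y" using Gam M by (simp add: Y)
    moreover have "(1 + om) * (M * Y) / M = (1 + om) * Y" using M by simp
    moreover have "(2 + om) * Y = Y + (1 + om) * Y" by (simp add: algebra_simps)
    ultimately show ?thesis using yb[OF t] by (simp add: lam_def)
  qed
  define z where "z t = q t - lam * y t" for t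
  show ?thesis
  proof (rule that[of y z])
    show "y 0 = y0" by (rule y(1))
    show "z 0 = y1" by (simp add: z_def q(1) y(1))
    fix t assume t: "t \<in> {0..T}"
    show "(y has_vector_derivative z t) (at t within {0..T})" unfolding z_def by (rule y(2)[OF t])
    have "(z has_vector_derivative (g t - lam' * q t) - lam * (q t - lam * y t)) (at t within {0..T})"
      unfolding z_def[abs_def]
      by (intro has_vector_derivative_diff has_vector_derivative_mult_right q(2) y(2) t)
    moreover have "(g t - lam' * q t) - lam * (q t - lam * y t)
        = g t - (lam + lam') * z t - (lam' * lam) * y t"
      by (simp add: z_def algebra_simps)
    ultimately show "(z has_vector_derivative
          g t - (2 * (real m)\<^sup>2) *\<^sub>R z t - (real m ^ 4 + om\<^sup>2) *\<^sub>R y t) (at t within {0..T})"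
      unfolding ll by (simp add: M2 M_def[symmetric] scaleR_conv_of_real)
    have "(2 + om) * Y \<le> K * Y"
      using Y0 om by (intro mult_right_mono) (auto simp: K_def algebra_simps)
    then show "norm (y t) \<le> K * Y" using yb'[OF t] by linarith
    have "norm (z t) \<le> norm (q t) + norm lam * norm (y t)"
      unfolding z_def using norm_triangle_ineq4[of "q t" "lam * y t"] by (simp add: norm_mult)
    also have "\<dots> \<le> (1 + om) * (M * Y) + ((1 + om) * M) * ((2 + om) * Y)"
      using qb'[OF t] nl yb'[OF t] om M by (intro add_mono mult_mono) auto
    also have "\<dots> = K * (M * Y)" by (simp add: K_def algebra_simps)
    finally show "norm (z t) \<le> K * ((real m)\<^sup>2 * Y)" by (simp add: M_def)
  qed
qed

lemma matrix_axis_bounded_linear: "bounded_linear (\<lambda>c::complex. (E :: complex^'n^'m) *v axis i c)"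
proof -
  have "linear (\<lambda>c::complex. E *v axis i c)"
    by (rule linearI)
       (simp_all add: vec_eq_iff matrix_vector_mult_def axis_def scaleR_sum_right sum.distrib
          if_distrib[of "\<lambda>x. _ * x"] distrib_left flip: sum.distrib cong: if_cong)
  then show ?thesis by (simp add: linear_conv_bounded_linear)
qed

lemma sum_axis_components: "(\<Sum>i\<in>UNIV. axis i (x $ i)) = (x :: complex^'n)"
  by (simp add: vec_eq_iff axis_def)

text \<open>Each spectral component of the vector equation at level \<open>m\<close> is a scalar equation with
$\omega^2 = \mu$. The constant \<open>K\<close> is uniform in \<open>m\<close>, and the bound is sharp enough to keep three powers of
\<open>m\<close> on the displacement and one on the velocity.\<close>

lemma level_ode:
  fixes A :: "complex^'n^'n" and S :: "real set" and E :: "real \<Rightarrow> complex^'n^'n"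
  assumes T: "0 \<le> T" and S: "finite S" "\<And>mu. mu \<in> S \<Longrightarrow> 0 \<le> mu"
    and E: "\<And>v. (\<Sum>mu\<in>S. E mu *v v) = v" "\<And>mu v. A *v (E mu *v v) = mu *\<^sub>R (E mu *v v)"
  obtains K where "0 \<le> K"
    and "\<And>m a b g Gam. 1 \<le> m \<Longrightarrow> continuous_on {0..T} g \<Longrightarrow> (\<And>t. t \<in> {0..T} \<Longrightarrow> norm (g t) \<le> Gam)
      \<Longrightarrow> \<exists>v w. v 0 = a \<and> w 0 = b \<and>
        (\<forall>t\<in>{0..T}. (v has_vector_derivative w t) (at t within {0..T}) \<and>
          (w has_vector_derivative g t - (2 * (real m)\<^sup>2) *\<^sub>R w t - (real m ^ 4) *\<^sub>R v t - A *v v t) (at t within {0..T}) \<and>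
          norm (v t) \<le> K * (norm a + norm b / (real m)\<^sup>2 + Gam / real m ^ 4) \<and>
          norm (w t) \<le> K * ((real m)\<^sup>2 * (norm a + norm b / (real m)\<^sup>2 + Gam / real m ^ 4)))"
proof -
  define L where "L mu i c = E mu *v axis i c" for mu i and c :: complex
  have bl: "bounded_linear (L mu i)" for mu i
    unfolding L_def[abs_def] by (rule matrix_axis_bounded_linear)
  define BL where "BL mu i = onorm (L mu i)" for mu i
  have BL: "norm (L mu i c) \<le> BL mu i * norm c" "0 \<le> BL mu i" for mu i c
    unfolding BL_def using onorm[OF bl] onorm_pos_le[OF bl] by auto
  define Ka where "Ka mu = (1 + sqrt mu) * (3 + sqrt mu)" for mu
  have Ka: "0 \<le> Ka mu" if "mu \<in> S" for mu using S(2)[OF that] by (simp add: Ka_def)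
  define K where "K = (\<Sum>mu\<in>S. \<Sum>i\<in>UNIV. BL mu i * Ka mu)"
  have K0: "0 \<le> K" unfolding K_def by (intro sum_nonneg mult_nonneg_nonneg BL Ka)
  have Lsum: "(\<Sum>mu\<in>S. \<Sum>i\<in>UNIV. L mu i (x $ i)) = x" for x
  proof -
    have "(\<Sum>i\<in>UNIV. L mu i (x $ i)) = E mu *v x" for mu
    proof -
      have "E mu *v x = E mu *v (\<Sum>i\<in>UNIV. axis i (x $ i))" by (simp only: sum_axis_components)
      also have "\<dots> = (\<Sum>i\<in>UNIV. L mu i (x $ i))"
        unfolding L_def by (rule vec.linear_sum[OF matrix_vector_mul_linear_gen])
      finally show ?thesis ..
    qed
    then show ?thesis by (simp add: E(1))
  qed
  have AL: "A *v L mu i c = mu *\<^sub>R L mu i c" for mu i c by (simp add: L_def E(2))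
  show ?thesis
  proof (rule that[OF K0])
    fix m :: nat and a b :: "complex^'n" and g :: "real \<Rightarrow> complex^'n" and Gam :: real
    assume m: "1 \<le> m" and g: "continuous_on {0..T} g" "\<And>t. t \<in> {0..T} \<Longrightarrow> norm (g t) \<le> Gam"
    define Y where "Y = norm a + norm b / (real m)\<^sup>2 + Gam / real m ^ 4"
    define Pr where "Pr mu i y z \<longleftrightarrow> y 0 = a $ i \<and> z 0 = b $ i \<and>
        (\<forall>t\<in>{0..T}. (y has_vector_derivative z t) (at t within {0..T}) \<and>
         (z has_vector_derivative g t $ i - (2 * (real m)\<^sup>2) *\<^sub>R z t - (real m ^ 4 + mu) *\<^sub>R y t) (at t within {0..T}) \<and>
         norm (y t) \<le> Ka mu * Y \<and> norm (z t) \<le> Ka mu * ((real m)\<^sup>2 * Y))"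
      for mu i and y z :: "real \<Rightarrow> complex"
    have ex: "\<exists>y z. Pr mu i y z"
      if mu: "mu \<in> S" for mu i
    proof -
      have gi: "continuous_on {0..T} (\<lambda>t. g t $ i)" by (intro continuous_intros g(1))
      have gb: "norm (g t $ i) \<le> Gam" if "t \<in> {0..T}" for t
        using Finite_Cartesian_Product.norm_nth_le[of "g t" i] g(2)[OF that] by linarith
      have s: "0 \<le> sqrt mu" "(sqrt mu)\<^sup>2 = mu" using S(2)[OF mu] by simp_all
      define Y' where "Y' = norm (a $ i) + norm (b $ i) / (real m)\<^sup>2 + Gam / real m ^ 4"
      have YY: "Y' \<le> Y" unfolding Y_def Y'_def
        by (intro add_mono divide_right_mono Finite_Cartesian_Product.norm_nth_le) auto
      obtain y z where yz: "y 0 = a $ i" "z 0 = b $ i"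
        "\<And>t. t \<in> {0..T} \<Longrightarrow> (y has_vector_derivative z t) (at t within {0..T})"
        "\<And>t. t \<in> {0..T} \<Longrightarrow> (z has_vector_derivative
          g t $ i - (2 * (real m)\<^sup>2) *\<^sub>R z t - (real m ^ 4 + mu) *\<^sub>R y t) (at t within {0..T})"
        "\<And>t. t \<in> {0..T} \<Longrightarrow> norm (y t) \<le> Ka mu * Y'"
        "\<And>t. t \<in> {0..T} \<Longrightarrow> norm (z t) \<le> Ka mu * ((real m)\<^sup>2 * Y')"
        using second_order_ode[OF m s(1) T gi gb, of "a $ i" "b $ i"]
        unfolding s(2) Ka_def Y'_def by metis
      have "Ka mu * Y' \<le> Ka mu * Y" "Ka mu * ((real m)\<^sup>2 * Y') \<le> Ka mu * ((real m)\<^sup>2 * Y)"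
        using YY Ka[OF mu] by (intro mult_left_mono; simp)+
      then have "norm (y t) \<le> Ka mu * Y \<and> norm (z t) \<le> Ka mu * ((real m)\<^sup>2 * Y)" if "t \<in> {0..T}" for t
        using yz(5,6)[OF that] by linarith
      then show ?thesis using yz(1-4) unfolding Pr_def by - (rule exI[of _ y], rule exI[of _ z], blast)
    qed
    obtain y z where yz': "\<And>mu i. mu \<in> S \<Longrightarrow> Pr mu i (y mu i) (z mu i)"
      using ex by metis
    have yz:
      "\<And>mu i. mu \<in> S \<Longrightarrow> y mu i 0 = a $ i" "\<And>mu i. mu \<in> S \<Longrightarrow> z mu i 0 = b $ i"
      "\<And>mu i t. mu \<in> S \<Longrightarrow> t \<in> {0..T} \<Longrightarrow> (y mu i has_vector_derivative z mu i t) (at t within {0..T})"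
      "\<And>mu i t. mu \<in> S \<Longrightarrow> t \<in> {0..T} \<Longrightarrow> (z mu i has_vector_derivative
          g t $ i - (2 * (real m)\<^sup>2) *\<^sub>R z mu i t - (real m ^ 4 + mu) *\<^sub>R y mu i t) (at t within {0..T})"
      "\<And>mu i t. mu \<in> S \<Longrightarrow> t \<in> {0..T} \<Longrightarrow> norm (y mu i t) \<le> Ka mu * Y"
      "\<And>mu i t. mu \<in> S \<Longrightarrow> t \<in> {0..T} \<Longrightarrow> norm (z mu i t) \<le> Ka mu * ((real m)\<^sup>2 * Y)"
      using yz' unfolding Pr_def by blast+
    define v where "v t = (\<Sum>mu\<in>S. \<Sum>i\<in>UNIV. L mu i (y mu i t))" for t
    define w where "w t = (\<Sum>mu\<in>S. \<Sum>i\<in>UNIV. L mu i (z mu i t))" for t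
    have bound: "norm (\<Sum>mu\<in>S. \<Sum>i\<in>UNIV. L mu i (x mu i)) \<le> K * R"
      if "\<And>mu i. mu \<in> S \<Longrightarrow> norm (x mu i) \<le> Ka mu * R" for x R
    proof -
      have "norm (\<Sum>mu\<in>S. \<Sum>i\<in>UNIV. L mu i (x mu i)) \<le> (\<Sum>mu\<in>S. \<Sum>i\<in>UNIV. BL mu i * (Ka mu * R))"
        by (intro sum_norm_le order_trans[OF BL(1)] mult_left_mono BL(2) that)
      also have "\<dots> = K * R" by (simp add: K_def sum_distrib_right mult.assoc)
      finally show ?thesis .
    qed
    show "\<exists>v w. v 0 = a \<and> w 0 = b \<and>
        (\<forall>t\<in>{0..T}. (v has_vector_derivative w t) (at t within {0..T}) \<and>
          (w has_vector_derivative g t - (2 * (real m)\<^sup>2) *\<^sub>R w t - (real m ^ 4) *\<^sub>R v t - A *v v t) (at t within {0..T}) \<and>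
          norm (v t) \<le> K * (norm a + norm b / (real m)\<^sup>2 + Gam / real m ^ 4) \<and>
          norm (w t) \<le> K * ((real m)\<^sup>2 * (norm a + norm b / (real m)\<^sup>2 + Gam / real m ^ 4)))"
    proof (rule exI[of _ v], rule exI[of _ w], intro conjI ballI)
      show "v 0 = a" using Lsum[of a] by (simp add: v_def yz(1) cong: sum.cong)
      show "w 0 = b" using Lsum[of b] by (simp add: w_def yz(2) cong: sum.cong)
      fix t assume t: "t \<in> {0..T}"
      show "(v has_vector_derivative w t) (at t within {0..T})"
        unfolding v_def[abs_def] w_def
        by (intro has_vector_derivative_sum bounded_linear.has_vector_derivative[OF bl] yz(3) t)
      have "(w has_vector_derivative (\<Sum>mu\<in>S. \<Sum>i\<in>UNIV. L mu i
          (g t $ i - (2 * (real m)\<^sup>2) *\<^sub>R z mu i t - (real m ^ 4 + mu) *\<^sub>R y mu i t))) (at t within {0..T})"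
        unfolding w_def[abs_def]
        by (intro has_vector_derivative_sum bounded_linear.has_vector_derivative[OF bl] yz(4) t)
      moreover have "(\<Sum>mu\<in>S. \<Sum>i\<in>UNIV. L mu i
          (g t $ i - (2 * (real m)\<^sup>2) *\<^sub>R z mu i t - (real m ^ 4 + mu) *\<^sub>R y mu i t))
        = g t - (2 * (real m)\<^sup>2) *\<^sub>R w t - (real m ^ 4) *\<^sub>R v t - A *v v t"
      proof -
        have Av: "A *v v t = (\<Sum>mu\<in>S. \<Sum>i\<in>UNIV. mu *\<^sub>R L mu i (y mu i t))"
          unfolding v_def
          by (simp add: vec.linear_sum[OF matrix_vector_mul_linear_gen] AL)
        have "L mu i (g t $ i - (2 * (real m)\<^sup>2) *\<^sub>R z mu i t - (real m ^ 4 + mu) *\<^sub>R y mu i t)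
          = L mu i (g t $ i) - (2 * (real m)\<^sup>2) *\<^sub>R L mu i (z mu i t) - (real m ^ 4) *\<^sub>R L mu i (y mu i t)
            - mu *\<^sub>R L mu i (y mu i t)" for mu i
          using bl[of mu i] by (simp add: linear_simps scaleR_add_left diff_diff_eq)
        then show ?thesis
          unfolding Av by (simp add: sum_subtractf Lsum v_def w_def scaleR_sum_right)
      qed
      ultimately show "(w has_vector_derivative g t - (2 * (real m)\<^sup>2) *\<^sub>R w t - (real m ^ 4) *\<^sub>R v t - A *v v t) (at t within {0..T})"
        by simp
      show "norm (v t) \<le> K * (norm a + norm b / (real m)\<^sup>2 + Gam / real m ^ 4)"
        unfolding v_def Y_def[symmetric] by (rule bound) (rule yz(5)[OF _ t])
      show "norm (w t) \<le> K * ((real m)\<^sup>2 * (norm a + norm b / (real m)\<^sup>2 + Gam / real m ^ 4))"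
        unfolding w_def Y_def[symmetric] by (rule bound) (rule yz(6)[OF _ t])
    qed
  qed
qed

section \<open>Steering a scalar mode to rest\<close>

text \<open>If the derivative of \<open>P\<close> is $(c_0 + c_1 t) e^{\lambda t} F(t)$, its increment is a combination of moments
of \<open>F\<close>.\<close>

lemma has_vector_derivative_imp_moment:
  fixes P F :: "real \<Rightarrow> complex"
  assumes T: "0 \<le> T"
    and P: "\<And>t. t \<in> {0..T} \<Longrightarrow> (P has_vector_derivative
        c0 * (exp (lam * of_real t) * F t) + c1 * (of_real t * exp (lam * of_real t) * F t)) (at t within {0..T})"
    and F: "continuous_on {0..T} F"
  shows "P T - P 0 = c0 * moment T 0 lam F + c1 * moment T 1 lam F"
proof -
  have "((\<lambda>t. c0 * (exp (lam * of_real t) * F t) + c1 * (of_real t * exp (lam * of_real t) * F t)) has_integral (P T - P 0)) {0..T}"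
    by (rule fundamental_theorem_of_calculus[OF T P])
  moreover have "((\<lambda>t. c0 * (of_real t ^ 0 * exp (lam * of_real t) * F t) + c1 * (of_real t ^ 1 * exp (lam * of_real t) * F t))
     has_integral (c0 * moment T 0 lam F + c1 * moment T 1 lam F)) {0..T}"
    unfolding moment_def
    by (intro has_integral_add has_integral_mult_right integrable_integral moment_integrable F)
  ultimately show ?thesis by (simp add: has_integral_unique)
qed

lemma freq_cnj: "freq m th + cnj (freq m th) = of_real (2 * (real m)\<^sup>2)"
  "freq m th * cnj (freq m th) = of_real (real m ^ 4 + th\<^sup>2)"
  by (simp_all add: complex_eq_iff power2_eq_square eval_nat_numeral)

text \<open>The equation of one component \<open>u = v + x F\<close> of the full displacement, where \<open>v\<close> belongs to the part with
homogeneous boundary conditions and \<open>F\<close> is a component of \<open>B f\<close>. In the equation for \<open>u\<close> the source contains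
\<open>F\<close> and \<open>F'\<close>, while \<open>F''\<close> has cancelled.\<close>

locale controlled_mode =
  fixes T th x :: real and m :: nat and u z F F1 :: "real \<Rightarrow> complex"
  assumes T: "0 < T"
    and u: "\<And>t. t \<in> {0..T} \<Longrightarrow> (u has_vector_derivative z t) (at t within {0..T})"
    and z: "\<And>t. t \<in> {0..T} \<Longrightarrow> (z has_vector_derivative
        of_real x * (of_real (2 * (real m)\<^sup>2) * F1 t + of_real (real m ^ 4) * F t)
          - of_real (2 * (real m)\<^sup>2) * z t - of_real (real m ^ 4 + th\<^sup>2) * u t) (at t within {0..T})"
    and F: "\<And>t. t \<in> {0..T} \<Longrightarrow> (F has_vector_derivative F1 t) (at t within {0..T})"
    and F0: "F 0 = 0" "F T = 0"
begin

lemma F_continuous: "continuous_on {0..T} F"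
  by (rule continuous_on_vector_derivative[OF F])

text \<open>Multiplying \<open>z + \<lambda>' u\<close> by $e^{\lambda t}$ removes the homogeneous part of the equation, because
$\lambda + \lambda' = 2m^2$ and $\lambda\lambda' = m^4 + \theta^2$. The correction by $2 m^2 x F$ integrates
the term with \<open>F'\<close> by parts and vanishes at both ends.\<close>

lemma first_identity:
  assumes th': "th'\<^sup>2 = th\<^sup>2"
  defines "lam \<equiv> freq m th'"
  shows "exp (lam * of_real T) * (z T + cnj lam * u T)
    = z 0 + cnj lam * u 0 + of_real x * (of_real (real m ^ 4) - of_real (2 * (real m)\<^sup>2) * lam) * moment T 0 lam F"
proof -
  define M where "M = complex_of_real (2 * (real m)\<^sup>2)"
  define N where "N = complex_of_real (real m ^ 4)"
  define mu where "mu = complex_of_real (th\<^sup>2)"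
  have l: "cnj lam = M - lam" "lam * (M - lam) = N + mu"
  proof -
    show 1: "cnj lam = M - lam" unfolding M_def lam_def freq_cnj(1)[of m th', symmetric] by simp
    show "lam * (M - lam) = N + mu"
      unfolding 1[symmetric] unfolding lam_def freq_cnj(2) th' N_def mu_def by simp
  qed
  define P where "P t = exp (lam * of_real t) * (z t + (M - lam) * u t - of_real x * M * F t)" for t
  have "P T - P 0 = (of_real x * (N - M * lam)) * moment T 0 lam F + 0 * moment T 1 lam F"
  proof (rule has_vector_derivative_imp_moment[OF _ _ F_continuous])
    fix t assume t: "t \<in> {0..T}"
    have "(P has_vector_derivative (exp (lam * of_real t) *
        ((of_real x * (M * F1 t + N * F t) - M * z t - (N + mu) * u t) + (M - lam) * z t - of_real x * M * F1 t)
        + (lam * exp (lam * of_real t)) * (z t + (M - lam) * u t - of_real x * M * F t))) (at t within {0..T})"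
      unfolding P_def[abs_def]
      using z[OF t] u[OF t] F[OF t]
      by (intro has_vector_derivative_mult has_vector_derivative_exp_of_real has_vector_derivative_diff
          has_vector_derivative_add has_vector_derivative_mult_right)
         (simp_all add: M_def N_def mu_def)
    moreover have "exp (lam * of_real t) *
        ((of_real x * (M * F1 t + N * F t) - M * z t - (N + mu) * u t) + (M - lam) * z t - of_real x * M * F1 t)
        + (lam * exp (lam * of_real t)) * (z t + (M - lam) * u t - of_real x * M * F t)
      = of_real x * (N - M * lam) * (exp (lam * of_real t) * F t) + 0 * (of_real t * exp (lam * of_real t) * F t)"
      using l(2) by algebra
    ultimately show "(P has_vector_derivative of_real x * (N - M * lam) * (exp (lam * of_real t) * F t)
        + 0 * (of_real t * exp (lam * of_real t) * F t)) (at t within {0..T})" by simp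
  qed (use T in simp)
  then show ?thesis unfolding M_def[symmetric] N_def[symmetric]
    by (simp add: P_def F0 l(1) algebra_simps)
qed

text \<open>For the double exponent the second adjoint solution is $t e^{\lambda t}$. This yields a second, independent
linear combination of the terminal values.\<close>

lemma second_identity:
  assumes th: "th = 0"
  defines "lam \<equiv> freq m 0"
  shows "exp (lam * of_real T) * (u T - of_real T * (z T + lam * u T))
    = u 0 + of_real x * (of_real (2 * (real m)\<^sup>2) * moment T 0 lam F + of_real (real m ^ 4) * moment T 1 lam F)"
proof -
  have l: "complex_of_real (2 * (real m)\<^sup>2) = 2 * lam" "complex_of_real (real m ^ 4) = lam * lam"
    by (simp_all add: lam_def complex_eq_iff power2_eq_square eval_nat_numeral)
  define P where "P t = exp (lam * of_real t) * (u t - of_real t * (z t + lam * u t - of_real x * (2 * lam) * F t))" for t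
  have "P T - P 0 = (of_real x * (2 * lam)) * moment T 0 lam F + (of_real x * (lam * lam)) * moment T 1 lam F"
  proof (rule has_vector_derivative_imp_moment[OF _ _ F_continuous])
    fix t assume t: "t \<in> {0..T}"
    have z': "(z has_vector_derivative of_real x * (2 * lam * F1 t + lam * lam * F t) - 2 * lam * z t - lam * lam * u t)
       (at t within {0..T})"
      using z[OF t] unfolding th l by (simp add: l del: of_real_mult of_real_power)
    have "(complex_of_real has_vector_derivative 1) (at t within {0..T})"
      by (auto intro!: derivative_eq_intros)
    then have "(P has_vector_derivative (exp (lam * of_real t) *
        (z t - (of_real t * ((of_real x * (2 * lam * F1 t + lam * lam * F t) - 2 * lam * z t - lam * lam * u t)
            + lam * z t - of_real x * (2 * lam) * F1 t)
          + 1 * (z t + lam * u t - of_real x * (2 * lam) * F t)))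
        + (lam * exp (lam * of_real t)) * (u t - of_real t * (z t + lam * u t - of_real x * (2 * lam) * F t)))) (at t within {0..T})"
      unfolding P_def[abs_def]
      by (intro has_vector_derivative_mult has_vector_derivative_exp_of_real has_vector_derivative_diff
          has_vector_derivative_add has_vector_derivative_mult_right z' u[OF t] F[OF t])
    moreover have "exp (lam * of_real t) *
        (z t - (of_real t * ((of_real x * (2 * lam * F1 t + lam * lam * F t) - 2 * lam * z t - lam * lam * u t)
            + lam * z t - of_real x * (2 * lam) * F1 t)
          + 1 * (z t + lam * u t - of_real x * (2 * lam) * F t)))
        + (lam * exp (lam * of_real t)) * (u t - of_real t * (z t + lam * u t - of_real x * (2 * lam) * F t))
      = of_real x * (2 * lam) * (exp (lam * of_real t) * F t) + of_real x * (lam * lam) * (of_real t * exp (lam * of_real t) * F t)"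
      by algebra
    ultimately show "(P has_vector_derivative of_real x * (2 * lam) * (exp (lam * of_real t) * F t)
        + of_real x * (lam * lam) * (of_real t * exp (lam * of_real t) * F t)) (at t within {0..T})" by simp
  qed (use T in simp)
  then show ?thesis unfolding l
    by (simp add: P_def F0 algebra_simps)
qed

text \<open>When \<open>th\<close> is not \<open>0\<close>, the identities for \<open>th\<close> and \<open>- th\<close> are two independent linear equations for the
terminal values; when \<open>th = 0\<close> they coincide, and the second identity supplies the missing one.\<close>

lemma steered_to_zero:
  assumes first: "\<And>th'. th'\<^sup>2 = th\<^sup>2 \<Longrightarrow> z 0 + cnj (freq m th') * u 0
      + of_real x * (of_real (real m ^ 4) - of_real (2 * (real m)\<^sup>2) * freq m th') * moment T 0 (freq m th') F = 0"
    and second: "th = 0 \<Longrightarrow> u 0 + of_real x * (of_real (2 * (real m)\<^sup>2) * moment T 0 (freq m 0) F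
      + of_real (real m ^ 4) * moment T 1 (freq m 0) F) = 0"
  shows "u T = 0" "z T = 0"
proof -
  have e: "z T + cnj (freq m th') * u T = 0" if "th'\<^sup>2 = th\<^sup>2" for th'
    using first_identity[OF that] first[OF that] by simp
  have e1: "z T + cnj (freq m th) * u T = 0" by (rule e) simp
  have e2: "z T + cnj (freq m (- th)) * u T = 0" by (rule e) simp
  have "u T = 0"
  proof (cases "th = 0")
    case True
    have "u T - of_real T * (z T + freq m 0 * u T) = 0"
      using second_identity[OF True] second[OF True] by simp
    moreover have "cnj (freq m 0) = freq m 0" by (simp add: complex_eq_iff)
    ultimately show ?thesis using e1 True by simp
  next
    case False
    have "(cnj (freq m th) - cnj (freq m (- th))) * u T
        = (z T + cnj (freq m th) * u T) - (z T + cnj (freq m (- th)) * u T)"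
      by (simp only: left_diff_distrib add_diff_add diff_self add_0_left)
    then have "(cnj (freq m th) - cnj (freq m (- th))) * u T = 0"
      unfolding e1 e2 by (simp only: diff_self)
    moreover have "cnj (freq m th) - cnj (freq m (- th)) \<noteq> 0"
      using False by (simp add: complex_eq_iff)
    ultimately show ?thesis by simp
  qed
  then show "u T = 0" "z T = 0" using e1 by simp_all
qed

end

section \<open>The vector moment problem and its targets\<close>

lemma norm_vector_scalar: "norm (c *s v) = norm c * norm (v :: complex^'n)"
  by (simp add: norm_vec_def L2_set_def norm_mult power_mult_distrib real_sqrt_mult
      flip: sum_distrib_left)

lemma bounded_linear_scalar_left: "bounded_linear (\<lambda>c::complex. c *s (v :: complex^'n))"
  by (rule bounded_linear_intro[where K = "norm v"])
     (simp_all add: vec_eq_iff distrib_right norm_vector_scalar)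

lemma matrix_vector_bounded_linear: "bounded_linear ((*v) (A :: complex^'n^'m))"
  using linear_matrix_vector linear_conv_bounded_linear by blast

lemma matrix_vector_norm_bound:
  obtains K where "0 \<le> K" "\<And>v. norm ((A :: complex^'n^'m) *v v) \<le> K * norm v"
  using onorm[OF matrix_vector_bounded_linear] onorm_pos_le[OF matrix_vector_bounded_linear] that by blast

lemma gaussian_summable:
  fixes eps :: real
  assumes "0 < eps"
  shows "summable (\<lambda>n. exp (- eps * (real (Suc n))\<^sup>2))"
proof (rule summable_comparison_test')
  show "summable (\<lambda>n. exp (- eps) ^ n)" by (rule summable_geometric) (use assms in simp)
  fix n :: nat
  have "real n \<le> (real (Suc n))\<^sup>2" by (simp add: power2_eq_square algebra_simps)
  then have "- eps * (real (Suc n))\<^sup>2 \<le> real n * - eps" using assms by (simp add: mult.commute)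
  then show "norm (exp (- eps * (real (Suc n))\<^sup>2)) \<le> exp (- eps) ^ n"
    by (simp flip: exp_of_nat_mult)
qed

text \<open>The control is the sum over all levels \<open>n\<close> and exponents of \<open>q n th j\<close> times a vector which \<open>R th\<close>
chooses such that \<open>G th B\<close> maps it to the prescribed target. Since the targets are only required to be
bounded in \<open>n\<close>, the Gaussian decay of the family makes the sum converge.\<close>

lemma moment_problem:
  fixes B :: "complex^'l^'n" and G :: "real \<Rightarrow> complex^'n^'n" and R :: "real \<Rightarrow> complex^'n^'l"
  assumes T: "0 < T" and Theta: "finite Theta"
    and R: "\<And>th v. th \<in> Theta \<Longrightarrow> G th *v (B *v (R th *v v)) = G th *v v"
  obtains C where "0 \<le> C"
    and "\<And>N d. 0 \<le> N \<Longrightarrow> (\<And>n th j. 1 \<le> n \<Longrightarrow> th \<in> Theta \<Longrightarrow> norm (d n th j) \<le> N) \<Longrightarrow>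
      \<exists>F. C2_jet 0 T (C * N) F \<and>
        (\<forall>m\<ge>1. \<forall>th\<in>Theta. \<forall>i<2. \<forall>r. moment T i (freq m th) (\<lambda>t. (G th *v (B *v F 0 t)) $ r)
           = (G th *v d m th i) $ r)"
proof -
  obtain eps C0 q where eps: "0 < eps" and C0: "0 \<le> C0"
    and jq: "\<And>n th j. 1 \<le> n \<Longrightarrow> th \<in> Theta \<Longrightarrow> j < 2 \<Longrightarrow> C2_jet 0 T (C0 * exp (- eps * (real n)\<^sup>2)) (q n th j)"
    and mq: "\<And>n th j m ph i. 1 \<le> n \<Longrightarrow> th \<in> Theta \<Longrightarrow> j < 2 \<Longrightarrow> 1 \<le> m \<Longrightarrow> ph \<in> Theta \<Longrightarrow> i < 2
      \<Longrightarrow> moment T i (freq m ph) (q n th j 0) = (if m = n \<and> ph = th \<and> i = j then 1 else 0)"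
    using biorthogonal_family[OF T Theta] by blast
  define BR where "BR th = onorm ((*v) (R th))" for th
  have BR: "norm (R th *v v) \<le> BR th * norm v" "0 \<le> BR th" for th v
    unfolding BR_def using onorm[OF matrix_vector_bounded_linear] onorm_pos_le[OF matrix_vector_bounded_linear] by auto
  define E where "E n = exp (- eps * (real (Suc n))\<^sup>2)" for n
  define K where "K = (\<Sum>th\<in>Theta. \<Sum>j\<in>{..<2::nat}. C0 * BR th)"
  have K: "0 \<le> K" unfolding K_def by (intro sum_nonneg mult_nonneg_nonneg C0 BR)
  have sE: "summable E" unfolding E_def[abs_def] by (rule gaussian_summable[OF eps])
  have E0: "0 \<le> E n" for n by (simp add: E_def)
  show ?thesis
  proof (rule that[of "K * suminf E"])
    show "0 \<le> K * suminf E" using K suminf_nonneg[OF sE E0] by simp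
    fix N :: real and d :: "nat \<Rightarrow> real \<Rightarrow> nat \<Rightarrow> complex^'n"
    assume N: "0 \<le> N" and d: "\<And>n th j. 1 \<le> n \<Longrightarrow> th \<in> Theta \<Longrightarrow> norm (d n th j) \<le> N"
    \<comment> \<open>The series index starts at \<open>0\<close> and the levels at \<open>1\<close>.\<close>
    define c where "c n th j = R th *v d (Suc n) th j" for n th j
    have cb: "norm (c n th j) \<le> BR th * N" if "th \<in> Theta" for n th j
      unfolding c_def using d[of "Suc n" th j] that
      by (intro order_trans[OF BR(1)] mult_left_mono BR(2)) auto
    define X where "X n k t = (\<Sum>th\<in>Theta. \<Sum>j\<in>{..<2}. q (Suc n) th j k t *s c n th j)" for n k t
    have jX: "C2_jet 0 T (K * N * E n) (X n)" for n
    proof -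
      have "C2_jet 0 T (\<Sum>th\<in>Theta. \<Sum>j\<in>{..<2::nat}. C0 * E n * (BR th * N)) (X n)"
        unfolding X_def[abs_def]
      proof (intro C2_jet_sum Theta finite_lessThan)
        fix th j assume th: "th \<in> Theta" and j: "j \<in> {..<2::nat}"
        show "C2_jet 0 T (C0 * E n * (BR th * N)) (\<lambda>k t. q (Suc n) th j k t *s c n th j)"
          using th j C0 E0 cb[OF th] BR(2) N unfolding E_def
          by (intro C2_jet_linear[OF jq bounded_linear_scalar_left])
             (auto simp: norm_vector_scalar intro!: mult_left_mono)
      qed
      moreover have "(\<Sum>th\<in>Theta. \<Sum>j\<in>{..<2::nat}. C0 * E n * (BR th * N)) = K * N * E n"
        by (simp add: K_def sum_distrib_left sum_distrib_right mult_ac)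
      ultimately show ?thesis by simp
    qed
    have sX: "summable (\<lambda>n. K * N * E n)" by (rule summable_mult[OF sE])
    define F where "F k t = (\<Sum>n. X n k t)" for k t
    have "C2_jet 0 T (\<Sum>n. K * N * E n) F"
      unfolding F_def[abs_def] by (rule C2_jet_suminf[OF jX sX])
    moreover have "(\<Sum>n. K * N * E n) = K * suminf E * N"
      by (subst suminf_mult[OF sE]) simp
    ultimately have jF: "C2_jet 0 T (K * suminf E * N) F" by simp
    have "moment T i (freq m th) (\<lambda>t. (G th *v (B *v F 0 t)) $ r) = (G th *v d m th i) $ r"
      if m: "1 \<le> m" and th: "th \<in> Theta" and i: "i < 2" for m th i r
    proof -
      define l where "l v = (G th *v (B *v v)) $ r" for v
      have bl: "bounded_linear l"
        unfolding l_def[abs_def]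
        by (intro bounded_linear_compose[OF bounded_linear_vec_nth]
            bounded_linear_compose[OF matrix_vector_bounded_linear] matrix_vector_bounded_linear)
      have ls: "l (a *s v) = a * l v" for a v
        by (simp add: l_def vector_scalar_commute)
      have lX: "l (X n 0 t) = (\<Sum>ph\<in>Theta. \<Sum>j\<in>{..<2}. l (c n ph j) * q (Suc n) ph j 0 t)" for n t
        unfolding X_def
        by (simp add: linear_sum[OF bounded_linear.linear[OF bl]] ls mult.commute del: sum.lessThan_Suc)
      obtain Kl where Kl: "\<And>v. norm (l v) \<le> norm v * Kl" "0 \<le> Kl"
        using bounded_linear.nonneg_bounded[OF bl] by blast
      have jlX: "C2_jet 0 T (K * N * E n * Kl) (\<lambda>k t. l (X n k t))" for n
        by (rule C2_jet_linear[OF jX bl Kl])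
      have slX: "summable (\<lambda>n. K * N * E n * Kl)" by (rule summable_mult2[OF sX])
      have lF: "l (F 0 t) = (\<Sum>n. l (X n 0 t))" for t
        unfolding F_def
        by (rule bounded_linear.suminf[OF bl])
           (rule summable_comparison_test'[OF sX], use C2_jet_bound[OF jX, of 0] in auto)
      have "(\<lambda>n. moment T i (freq m th) (\<lambda>t. l (X n 0 t))) sums moment T i (freq m th) (\<lambda>t. \<Sum>n. l (X n 0 t))"
        by (rule moment_sums[OF C2_jet_continuous[OF jlX, of 0] C2_jet_bound[OF jlX, of 0] slX]) auto
      moreover have "moment T i (freq m th) (\<lambda>t. l (X n 0 t)) = (if n = m - 1 then l (c n th i) else 0)" for n
      proof -
        have cq: "continuous_on {0..T} (q (Suc n) ph j 0)" if "ph \<in> Theta" "j < 2" for ph j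
          by (rule C2_jet_continuous[OF jq]) (use that in auto)
        have "moment T i (freq m th) (\<lambda>t. l (X n 0 t))
          = (\<Sum>ph\<in>Theta. moment T i (freq m th) (\<lambda>t. \<Sum>j\<in>{..<2}. l (c n ph j) * q (Suc n) ph j 0 t))"
          unfolding lX by (rule moment_sum[OF Theta]) (auto intro!: continuous_intros cq)
        also have "\<dots> = (\<Sum>ph\<in>Theta. \<Sum>j\<in>{..<2}. l (c n ph j) * moment T i (freq m th) (q (Suc n) ph j 0))"
          by (intro sum.cong refl, subst moment_sum)
             (auto intro!: continuous_intros cq simp: moment_cmult)
        also have "\<dots> = (\<Sum>ph\<in>Theta. \<Sum>j\<in>{..<2}. if n = m - 1 \<and> th = ph \<and> i = j then l (c n ph j) else 0)"
          using m th i by (intro sum.cong refl) (auto simp: mq)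
        also have "\<dots> = (if n = m - 1 then l (c n th i) else 0)"
        proof (cases "n = m - 1")
          case True
          have "(\<Sum>ph\<in>Theta. \<Sum>j\<in>{..<2}. if n = m - 1 \<and> th = ph \<and> i = j then l (c n ph j) else 0)
             = (\<Sum>ph\<in>Theta. if th = ph then (\<Sum>j\<in>{..<2}. if i = j then l (c n ph j) else 0) else 0)"
            using True by (intro sum.cong refl) auto
          also have "\<dots> = (\<Sum>j\<in>{..<2}. if i = j then l (c n th j) else 0)"
            using Theta th by (simp add: sum.delta)
          also have "\<dots> = l (c n th i)" using i by (subst sum.delta') auto
          finally show ?thesis using True by simp
        qed simp
        finally show ?thesis .
      qed
      ultimately have "(\<lambda>n. if n = m - 1 then l (c n th i) else 0) sums moment T i (freq m th) (\<lambda>t. l (F 0 t))"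
        by (simp add: lF)
      moreover have "(\<lambda>n. if n = m - 1 then l (c n th i) else 0) sums l (c (m - 1) th i)"
        by (rule sums_single)
      ultimately have "moment T i (freq m th) (\<lambda>t. l (F 0 t)) = l (c (m - 1) th i)"
        by (rule sums_unique2)
      also have "\<dots> = (G th *v d m th i) $ r" using m R[OF th] by (simp add: l_def c_def)
      finally show ?thesis by (simp add: l_def)
    qed
    then show "\<exists>F. C2_jet 0 T (K * suminf E * N) F \<and>
        (\<forall>m\<ge>1. \<forall>th\<in>Theta. \<forall>i<2. \<forall>r. moment T i (freq m th) (\<lambda>t. (G th *v (B *v F 0 t)) $ r)
           = (G th *v d m th i) $ r)"
      using jF by blast
  qed
qed

lemma hcoef_bounds:
  assumes "1 \<le> m"
  shows "1 / (2 * real m) \<le> \<bar>hcoef m\<bar>" "\<bar>hcoef m\<bar> \<le> 1 / real m"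
proof -
  have "(1 / 2)\<^sup>2 \<le> 2 / pi" using pi_less_4 by (simp add: power2_eq_square field_simps)
  then have a: "1 / 2 \<le> sqrt (2 / pi)" by (rule real_le_rsqrt)
  have b: "sqrt (2 / pi) \<le> 1" using pi_gt3 by simp
  have h: "\<bar>hcoef m\<bar> = sqrt (2 / pi) / real m" by (simp add: hcoef_def abs_mult power_abs)
  show "1 / (2 * real m) \<le> \<bar>hcoef m\<bar>" "\<bar>hcoef m\<bar> \<le> 1 / real m"
    unfolding h using a b assms by (simp_all add: field_simps)
qed

text \<open>The factor in front of the moment in the first identity. Its size is at least of order $m^3$, which
balances the factor $m^2$ in the data.\<close>

definition mode_factor :: "nat \<Rightarrow> real \<Rightarrow> complex" where
  "mode_factor m th = of_real (hcoef m) * (of_real (real m ^ 4) - of_real (2 * (real m)\<^sup>2) * freq m th)"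

lemma mode_factor_lower:
  assumes "1 \<le> m"
  shows "real m ^ 3 / 2 \<le> norm (mode_factor m th)"
proof -
  have "of_real (real m ^ 4) - of_real (2 * (real m)\<^sup>2) * freq m th = - Complex (real m ^ 4) (2 * (real m)\<^sup>2 * th)"
    by (simp add: complex_eq_iff power2_eq_square eval_nat_numeral)
  then have "real m ^ 4 \<le> norm (of_real (real m ^ 4) - of_real (2 * (real m)\<^sup>2) * freq m th)"
    using abs_Re_le_cmod[of "Complex (real m ^ 4) (2 * (real m)\<^sup>2 * th)"] by simp
  then have "1 / (2 * real m) * real m ^ 4 \<le> \<bar>hcoef m\<bar> * norm (of_real (real m ^ 4) - of_real (2 * (real m)\<^sup>2) * freq m th)"
    using hcoef_bounds[OF assms] by (intro mult_mono) auto
  then have "1 / (2 * real m) * real m ^ 4 \<le> norm (mode_factor m th)"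
    by (simp add: mode_factor_def norm_mult)
  then show ?thesis using assms by (simp add: eval_nat_numeral)
qed

text \<open>\<open>target0\<close> and \<open>target1\<close> are the values of the two moments for which the right-hand sides of the
two identities vanish, given the initial displacement \<open>a\<close> and velocity \<open>b\<close> at level \<open>m\<close>.\<close>

definition target0 :: "nat \<Rightarrow> real \<Rightarrow> complex^'n \<Rightarrow> complex^'n \<Rightarrow> complex^'n" where
  "target0 m th a b = (- 1 / mode_factor m th) *s (b + cnj (freq m th) *s a)"

definition target1 :: "nat \<Rightarrow> complex^'n \<Rightarrow> complex^'n \<Rightarrow> complex^'n" where
  "target1 m a b = (- 1 / of_real (hcoef m * real m ^ 4)) *s
     (a + of_real (2 * (real m)\<^sup>2 * hcoef m) *s target0 m 0 a b)"

lemma target0_bound: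
  assumes m: "1 \<le> m" and D: "\<bar>th\<bar> \<le> D"
  shows "norm (target0 m th a b) \<le> 2 * (1 + D) * (norm a + norm b)"
proof -
  have D0: "0 \<le> D" using D by linarith
  have m2: "1 \<le> (real m)\<^sup>2" using m by simp
  have m23: "(real m)\<^sup>2 \<le> real m ^ 3" using m by (intro power_increasing) auto
  have "norm (cnj (freq m th)) \<le> (real m)\<^sup>2 + \<bar>th\<bar>"
    using cmod_le[of "freq m th"] by simp
  also have "\<dots> \<le> (1 + D) * (real m)\<^sup>2" using mult_left_mono[OF m2 D0] D by (simp add: distrib_right)
  finally have fr: "norm (cnj (freq m th)) \<le> (1 + D) * (real m)\<^sup>2" .
  have pos: "0 < real m ^ 3 / 2" using m by simp
  have "norm (b + cnj (freq m th) *s a) \<le> norm b + (1 + D) * (real m)\<^sup>2 * norm a"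
    using norm_triangle_ineq[of b "cnj (freq m th) *s a"] mult_right_mono[OF fr norm_ge_zero[of a]]
    by (simp add: norm_vector_scalar)
  also have "\<dots> \<le> (1 + D) * real m ^ 3 * norm b + (1 + D) * real m ^ 3 * norm a"
  proof (intro add_mono mult_right_mono mult_left_mono m23)
    have "1 * 1 \<le> (1 + D) * real m ^ 3" using D0 m by (intro mult_mono) auto
    then show "norm b \<le> (1 + D) * real m ^ 3 * norm b"
      using mult_right_mono[of 1 "(1 + D) * real m ^ 3" "norm b"] by simp
  qed (use D0 in auto)
  finally have num: "norm (b + cnj (freq m th) *s a) \<le> (1 + D) * real m ^ 3 * (norm a + norm b)"
    by (simp add: distrib_left add.commute)
  have "norm (target0 m th a b) = norm (b + cnj (freq m th) *s a) / norm (mode_factor m th)"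
    unfolding target0_def norm_vector_scalar norm_divide norm_minus_cancel norm_one by simp
  also have "\<dots> \<le> ((1 + D) * real m ^ 3 * (norm a + norm b)) / (real m ^ 3 / 2)"
    using D0 by (intro frac_le num pos mode_factor_lower[OF m]) auto
  also have "\<dots> = 2 * (1 + D) * (norm a + norm b)"
  proof -
    have *: "c * p * s / (p / 2) = 2 * c * s" if "0 < p" for c p s :: real using that by simp
    show ?thesis by (rule *) (use m in simp)
  qed
  finally show ?thesis .
qed

lemma target1_bound:
  assumes m: "1 \<le> m"
  shows "norm (target1 m a b) \<le> 10 * (norm a + norm b)"
proof -
  have t0: "norm (target0 m 0 a b) \<le> 2 * (norm a + norm b)"
    using target0_bound[OF m, of 0 0 a b] by simp
  have h1: "(real m)\<^sup>2 * \<bar>hcoef m\<bar> \<le> real m ^ 3"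
  proof -
    have "(real m)\<^sup>2 * \<bar>hcoef m\<bar> \<le> (real m)\<^sup>2 * (1 / real m)"
      by (intro mult_left_mono hcoef_bounds[OF m]) auto
    also have "\<dots> \<le> real m ^ 3" using m power_increasing[of 1 3 "real m"] by (simp add: power2_eq_square)
    finally show ?thesis .
  qed
  have m3: "1 \<le> real m ^ 3" using m by simp
  have "norm (a + of_real (2 * (real m)\<^sup>2 * hcoef m) *s target0 m 0 a b)
     \<le> norm a + 2 * ((real m)\<^sup>2 * \<bar>hcoef m\<bar>) * norm (target0 m 0 a b)"
    using norm_triangle_ineq[of a "of_real (2 * (real m)\<^sup>2 * hcoef m) *s target0 m 0 a b"]
    by (simp add: norm_vector_scalar abs_mult norm_mult norm_power)
  also have "\<dots> \<le> real m ^ 3 * (norm a + norm b) + 2 * real m ^ 3 * (2 * (norm a + norm b))"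
  proof (rule add_mono)
    have "1 * norm a \<le> real m ^ 3 * (norm a + norm b)" using m3 by (intro mult_mono) auto
    then show "norm a \<le> real m ^ 3 * (norm a + norm b)" by simp
    show "2 * ((real m)\<^sup>2 * \<bar>hcoef m\<bar>) * norm (target0 m 0 a b) \<le> 2 * real m ^ 3 * (2 * (norm a + norm b))"
      using h1 t0 by (intro mult_mono mult_left_mono) auto
  qed
  also have "\<dots> = 5 * real m ^ 3 * (norm a + norm b)" by simp
  finally have num: "norm (a + of_real (2 * (real m)\<^sup>2 * hcoef m) *s target0 m 0 a b)
     \<le> 5 * real m ^ 3 * (norm a + norm b)" .
  have den: "real m ^ 3 / 2 \<le> \<bar>hcoef m * real m ^ 4\<bar>"
  proof -
    have "1 / (2 * real m) * real m ^ 4 \<le> \<bar>hcoef m\<bar> * real m ^ 4"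
      by (intro mult_right_mono hcoef_bounds[OF m]) auto
    then show ?thesis using m by (simp add: abs_mult eval_nat_numeral)
  qed
  have "norm (target1 m a b) = norm (a + of_real (2 * (real m)\<^sup>2 * hcoef m) *s target0 m 0 a b) / \<bar>hcoef m * real m ^ 4\<bar>"
    unfolding target1_def norm_vector_scalar norm_divide norm_minus_cancel norm_one norm_of_real by simp
  also have "\<dots> \<le> 5 * real m ^ 3 * (norm a + norm b) / (real m ^ 3 / 2)"
    using m by (intro frac_le num den) auto
  also have "\<dots> = 10 * (norm a + norm b)" using m by simp
  finally show ?thesis .
qed

text \<open>Every component of \<open>G mu V\<close>, corrected by the lifted control, is a controlled mode; its initial and
terminal values are those of \<open>V\<close> because the control vanishes to first order at both ends. All
components of all spectral parts are steered to zero, and the spectral parts add up to the vector.\<close>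

lemma coefficients_vanish:
  fixes A :: "complex^'n^'n" and B :: "complex^'l^'n" and G :: "real \<Rightarrow> complex^'n^'n"
    and f :: "nat \<Rightarrow> real \<Rightarrow> complex^'l" and V W :: "real \<Rightarrow> complex^'n"
  assumes T: "0 < T" and S: "\<And>mu. mu \<in> S \<Longrightarrow> 0 \<le> mu" and m: "1 \<le> m"
    and G: "\<And>v. (\<Sum>mu\<in>S. G mu *v v) = v" "\<And>mu v. G mu *v (A *v v) = mu *\<^sub>R (G mu *v v)"
    and f: "C2_jet 0 T M f"
    and H: "H2 T V W (\<lambda>t. - (2 * (real m)\<^sup>2) *\<^sub>R W t - (real m ^ 4) *\<^sub>R V t
        - A *v V t - hcoef m *\<^sub>R (B *v f 2 t + A *v (B *v f 0 t)))"
    and mom0: "\<And>th r. th\<^sup>2 \<in> S \<Longrightarrow> moment T 0 (freq m th) (\<lambda>t. (G (th\<^sup>2) *v (B *v f 0 t)) $ r)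
        = (G (th\<^sup>2) *v target0 m th (V 0) (W 0)) $ r"
    and mom1: "\<And>r. 0 \<in> S \<Longrightarrow> moment T 1 (freq m 0) (\<lambda>t. (G 0 *v (B *v f 0 t)) $ r)
        = (G 0 *v target1 m (V 0) (W 0)) $ r"
  shows "V T = 0" "W T = 0"
proof -
  define x where "x = hcoef m"
  have x0: "x \<noteq> 0" using hcoef_bounds(1)[OF m] m by (auto simp: x_def)
  note bl = matrix_vector_bounded_linear
  have cm: "continuous_on X (\<lambda>t. C *v h t)" if "continuous_on X h" for X and h :: "real \<Rightarrow> complex^'b" and C :: "complex^'b^'a"
    by (rule bounded_linear.continuous_on[OF bl that])
  define rhs where "rhs t = - (2 * (real m)\<^sup>2) *\<^sub>R W t - (real m ^ 4) *\<^sub>R V t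
        - A *v V t - x *\<^sub>R (B *v f 2 t + A *v (B *v f 0 t))" for t
  have H': "H2 T V W rhs" using H by (simp add: rhs_def[abs_def] x_def)
  have cr: "continuous_on {0..T} rhs"
    unfolding rhs_def[abs_def]
    by (intro continuous_intros cm H2_continuous[OF H'] C2_jet_continuous[OF f]) auto
  have f0: "f k 0 = 0" "f k T = 0" if "k \<le> 2" for k using C2_jet_zero[OF f that] by auto
  have main: "(G mu *v V T) $ r = 0 \<and> (G mu *v W T) $ r = 0" if mu: "mu \<in> S" for mu r
  proof -
    define l where "l v = (G mu *v v) $ r" for v
    have lbl: "bounded_linear l" unfolding l_def[abs_def]
      by (intro bounded_linear_compose[OF bounded_linear_vec_nth] bl)
    have lA: "l (A *v v) = mu *\<^sub>R l v" for v by (simp add: l_def G(2))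
    have ls: "l (a *s v) = a * l v" for a v
      by (simp add: l_def vector_scalar_commute)
    define F where "F t = l (B *v f 0 t)" for t
    define F1 where "F1 t = l (B *v f 1 t)" for t
    define u where "u t = l (V t) + of_real x * F t" for t
    define z where "z t = l (W t) + of_real x * F1 t" for t
    have dF: "(F has_vector_derivative F1 t) (at t within X)" for t X
      unfolding F_def[abs_def] F1_def
      by (rule bounded_linear.has_vector_derivative[OF lbl bounded_linear.has_vector_derivative[OF bl
          has_vector_derivative_at_within]]) (use C2_jet_deriv[OF f, of 0 t] in simp)
    have dF1: "(F1 has_vector_derivative l (B *v f 2 t)) (at t within X)" for t X
      unfolding F1_def[abs_def]
      by (rule bounded_linear.has_vector_derivative[OF lbl bounded_linear.has_vector_derivative[OF bl
          has_vector_derivative_at_within]]) (use C2_jet_deriv[OF f, of 1 t] in \<open>simp add: numeral_2_eq_2\<close>)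
    have sq: "(sqrt mu)\<^sup>2 = mu" using S[OF mu] by simp
    interpret controlled_mode T "sqrt mu" x m u z F F1
    proof
      show "0 < T" by (rule T)
      show "F 0 = 0" "F T = 0"
        using f0[of 0] bounded_linear.linear[OF lbl] by (simp_all add: F_def linear_0)
      fix t assume t: "t \<in> {0..T}"
      show "(F has_vector_derivative F1 t) (at t within {0..T})" by (rule dF)
      show "(u has_vector_derivative z t) (at t within {0..T})"
        unfolding u_def[abs_def] z_def
        by (intro has_vector_derivative_add has_vector_derivative_mult_right dF
            bounded_linear.has_vector_derivative[OF lbl] H2_deriv[OF H' t])
      have "(z has_vector_derivative l (rhs t) + of_real x * l (B *v f 2 t)) (at t within {0..T})"
        unfolding z_def[abs_def]
        by (intro has_vector_derivative_add has_vector_derivative_mult_right dF1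
            bounded_linear.has_vector_derivative[OF lbl] H2_classical[OF H' cr t])
      moreover have "l (rhs t) + of_real x * l (B *v f 2 t)
          = of_real x * (of_real (2 * (real m)\<^sup>2) * F1 t + of_real (real m ^ 4) * F t)
          - of_real (2 * (real m)\<^sup>2) * z t - of_real (real m ^ 4 + (sqrt mu)\<^sup>2) * u t"
      proof -
        have "l (rhs t) = - (of_real (2 * (real m)\<^sup>2) * l (W t)) - of_real (real m ^ 4) * l (V t)
           - of_real mu * l (V t) - of_real x * (l (B *v f 2 t) + of_real mu * F t)"
          unfolding rhs_def F_def
          by (simp add: linear_diff[OF bounded_linear.linear[OF lbl]] linear_add[OF bounded_linear.linear[OF lbl]]
              linear_scale[OF bounded_linear.linear[OF lbl]] linear_neg[OF bounded_linear.linear[OF lbl]]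
              lA scaleR_conv_of_real[where 'a = complex] del: of_real_mult of_real_power)
        then show ?thesis
          unfolding sq z_def u_def of_real_add by (simp only: distrib_left distrib_right) (simp add: algebra_simps)
      qed
      ultimately show "(z has_vector_derivative of_real x * (of_real (2 * (real m)\<^sup>2) * F1 t + of_real (real m ^ 4) * F t)
          - of_real (2 * (real m)\<^sup>2) * z t - of_real (real m ^ 4 + (sqrt mu)\<^sup>2) * u t) (at t within {0..T})"
        by simp
    qed
    have F1z: "F1 0 = 0" "F1 T = 0"
      using f0[of 1] bounded_linear.linear[OF lbl] by (simp_all add: F1_def linear_0)
    have u0: "u 0 = l (V 0)" "z 0 = l (W 0)" by (simp_all add: u_def z_def F0 F1z)
    have uT: "u T = l (V T)" "z T = l (W T)" by (simp_all add: u_def z_def F0 F1z)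
    have first: "z 0 + cnj (freq m th') * u 0
      + of_real x * (of_real (real m ^ 4) - of_real (2 * (real m)\<^sup>2) * freq m th') * moment T 0 (freq m th') F = 0"
      if "th'\<^sup>2 = (sqrt mu)\<^sup>2" for th'
    proof -
      have th': "th'\<^sup>2 = mu" using that sq by simp
      have mf: "mode_factor m th' \<noteq> 0" using mode_factor_lower[OF m, of th'] m by auto
      have "moment T 0 (freq m th') F = l (target0 m th' (V 0) (W 0))"
        using mom0[of th' r] th' mu by (simp add: F_def[abs_def] l_def)
      also have "\<dots> = (- 1 / mode_factor m th') * (l (W 0) + cnj (freq m th') * l (V 0))"
        unfolding target0_def ls by (simp add: linear_add[OF bounded_linear.linear[OF lbl]] ls)
      finally show ?thesis
        using mf unfolding x_def mode_factor_def[symmetric] u0 by simp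
    qed
    have second: "u 0 + of_real x * (of_real (2 * (real m)\<^sup>2) * moment T 0 (freq m 0) F
      + of_real (real m ^ 4) * moment T 1 (freq m 0) F) = 0" if "sqrt mu = 0"
    proof -
      have mu0: "mu = 0" using that by simp
      have M0: "moment T 0 (freq m 0) F = l (target0 m 0 (V 0) (W 0))"
        using mom0[of 0 r] mu mu0 by (simp add: F_def[abs_def] l_def)
      have "moment T 1 (freq m 0) F = l (target1 m (V 0) (W 0))"
        using mom1[of r] mu unfolding mu0 F_def[abs_def] l_def by simp
      also have "\<dots> = (- 1 / of_real (x * real m ^ 4)) *
          (l (V 0) + of_real (2 * (real m)\<^sup>2 * x) * l (target0 m 0 (V 0) (W 0)))"
        unfolding target1_def ls x_def[symmetric]
        by (simp only: linear_add[OF bounded_linear.linear[OF lbl]] ls)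
      finally have M1: "of_real (x * real m ^ 4) * moment T 1 (freq m 0) F
          = - (l (V 0) + of_real (2 * (real m)\<^sup>2 * x) * moment T 0 (freq m 0) F)"
        using x0 m unfolding M0 by simp
      show ?thesis using M1 unfolding u0 by (simp add: algebra_simps)
    qed
    show ?thesis using steered_to_zero[OF first second] unfolding uT l_def by blast
  qed
  have "(\<Sum>mu\<in>S. G mu *v V T) = 0" "(\<Sum>mu\<in>S. G mu *v W T) = 0"
    using main by (auto intro!: sum.neutral simp: vec_eq_iff)
  then show "V T = 0" "W T = 0" using G(1) by simp_all
qed

section \<open>Existence and terminal values of solutions\<close>

lemma Xs_coef_norm_summable:
  assumes "y \<in> Xs s" "1 \<le> s"
  shows "summable (\<lambda>m. norm (coef m y))"
proof (rule summable_norm_of_weighted)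
  show "summable (\<lambda>m. real m powr 2 * (norm (coef m y))\<^sup>2)"
  proof (rule summable_comparison_test'[OF Xs_coef_summable[OF assms(1)], of 1])
    fix m :: nat assume "1 \<le> m"
    then have "real m powr 2 \<le> real m powr (2 * s)"
      using assms(2) by (intro powr_mono) auto
    then show "norm (real m powr 2 * (norm (coef m y))\<^sup>2) \<le> real m powr (2 * s) * (norm (coef m y))\<^sup>2"
      by (simp add: mult_right_mono)
  qed
qed

lemma coef_le_Xs_norm:
  assumes "y \<in> Xs s" "1 \<le> m" "0 \<le> s"
  shows "norm (coef m y) \<le> Xs_norm s y"
proof -
  have "1 * norm (coef m y) \<le> real m powr s * norm (coef m y)"
    using assms by (intro mult_right_mono ge_one_powr_ge_zero) auto
  then show ?thesis using Xs_coef_bound[OF assms(1,2)] by simp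
qed

text \<open>For the bound \<open>Y m\<close> from the equation at level \<open>m\<close>, the quantity $m^3 Y_m$ is a multiple of
$m^3 |u^0_m| + m |u^1_m| + C m^{-2}$, since the source decays like \<open>1 / m\<close> with the coefficients of
the lifting. Each of the three terms is square summable.\<close>

lemma mode_bounds_summable:
  fixes u0 u1 :: "real \<Rightarrow> 'a::euclidean_space" and K C :: real
  assumes u0: "u0 \<in> Xs 3" and u1: "u1 \<in> Xs 1"
  defines "Y \<equiv> \<lambda>m. if m = 0 then 0 else
     K * (norm (coef m u0) + norm (coef m u1) / (real m)\<^sup>2 + (C / real m) / real m ^ 4)"
  shows "summable (\<lambda>m. real m powr 6 * (Y m)\<^sup>2)"
proof -
  have s0: "summable (\<lambda>m. real m powr 6 * (norm (coef m u0))\<^sup>2)" using Xs_coef_summable[OF u0] by simp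
  have s1: "summable (\<lambda>m. real m powr 2 * (norm (coef m u1))\<^sup>2)" using Xs_coef_summable[OF u1] by simp
  have s2: "summable (\<lambda>m. C\<^sup>2 * (1 / real m ^ 4))"
    using inverse_power_summable[of 4, where 'a = real] by (intro summable_mult) (simp add: inverse_eq_divide)
  have "summable (\<lambda>m. (3 * K\<^sup>2) * (real m powr 6 * (norm (coef m u0))\<^sup>2
     + real m powr 2 * (norm (coef m u1))\<^sup>2 + C\<^sup>2 * (1 / real m ^ 4)))"
    by (intro summable_mult summable_add s0 s1 s2)
  then show ?thesis
  proof (rule summable_comparison_test'[where N = 1])
    fix m :: nat assume m: "1 \<le> m"
    define a where "a = real m ^ 3 * norm (coef m u0)"
    define b where "b = real m * norm (coef m u1)"
    define c where "c = C / (real m)\<^sup>2"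
    have "real m ^ 3 * Y m = K * (a + b + c)"
      using m by (simp add: Y_def a_def b_def c_def field_simps eval_nat_numeral)
    then have "(real m ^ 3 * Y m)\<^sup>2 = (K * (a + b + c))\<^sup>2" by (simp only:)
    moreover have "real m powr 6 = (real m ^ 3)\<^sup>2" using m by (simp flip: power_mult)
    ultimately have e: "real m powr 6 * (Y m)\<^sup>2 = K\<^sup>2 * (a + b + c)\<^sup>2"
      by (simp only: power_mult_distrib)
    have "(a + b + c)\<^sup>2 \<le> 3 * (a\<^sup>2 + b\<^sup>2 + c\<^sup>2)"
      using sum_squares_bound[of a b] sum_squares_bound[of b c] sum_squares_bound[of a c]
      by (simp add: power2_eq_square algebra_simps)
    then have "K\<^sup>2 * (a + b + c)\<^sup>2 \<le> K\<^sup>2 * (3 * (a\<^sup>2 + b\<^sup>2 + c\<^sup>2))" by (intro mult_left_mono) auto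
    also have "\<dots> = (3 * K\<^sup>2) * (real m powr 6 * (norm (coef m u0))\<^sup>2
     + real m powr 2 * (norm (coef m u1))\<^sup>2 + C\<^sup>2 * (1 / real m ^ 4))"
      using m by (simp add: a_def b_def c_def power_mult_distrib power_divide flip: power_mult)
    finally show "norm (real m powr 6 * (Y m)\<^sup>2) \<le> (3 * K\<^sup>2) * (real m powr 6 * (norm (coef m u0))\<^sup>2
     + real m powr 2 * (norm (coef m u1))\<^sup>2 + C\<^sup>2 * (1 / real m ^ 4))"
      unfolding e by simp
  qed
qed

text \<open>The modes are solved separately and superposed. One and the same square summable sequence $m^3 Y_m$
gives \<open>C0_Xs T 3\<close> for the displacement and \<open>C0_Xs T 1\<close> for the velocity, as the latter is bounded by
$m^2 Y_m$.\<close>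

lemma solution_exists:
  fixes A :: "complex^'n^'n" and B :: "complex^'l^'n" and f :: "nat \<Rightarrow> real \<Rightarrow> complex^'l"
  assumes T: "0 < T" and A: "pos_semidef A"
    and u0: "u0 \<in> Xs 3" and u1: "u1 \<in> Xs 1" and f: "C2_jet 0 T M f"
  shows "\<exists>u ut. is_solution T A B u0 u1 (f 0) (f 1) (f 2) u ut"
proof -
  obtain S E G where S: "finite S" "S \<subseteq> real_eigenvalues A"
    and E: "\<And>v. (\<Sum>mu\<in>S. E mu *v v) = v" "\<And>mu v. A *v (E mu *v v) = mu *\<^sub>R (E mu *v v)"
    and "\<And>v. (\<Sum>mu\<in>S. G mu *v v) = v" "\<And>mu v. G mu *v (A *v v) = mu *\<^sub>R (G mu *v v)"
    by (rule spectral_resolution[OF A]) blast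
  have S0: "0 \<le> mu" if "mu \<in> S" for mu using real_eigenvalues_nonneg[OF A] S(2) that by blast
  note bl = matrix_vector_bounded_linear
  obtain KB where KB: "0 \<le> KB" "\<And>v. norm (B *v v) \<le> KB * norm v" by (rule matrix_vector_norm_bound[of B]) blast
  obtain KA where KA: "0 \<le> KA" "\<And>v. norm (A *v v) \<le> KA * norm v" by (rule matrix_vector_norm_bound[of A]) blast
  have M0: "0 \<le> M" by (rule C2_jet_nonneg[OF f])
  define h where "h t = B *v f 2 t + A *v (B *v f 0 t)" for t
  define Cg where "Cg = KB * M + KA * (KB * M)"
  have Cg0: "0 \<le> Cg" using KA KB M0 by (simp add: Cg_def)
  have hb: "norm (h t) \<le> Cg" for t
  proof -
    have "norm (B *v f k t) \<le> KB * M" if "k \<le> 2" for k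
      by (rule order_trans[OF KB(2)]) (intro mult_left_mono C2_jet_bound[OF f that] KB(1))
    then have "norm (B *v f 2 t) \<le> KB * M" "norm (A *v (B *v f 0 t)) \<le> KA * (KB * M)"
      by (auto intro!: order_trans[OF KA(2)] mult_left_mono KA(1))
    then show ?thesis unfolding h_def Cg_def by (rule norm_triangle_le[OF add_mono])
  qed
  have ch: "continuous_on X h" for X
    unfolding h_def[abs_def]
    by (intro continuous_on_add bounded_linear.continuous_on[OF bl] C2_jet_continuous[OF f]) auto
  obtain K where K0: "0 \<le> K"
    and lev: "\<And>m a b g Gam. 1 \<le> m \<Longrightarrow> continuous_on {0..T} g \<Longrightarrow> (\<And>t. t \<in> {0..T} \<Longrightarrow> norm (g t) \<le> Gam)
      \<Longrightarrow> \<exists>v w. v 0 = a \<and> w 0 = b \<and>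
        (\<forall>t\<in>{0..T}. (v has_vector_derivative w t) (at t within {0..T}) \<and>
          (w has_vector_derivative g t - (2 * (real m)\<^sup>2) *\<^sub>R w t - (real m ^ 4) *\<^sub>R v t - A *v v t) (at t within {0..T}) \<and>
          norm (v t) \<le> K * (norm a + norm b / (real m)\<^sup>2 + Gam / real m ^ 4) \<and>
          norm (w t) \<le> K * ((real m)\<^sup>2 * (norm a + norm b / (real m)\<^sup>2 + Gam / real m ^ 4)))"
    using level_ode[OF less_imp_le[OF T] S(1) S0 E] by blast
  define Y where "Y m = (if m = 0 then 0 else
     K * (norm (coef m u0) + norm (coef m u1) / (real m)\<^sup>2 + (Cg / real m) / real m ^ 4))" for m
  define P where "P m V W \<longleftrightarrow> V 0 = coef m u0 \<and> W 0 = coef m u1 \<and>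
        (\<forall>t\<in>{0..T}. (V has_vector_derivative W t) (at t within {0..T}) \<and>
          (W has_vector_derivative - (hcoef m *\<^sub>R h t) - (2 * (real m)\<^sup>2) *\<^sub>R W t - (real m ^ 4) *\<^sub>R V t - A *v V t) (at t within {0..T}) \<and>
          norm (V t) \<le> Y m \<and> norm (W t) \<le> (real m)\<^sup>2 * Y m)" for m V W
  have "\<exists>V W. P m V W" if m: "1 \<le> m" for m
  proof -
    have g: "norm (- (hcoef m *\<^sub>R h t)) \<le> Cg / real m" if "t \<in> {0..T}" for t
    proof -
      have "\<bar>hcoef m\<bar> * norm (h t) \<le> (1 / real m) * Cg"
        by (intro mult_mono hcoef_bounds[OF m] hb) auto
      then show ?thesis by simp
    qed
    have cg: "continuous_on {0..T} (\<lambda>t. - (hcoef m *\<^sub>R h t))" by (intro continuous_intros ch)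
    from lev[OF m cg g, where a = "coef m u0" and b = "coef m u1"]
    show ?thesis using m unfolding P_def Y_def by (simp add: mult.left_commute)
  qed
  then obtain V W where VW: "\<And>m. 1 \<le> m \<Longrightarrow> P m (V m) (W m)" by metis
  define c where "c t m = (if m = 0 then 0 else V m t)" for t m
  define d where "d t m = (if m = 0 then 0 else W m t)" for t m
  have Y0: "0 \<le> Y m" for m using K0 Cg0 by (simp add: Y_def)
  have cb: "norm (c t m) \<le> Y m" if "t \<in> {0..T}" for t m
    using VW[of m] that Y0[of m] by (cases "m = 0") (auto simp: c_def P_def)
  have db: "norm (d t m) \<le> (real m)\<^sup>2 * Y m" if "t \<in> {0..T}" for t m
    using VW[of m] that Y0[of m] by (cases "m = 0") (auto simp: d_def P_def)
  have dc: "((\<lambda>t. c t m) has_vector_derivative d t m) (at t within {0..T})" if "t \<in> {0..T}" for t m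
    using VW[of m] that by (cases "m = 0") (auto simp: c_def d_def P_def)
  have dd: "((\<lambda>t. d t m) has_vector_derivative - (hcoef m *\<^sub>R h t) - (2 * (real m)\<^sup>2) *\<^sub>R d t m
      - (real m ^ 4) *\<^sub>R c t m - A *v c t m) (at t within {0..T})" if "t \<in> {0..T}" "1 \<le> m" for t m
    using VW[of m] that by (auto simp: c_def d_def P_def)
  have cc: "continuous_on {0..T} (\<lambda>t. c t m)" for m by (rule continuous_on_vector_derivative[OF dc])
  have cd: "continuous_on {0..T} (\<lambda>t. d t m)" for m
    by (cases "m = 0") (use continuous_on_vector_derivative[OF dd[of _ m]] in \<open>auto simp: d_def\<close>)
  have s6: "summable (\<lambda>m. real m powr 6 * (Y m)\<^sup>2)"
    unfolding Y_def[abs_def] by (rule mode_bounds_summable[OF u0 u1])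
  have s2: "summable (\<lambda>m. real m powr 2 * (Y m)\<^sup>2)"
  proof (rule summable_comparison_test'[OF s6, of 1])
    fix m :: nat assume "1 \<le> m"
    then have "real m powr 2 \<le> real m powr 6" by (intro powr_mono) auto
    then show "norm (real m powr 2 * (Y m)\<^sup>2) \<le> real m powr 6 * (Y m)\<^sup>2" by (simp add: mult_right_mono)
  qed
  have s2d: "summable (\<lambda>m. real m powr 2 * ((real m)\<^sup>2 * Y m)\<^sup>2)"
  proof -
    have "real m powr 2 * ((real m)\<^sup>2 * Y m)\<^sup>2 = real m powr 6 * (Y m)\<^sup>2" for m
      by (cases "m = 0") (simp_all add: power_mult_distrib flip: power_mult power_add mult.assoc)
    then show ?thesis using s6 by simp
  qed
  have sY: "summable Y" using summable_norm_of_weighted[of Y] s2 Y0 by simp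
  have sYd: "summable (\<lambda>m. (real m)\<^sup>2 * Y m)"
    using summable_norm_of_weighted[of "\<lambda>m. (real m)\<^sup>2 * Y m"] s2d Y0 by simp
  have sc: "summable (\<lambda>m. norm (c t m))" if "t \<in> {0..T}" for t
    by (rule summable_comparison_test'[OF sY]) (use cb[OF that] in auto)
  have sd: "summable (\<lambda>m. norm (d t m))" if "t \<in> {0..T}" for t
    by (rule summable_comparison_test'[OF sYd]) (use db[OF that] in auto)
  define v where "v t = synth (c t)" for t
  define w where "w t = synth (d t)" for t
  define u where "u t x = v t x + (x / pi) *\<^sub>R (B *v f 0 t)" for t x
  define ut where "ut t x = w t x + (x / pi) *\<^sub>R (B *v f 1 t)" for t x
  have uv: "unlift B (f 0) u = v" "unlift B (f 1) ut = w"
    by (simp_all add: unlift_def u_def[abs_def] ut_def[abs_def])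
  have "is_solution T A B u0 u1 (f 0) (f 1) (f 2) u ut"
    unfolding is_solution_def uv Let_def
  proof (intro conjI allI impI)
    show "C0_Xs T 3 v"
      unfolding v_def[abs_def] by (rule C0_Xs_synth[OF T cc cb sY]) (use s6 in auto)
    show "C1_Xs T 1 v w"
      unfolding v_def[abs_def] w_def[abs_def]
      by (rule C1_Xs_synth[OF T dc cd cb db sY _ sYd]) (use s2 s2d in auto)
    have c0: "c 0 = (\<lambda>m. coef m u0)" using VW by (auto simp: c_def P_def fun_eq_iff)
    have d0: "d 0 = (\<lambda>m. coef m u1)" using VW by (auto simp: d_def P_def fun_eq_iff)
    show "AE x in Omega. v 0 x = u0 x"
      using Xs_AE_synth[OF u0 Xs_coef_norm_summable[OF u0]] by (auto simp: v_def c0)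
    show "AE x in Omega. w 0 x = u1 x"
      using Xs_AE_synth[OF u1 Xs_coef_norm_summable[OF u1]] by (auto simp: w_def d0)
    fix m :: nat assume m: "1 \<le> m"
    have cv: "coef m (v t) = c t m" "coef m (w t) = d t m" if "t \<in> {0..T}" for t
      unfolding v_def w_def by (rule coef_synth[OF sc[OF that] m] coef_synth[OF sd[OF that] m])+
    define rhs where "rhs t = - (2 * (real m)\<^sup>2) *\<^sub>R coef m (w t) - (real m ^ 4) *\<^sub>R coef m (v t)
                - A *v coef m (v t) - hcoef m *\<^sub>R (B *v f 2 t + A *v (B *v f 0 t))" for t
    have rhs: "rhs t = - (hcoef m *\<^sub>R h t) - (2 * (real m)\<^sup>2) *\<^sub>R d t m
      - (real m ^ 4) *\<^sub>R c t m - A *v c t m" if "t \<in> {0..T}" for t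
      unfolding rhs_def cv[OF that] h_def by simp
    have "H2 T (\<lambda>t. coef m (v t)) (\<lambda>t. coef m (w t)) rhs"
    proof (rule H2I)
      fix t assume t: "t \<in> {0..T}"
      show "((\<lambda>t. coef m (v t)) has_vector_derivative coef m (w t)) (at t within {0..T})"
        unfolding cv(2)[OF t]
        by (rule has_vector_derivative_transform[OF t _ dc[OF t]]) (simp add: cv)
      show "((\<lambda>t. coef m (w t)) has_vector_derivative rhs t) (at t within {0..T})"
        unfolding rhs[OF t]
        by (rule has_vector_derivative_transform[OF t _ dd[OF t m]]) (simp add: cv)
    next
      have "continuous_on {0..T} (\<lambda>t. - (hcoef m *\<^sub>R h t) - (2 * (real m)\<^sup>2) *\<^sub>R d t m
        - (real m ^ 4) *\<^sub>R c t m - A *v c t m)"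
        by (intro continuous_intros ch cc cd bounded_linear.continuous_on[OF bl])
      then show "continuous_on {0..T} rhs" by (rule continuous_on_eq) (simp add: rhs)
    qed
    then show "H2 T (\<lambda>t. coef m (v t)) (\<lambda>t. coef m (w t))
           (\<lambda>t. - (2 * (real m)\<^sup>2) *\<^sub>R coef m (w t) - (real m ^ 4) *\<^sub>R coef m (v t)
                - A *v coef m (v t) - hcoef m *\<^sub>R (B *v f 2 t + A *v (B *v f 0 t)))"
      by (simp only: rhs_def[abs_def])
  qed
  then show ?thesis by blast
qed

lemma H2_norm_jet_le:
  assumes T: "0 < T" and f: "C2_jet 0 T M f"
  shows "H2_norm T (f 0) (f 1) (f 2) \<le> sqrt (3 * T) * M"
proof -
  have M0: "0 \<le> M" by (rule C2_jet_nonneg[OF f])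
  have "(LINT t|lebesgue_on {0..T}. (norm (f 0 t))\<^sup>2 + (norm (f 1 t))\<^sup>2 + (norm (f 2 t))\<^sup>2)
      \<le> (LINT t|lebesgue_on {0..T}. 3 * M\<^sup>2)"
  proof (rule integral_mono)
    show "integrable (lebesgue_on {0..T}) (\<lambda>t. (norm (f 0 t))\<^sup>2 + (norm (f 1 t))\<^sup>2 + (norm (f 2 t))\<^sup>2)"
      by (intro continuous_imp_integrable_real continuous_intros C2_jet_continuous[OF f]) auto
    show "integrable (lebesgue_on {0..T}) (\<lambda>t. 3 * M\<^sup>2)"
      by (intro continuous_imp_integrable_real continuous_intros)
    fix t
    have "(norm (f k t))\<^sup>2 \<le> M\<^sup>2" if "k \<le> 2" for k
      by (intro power_mono C2_jet_bound[OF f that]) auto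
    from this[of 0] this[of 1] this[of 2]
    show "(norm (f 0 t))\<^sup>2 + (norm (f 1 t))\<^sup>2 + (norm (f 2 t))\<^sup>2 \<le> 3 * M\<^sup>2" by simp
  qed
  also have "\<dots> = 3 * T * M\<^sup>2" using T by (simp add: measure_restrict_space)
  finally have "H2_norm T (f 0) (f 1) (f 2) \<le> sqrt (3 * T * M\<^sup>2)"
    unfolding H2_norm_def by (rule real_sqrt_le_mono)
  then show ?thesis using M0 by (simp add: real_sqrt_mult)
qed

lemma H2_zero_jet:
  assumes f: "C2_jet 0 T M f"
  shows "H2_zero T (f 0) (f 1) (f 2)"
proof -
  have "H2 T (f 0) (f 1) (f 2)"
  proof (rule H2I)
    show "(f 0 has_vector_derivative f 1 t) (at t within {0..T})" for t
      by (rule has_vector_derivative_at_within) (use C2_jet_deriv[OF f, of 0 t] in simp)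
    show "(f 1 has_vector_derivative f 2 t) (at t within {0..T})" for t
      by (rule has_vector_derivative_at_within)
        (use C2_jet_deriv[OF f, of 1 t] in \<open>simp add: numeral_2_eq_2\<close>)
    show "continuous_on {0..T} (f 2)" by (rule C2_jet_continuous[OF f]) simp
  qed
  then show ?thesis unfolding H2_zero_def using C2_jet_zero[OF f] by simp
qed

text \<open>The argument applies to any solution: its coefficients at time \<open>0\<close> are those of the data, its coefficients
at time \<open>T\<close> vanish, and the lifting vanishes at time \<open>T\<close>.\<close>

lemma solution_vanishes:
  fixes A :: "complex^'n^'n" and B :: "complex^'l^'n" and G :: "real \<Rightarrow> complex^'n^'n"
    and f :: "nat \<Rightarrow> real \<Rightarrow> complex^'l"
  assumes T: "0 < T" and S: "\<And>mu. mu \<in> S \<Longrightarrow> 0 \<le> mu"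
    and G: "\<And>v. (\<Sum>mu\<in>S. G mu *v v) = v" "\<And>mu v. G mu *v (A *v v) = mu *\<^sub>R (G mu *v v)"
    and f: "C2_jet 0 T M f" and u0: "u0 \<in> Xs 3" and u1: "u1 \<in> Xs 1"
    and mom0: "\<And>m th r. 1 \<le> m \<Longrightarrow> th\<^sup>2 \<in> S \<Longrightarrow> moment T 0 (freq m th) (\<lambda>t. (G (th\<^sup>2) *v (B *v f 0 t)) $ r)
        = (G (th\<^sup>2) *v target0 m th (coef m u0) (coef m u1)) $ r"
    and mom1: "\<And>m r. 1 \<le> m \<Longrightarrow> 0 \<in> S \<Longrightarrow> moment T 1 (freq m 0) (\<lambda>t. (G 0 *v (B *v f 0 t)) $ r)
        = (G 0 *v target1 m (coef m u0) (coef m u1)) $ r"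
    and sol: "is_solution T A B u0 u1 (f 0) (f 1) (f 2) u ut"
  shows "AE x in Omega. u T x = 0" "AE x in Omega. ut T x = 0"
proof -
  define v where "v = unlift B (f 0) u"
  define w where "w = unlift B (f 1) ut"
  have C0: "C0_Xs T 3 v" and C1: "C1_Xs T 1 v w"
    and i0: "AE x in Omega. v 0 x = u0 x" and i1: "AE x in Omega. w 0 x = u1 x"
    and H: "\<And>m. 1 \<le> m \<Longrightarrow> H2 T (\<lambda>t. coef m (v t)) (\<lambda>t. coef m (w t))
           (\<lambda>t. - (2 * (real m)\<^sup>2) *\<^sub>R coef m (w t) - (real m ^ 4) *\<^sub>R coef m (v t)
                - A *v coef m (v t) - hcoef m *\<^sub>R (B *v f 2 t + A *v (B *v f 0 t)))"
    using sol by (simp_all add: is_solution_def Let_def v_def w_def)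
  have vX: "v t \<in> Xs 3" and wX: "w t \<in> Xs 1" if "t \<in> {0..T}" for t
    using C0 C1 that by (auto simp: C0_Xs_def C1_Xs_def)
  have sq: "sq_integrable Omega y" if "y \<in> Xs s" for y :: "real \<Rightarrow> complex^'n" and s
    using that by (simp add: Xs_def)
  have t0: "0 \<in> {0..T}" "T \<in> {0..T}" using T by auto
  have in0: "coef m (v 0) = coef m u0" for m
    by (rule coef_cong_AE[OF sq[OF vX[OF t0(1)]] sq[OF u0] i0])
  have in1: "coef m (w 0) = coef m u1" for m
    by (rule coef_cong_AE[OF sq[OF wX[OF t0(1)]] sq[OF u1] i1])
  have van: "coef m (v T) = 0" "coef m (w T) = 0" if m: "1 \<le> m" for m
    by (rule coefficients_vanish[OF T S m G f H[OF m]];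
        simp only: in0 in1; rule mom0[OF m] mom1[OF m]; assumption)+
  have "v T = u T" "w T = ut T"
    using C2_jet_zero[OF f, of 0 T] C2_jet_zero[OF f, of 1 T] by (simp_all add: v_def w_def unlift_def)
  then show "AE x in Omega. u T x = 0" "AE x in Omega. ut T x = 0"
    using Xs_AE_zero[OF vX[OF t0(2)] van(1)] Xs_AE_zero[OF wX[OF t0(2)] van(2)] by simp_all
qed

theorem theorem5:
  fixes T :: real and A :: "complex^'n^'n" and B :: "complex^'l^'n"
  assumes "T > 0"
    and "pos_semidef A"
    and "\<And>lam. lam \<in> spectrum A \<Longrightarrow> rank (hcat (mat lam - A) B) = CARD('n)"
  shows "\<exists>C. \<forall>u0\<in>Xs 3. \<forall>u1\<in>Xs 1. \<exists>f f1 f2.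
           H2_zero T f f1 f2 \<and>
           (\<exists>u ut. is_solution T A B u0 u1 f f1 f2 u ut) \<and>
           (\<forall>u ut. is_solution T A B u0 u1 f f1 f2 u ut \<longrightarrow>
              (AE x in Omega. u T x = 0) \<and> (AE x in Omega. ut T x = 0)) \<and>
           H2_norm T f f1 f2 \<le> C * (Xs_norm 3 u0 + Xs_norm 1 u1)"
proof -
  obtain S E G where S: "finite S" "S \<subseteq> real_eigenvalues A"
    and "\<And>v. (\<Sum>mu\<in>S. E mu *v v) = v" "\<And>mu v. A *v (E mu *v v) = mu *\<^sub>R (E mu *v v)"
    and G: "\<And>v. (\<Sum>mu\<in>S. G mu *v v) = v" "\<And>mu v. G mu *v (A *v v) = mu *\<^sub>R (G mu *v v)"
    by (rule spectral_resolution[OF assms(2)]) blast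
  have S0: "0 \<le> mu" if "mu \<in> S" for mu using real_eigenvalues_nonneg[OF assms(2)] S(2) that by blast
  have "\<exists>R :: complex^'n^'l. \<forall>v. G mu *v (B *v (R *v v)) = G mu *v v" if "mu \<in> S" for mu
  proof -
    have "complex_of_real mu \<in> spectrum A" using S(2) that by (auto intro: real_eigenvalues_spectrum)
    from hautus_right_inverse[OF assms(3)[OF this] G(2)] show ?thesis by metis
  qed
  then obtain R :: "real \<Rightarrow> complex^'n^'l"
    where R: "\<And>mu v. mu \<in> S \<Longrightarrow> G mu *v (B *v (R mu *v v)) = G mu *v v" by metis
  \<comment> \<open>Both square roots of each eigenvalue occur as imaginary parts of the exponents.\<close>
  define Theta where "Theta = {th. th\<^sup>2 \<in> S}"
  have "Theta \<subseteq> sqrt ` S \<union> (\<lambda>mu. - sqrt mu) ` S"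
  proof
    fix th assume "th \<in> Theta"
    then have "th\<^sup>2 \<in> S" by (simp add: Theta_def)
    moreover have "th = sqrt (th\<^sup>2) \<or> th = - sqrt (th\<^sup>2)"
      unfolding real_sqrt_abs by linarith
    ultimately show "th \<in> sqrt ` S \<union> (\<lambda>mu. - sqrt mu) ` S" by blast
  qed
  then have fT: "finite Theta" by (rule finite_subset) (use S(1) in simp)
  obtain D where D: "0 < D" "\<And>th. th \<in> Theta \<Longrightarrow> \<bar>th\<bar> \<le> D" using finite_separation[OF fT] by metis
  obtain C where C: "0 \<le> C" and control: "\<And>N d. 0 \<le> N \<Longrightarrow> (\<And>n th j. 1 \<le> n \<Longrightarrow> th \<in> Theta \<Longrightarrow> norm (d n th j) \<le> N) \<Longrightarrow>
      \<exists>F. C2_jet 0 T (C * N) F \<and>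
        (\<forall>m\<ge>1. \<forall>th\<in>Theta. \<forall>i<2. \<forall>r. moment T i (freq m th) (\<lambda>t. (G (th\<^sup>2) *v (B *v F 0 t)) $ r)
           = (G (th\<^sup>2) *v d m th i) $ r)"
    by (rule moment_problem[OF assms(1) fT, of "\<lambda>th. G (th\<^sup>2)" B "\<lambda>th. R (th\<^sup>2)"])
       (auto simp: Theta_def R)
  define K where "K = 10 * (1 + D)"
  have K: "0 \<le> K" using D by (simp add: K_def)
  show ?thesis
  proof (intro exI[of _ "sqrt (3 * T) * (C * K)"] ballI)
    fix u0 u1 :: "real \<Rightarrow> complex^'n" assume u0: "u0 \<in> Xs 3" and u1: "u1 \<in> Xs 1"
    define N where "N = Xs_norm 3 u0 + Xs_norm 1 u1"
    have Nb: "norm (coef m u0) + norm (coef m u1) \<le> N" if "1 \<le> m" for m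
      unfolding N_def using that by (intro add_mono coef_le_Xs_norm u0 u1) auto
    have N0: "0 \<le> N" using Nb[of 1] norm_ge_zero[of "coef 1 u0"] norm_ge_zero[of "coef 1 u1"] by linarith
    define d where "d m th j = (if j = 0 then target0 m th (coef m u0) (coef m u1)
      else target1 m (coef m u0) (coef m u1))" for m th and j :: nat
    have db: "norm (d m th j) \<le> K * N" if m: "1 \<le> m" and th: "th \<in> Theta" for m th j
    proof -
      have "norm (target0 m th (coef m u0) (coef m u1)) \<le> 2 * (1 + D) * (norm (coef m u0) + norm (coef m u1))"
        by (rule target0_bound[OF m D(2)[OF th]])
      also have "\<dots> \<le> K * N" using Nb[OF m] D K by (intro mult_mono) (auto simp: K_def)
      finally have 0: "norm (target0 m th (coef m u0) (coef m u1)) \<le> K * N" .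
      have "norm (target1 m (coef m u0) (coef m u1)) \<le> 10 * (norm (coef m u0) + norm (coef m u1))"
        by (rule target1_bound[OF m])
      also have "\<dots> \<le> K * N" using Nb[OF m] D K by (intro mult_mono) (auto simp: K_def)
      finally show ?thesis using 0 by (simp add: d_def)
    qed
    obtain f where f: "C2_jet 0 T (C * (K * N)) f"
      and mom: "\<And>m th i r. 1 \<le> m \<Longrightarrow> th \<in> Theta \<Longrightarrow> i < 2 \<Longrightarrow>
        moment T i (freq m th) (\<lambda>t. (G (th\<^sup>2) *v (B *v f 0 t)) $ r) = (G (th\<^sup>2) *v d m th i) $ r"
      using control[of "K * N" d, OF mult_nonneg_nonneg[OF K N0] db] by blast
    have mom0: "moment T 0 (freq m th) (\<lambda>t. (G (th\<^sup>2) *v (B *v f 0 t)) $ r)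
        = (G (th\<^sup>2) *v target0 m th (coef m u0) (coef m u1)) $ r" if "1 \<le> m" "th\<^sup>2 \<in> S" for m th r
      using mom[of m th 0 r] that by (simp add: Theta_def d_def)
    have mom1: "moment T 1 (freq m 0) (\<lambda>t. (G 0 *v (B *v f 0 t)) $ r)
        = (G 0 *v target1 m (coef m u0) (coef m u1)) $ r" if "1 \<le> m" "0 \<in> S" for m r
      using mom[of m 0 1 r] that by (simp add: Theta_def d_def)
    have "H2_norm T (f 0) (f 1) (f 2) \<le> sqrt (3 * T) * (C * (K * N))"
      by (rule H2_norm_jet_le[OF assms(1) f])
    then have bound: "H2_norm T (f 0) (f 1) (f 2) \<le> sqrt (3 * T) * (C * K) * (Xs_norm 3 u0 + Xs_norm 1 u1)"
      by (simp add: N_def mult.assoc)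
    show "\<exists>f f1 f2. H2_zero T f f1 f2 \<and>
           (\<exists>u ut. is_solution T A B u0 u1 f f1 f2 u ut) \<and>
           (\<forall>u ut. is_solution T A B u0 u1 f f1 f2 u ut \<longrightarrow>
              (AE x in Omega. u T x = 0) \<and> (AE x in Omega. ut T x = 0)) \<and>
           H2_norm T f f1 f2 \<le> sqrt (3 * T) * (C * K) * (Xs_norm 3 u0 + Xs_norm 1 u1)"
      using H2_zero_jet[OF f] solution_exists[OF assms(1,2) u0 u1 f, of B]
        solution_vanishes[OF assms(1) S0 G f u0 u1 mom0 mom1] bound by blast
  qed
qed

end
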